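(* For any $\epsilon>0$, there is a polynomial time two-sided distribution-free adaptive algorithm for $\epsilon$-testing $k$-Junta that makes $\tilde O(k/\epsilon)$ queries.
   Context: Boolean functions $f:\{0,1\}^n\to\{0,1\}$ are accessed through a membership-query oracle that returns $f(x)$ for a queried $x\in\{0,1\}^n$. For a distribution $\mathcal D$ on $\{0,1\}^n$, $f$ is $\epsilon$-far from a class $C$ with respect to $\mathcal D$ if $\Pr_{x\sim\mathcal D}[f(x)\neq g(x)]\ge\epsilon$ for every $g\in C$. A two-sided distribution-free adaptive algorithm for $\epsilon$-testing $C$ is a randomized algorithm that, given $\epsilon$, membership-query access to an arbitrary Boolean function $f$, and an oracle returning independent samples drawn from an arbitrary unknown distribution $\mathcal D$ on $\{0,1\}^n$, chooses its queries possibly adaptively and, for every $\mathcal D$: accepts with probability at least $2/3$ if $f\in C$, and rejects with probability at least $2/3$ if $f$ is $\epsilon$-far from every function in $C$ with respect to $\mathcal D$. The number of queries counts both membership queries and samples. $\tilde O(T)$ means $O(T\cdot\mathrm{poly}(\log T))$. A function is a $k$-junta if it depends on at most $k$ of its coordinates; $k$-Junta is the class of all $k$-juntas. *)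

theory Defs
  imports "HOL-Probability.Probability"
begin

definition cube :: "nat \<Rightarrow> bool list set" where
  "cube n = {x. length x = n}"

text \<open>
  A Boolean function on the \<open>n\<close>-cube is a function on \<open>bool list\<close> of which only the values on
  \<open>cube n\<close> are ever looked at.
\<close>

definition depends_on :: "nat \<Rightarrow> (bool list \<Rightarrow> bool) \<Rightarrow> nat \<Rightarrow> bool" where
  "depends_on n f i \<longleftrightarrow> (\<exists>x\<in>cube n. f (x[i := \<not> x ! i]) \<noteq> f x)"

definition juntas :: "nat \<Rightarrow> nat \<Rightarrow> (bool list \<Rightarrow> bool) set" where
  "juntas n k = {f. card {i. i < n \<and> depends_on n f i} \<le> k}"

definition eps_far ::
  "bool list pmf \<Rightarrow> real \<Rightarrow> (bool list \<Rightarrow> bool) set \<Rightarrow> (bool list \<Rightarrow> bool) \<Rightarrow> bool" where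
  "eps_far D \<epsilon> C f \<longleftrightarrow> (\<forall>g\<in>C. measure_pmf.prob D {x. f x \<noteq> g x} \<ge> \<epsilon>)"

text \<open>
  Algorithms are programs of a random access machine whose cells hold natural numbers, extended
  with fair coin flips and the two oracles; each step costs one unit of time. The only arithmetic
  operations are addition and truncated subtraction, so a step lengthens the binary representation
  of the largest stored number by at most a constant (depending on the program). Hence polynomial
  time on this machine is the same as polynomial time on a probabilistic oracle Turing machine;
  with a unit-cost multiplication this would fail.
\<close>

type_synonym mem = "nat \<Rightarrow> nat"

datatype expr = Lit nat | Cell expr | Add expr expr | Sub expr expr

fun val :: "mem \<Rightarrow> expr \<Rightarrow> nat" where
  "val m (Lit c) = c"
| "val m (Cell e) = m (val m e)"
| "val m (Add e1 e2) = val m e1 + val m e2"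
| "val m (Sub e1 e2) = val m e1 - val m e2"

text \<open>
  The first argument of \<open>Store\<close>, \<open>Flip\<close> and \<open>Query\<close> is the address of the cell that receives the
  result. A point of the \<open>n\<close>-cube occupies \<open>n\<close> consecutive cells, a nonzero cell standing for
  \<open>True\<close>; the last argument of \<open>Query\<close> and the argument of \<open>Sample\<close> are the address of its first
  cell. Conditions of \<open>Cond\<close> and \<open>Loop\<close> hold if they are nonzero.
\<close>

datatype com =
    Store expr expr
  | Flip expr
  | Query expr expr
  | Sample expr
  | Seq com com
  | Cond expr com com
  | Loop expr com

definition read_point :: "nat \<Rightarrow> mem \<Rightarrow> nat \<Rightarrow> bool list" where
  "read_point n m a = map (\<lambda>i. m (a + i) \<noteq> 0) [0..<n]"

definition write_point :: "nat \<Rightarrow> bool list \<Rightarrow> nat \<Rightarrow> mem \<Rightarrow> mem" where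
  "write_point n x a m = (\<lambda>j. if a \<le> j \<and> j < a + n then of_bool (x ! (j - a)) else m j)"

text \<open>
  A configuration consists of the stack of commands still to be executed, the memory, and the
  number of oracle calls (membership queries and samples) made so far. The machine has halted when
  the stack is empty.
\<close>

type_synonym config = "com list \<times> mem \<times> nat"

fun step :: "nat \<Rightarrow> (bool list \<Rightarrow> bool) \<Rightarrow> bool list pmf \<Rightarrow> config \<Rightarrow> config pmf" where
  "step n f D ([], m, q) = return_pmf ([], m, q)"
| "step n f D (Store a e # K, m, q) = return_pmf (K, m(val m a := val m e), q)"
| "step n f D (Flip a # K, m, q) =
     map_pmf (\<lambda>b. (K, m(val m a := of_bool b), q)) (bernoulli_pmf (1/2))"
| "step n f D (Query a e # K, m, q) =
     return_pmf (K, m(val m a := of_bool (f (read_point n m (val m e)))), Suc q)"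
| "step n f D (Sample a # K, m, q) =
     map_pmf (\<lambda>x. (K, write_point n x (val m a) m, Suc q)) D"
| "step n f D (Seq c1 c2 # K, m, q) = return_pmf (c1 # c2 # K, m, q)"
| "step n f D (Cond e c1 c2 # K, m, q) =
     return_pmf ((if val m e \<noteq> 0 then c1 else c2) # K, m, q)"
| "step n f D (Loop e c # K, m, q) =
     return_pmf (if val m e \<noteq> 0 then c # Loop e c # K else K, m, q)"

fun run :: "nat \<Rightarrow> (bool list \<Rightarrow> bool) \<Rightarrow> bool list pmf \<Rightarrow> nat \<Rightarrow> config \<Rightarrow> config pmf" where
  "run n f D 0 s = return_pmf s"
| "run n f D (Suc t) s = bind_pmf (step n f D s) (run n f D t)"

text \<open>
  A real \<open>\<epsilon>\<close> does not fit into a cell. The program is given the integer \<open>\<lceil>1/\<epsilon>\<rceil>\<close> instead and has to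
  be correct for the real number \<open>\<epsilon>\<close> itself.
\<close>

definition start :: "com \<Rightarrow> nat \<Rightarrow> nat \<Rightarrow> real \<Rightarrow> config" where
  "start P n k \<epsilon> = ([P], (\<lambda>_. 0)(0 := n, 1 := k, 2 := nat \<lceil>1 / \<epsilon>\<rceil>), 0)"

definition halted :: "config \<Rightarrow> bool" where
  "halted s \<longleftrightarrow> fst s = []"

definition queries :: "config \<Rightarrow> nat" where
  "queries s = snd (snd s)"

text \<open>
  The verdict is read off cell 0 after halting. Halted configurations do not change any more, so
  the probabilities below increase with \<open>t\<close>, and their suprema are the probabilities that the
  program ever halts with the respective verdict.
\<close>

definition accept_prob ::
  "com \<Rightarrow> nat \<Rightarrow> nat \<Rightarrow> real \<Rightarrow> (bool list \<Rightarrow> bool) \<Rightarrow> bool list pmf \<Rightarrow> real" where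
  "accept_prob P n k \<epsilon> f D =
     (SUP t. measure_pmf.prob (run n f D t (start P n k \<epsilon>)) {s. halted s \<and> fst (snd s) 0 \<noteq> 0})"

definition reject_prob ::
  "com \<Rightarrow> nat \<Rightarrow> nat \<Rightarrow> real \<Rightarrow> (bool list \<Rightarrow> bool) \<Rightarrow> bool list pmf \<Rightarrow> real" where
  "reject_prob P n k \<epsilon> f D =
     (SUP t. measure_pmf.prob (run n f D t (start P n k \<epsilon>)) {s. halted s \<and> fst (snd s) 0 = 0})"

definition junta_tester :: "com \<Rightarrow> bool" where
  "junta_tester P \<longleftrightarrow>
     (\<forall>n k \<epsilon> f D. 1 \<le> k \<longrightarrow> 0 < \<epsilon> \<longrightarrow> set_pmf D \<subseteq> cube n \<longrightarrow>
        (f \<in> juntas n k \<longrightarrow> accept_prob P n k \<epsilon> f D \<ge> 2/3) \<and>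
        (eps_far D \<epsilon> (juntas n k) f \<longrightarrow> reject_prob P n k \<epsilon> f D \<ge> 2/3))"

definition polynomial_time :: "com \<Rightarrow> bool" where
  "polynomial_time P \<longleftrightarrow>
     (\<exists>c d :: nat. \<forall>n k \<epsilon> f D. 1 \<le> k \<longrightarrow> 0 < \<epsilon> \<longrightarrow> set_pmf D \<subseteq> cube n \<longrightarrow>
        (\<exists>t. real t \<le> real c * (real n + real k + 1 / \<epsilon> + 1) ^ d \<and>
             (\<forall>s\<in>set_pmf (run n f D t (start P n k \<epsilon>)). halted s)))"

text \<open>
  The worst-case number of queries is \<open>O(T (log T)\<^sup>d)\<close> for some \<open>d\<close>, uniformly in all parameters.
  The shift by 2 keeps the logarithm at least 1 for small \<open>T\<close>.
\<close>

definition soft_O_queries :: "com \<Rightarrow> (nat \<Rightarrow> real \<Rightarrow> real) \<Rightarrow> bool" where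
  "soft_O_queries P T \<longleftrightarrow>
     (\<exists>c d :: nat. \<forall>n k \<epsilon> f D. 1 \<le> k \<longrightarrow> 0 < \<epsilon> \<longrightarrow> set_pmf D \<subseteq> cube n \<longrightarrow>
        (\<forall>t. \<forall>s\<in>set_pmf (run n f D t (start P n k \<epsilon>)).
           real (queries s) \<le> real c * T k \<epsilon> * log 2 (T k \<epsilon> + 2) ^ d))"

end

theory Submission
  imports Defs
begin

text \<open>
  The coordinates are divided at random into so many blocks that the relevant variables of a
  \<open>k\<close>-junta are likely to lie in different blocks. A sample on which \<open>f\<close> changes when the coordinates
  outside the blocks found so far are set to 0 yields, by binary search, a further relevant block
  \<open>B\<close> and a point \<open>v\<close> on which \<open>B\<close> matters. The search stops after an epoch of samples without
  success; then \<open>f\<close> is probably close to its restriction to the blocks found. More than \<open>k\<close> blocks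
  refute that \<open>f\<close> is a \<open>k\<close>-junta.

  If \<open>f\<close> is a junta with separated variables, then as a function of the coordinates in \<open>B\<close>, with the
  other ones fixed by \<open>v\<close>, it is a literal of some variable \<open>\<tau>\<close>. For any point \<open>x\<close> the value of \<open>x\<close> at
  \<open>\<tau>\<close> can therefore be read off without knowing \<open>\<tau>\<close>: resampling those coordinates in \<open>B\<close> where \<open>x\<close> is 0
  (or 1) can change the value of \<open>f\<close> for exactly one of the two sides. The test reads these bits off
  for uniform points and for samples, rejects if for some block none or both of the sides matter, and
  also if the value of \<open>f\<close> at the masked point differs from its value at the point that is constant
  on every block with the bit read off.

  Soundness: the influence of a set of coordinates under resampling is a sum of nonnegative weights
  of the sets meeting it. A block of small influence is rejected since no side matters. If no single
  variable has at least half of the influence of the whole block, a uniform point splits the block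
  into two sides that matter with noticeable probability. Otherwise every block has a variable
  \<open>\<tau>\<close> that determines the bit read off, and the last comparison is with a junta of these variables.
\<close>

text \<open>Rows are never certified one at a time. A round reads all rows for one point and is lost
  as soon as one row misbehaves, so the number of rounds does not grow with \<open>k\<close>, while
  a round costs \<open>k\<close> times a power of a logarithm. It suffices that bad rows lose each
  round with probability about \<epsilon>, up to such powers.

  The obstacle is a block of small but not negligible influence. With \<open>m1\<close> trials per
  side, influence at most \<open>1/(4 m1)\<close> usually leaves both flags down. A larger influence
  that is spread over several variables raises both flags with probability of order
  \<open>1/m1^2\<close>. Otherwise a single variable has influence at least \<open>1/(8 m1)\<close>,
  which \<open>m1\<close> trials may well miss; therefore samples are read with
  \<open>m2 = 8 m1^2\<close> trials, which miss it with probability at most \<open>exp(-m1)\<close>.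
  For a junta, \<open>m1\<close> of logarithmic size is enough, since a literal has influence
  exactly 1/2 and the opposite side has influence 0.

  The analysis concerns plain distributions. The machine realises them exactly, with worst-case
  bounds on time and queries, so the refinement adds no error.\<close>

section \<open>Refinement of machine programs by probability distributions\<close>

text \<open>\<open>P\<close> is a joint law of the outcome, the memory, the queries and the time
  spent. It is chosen before the continuation \<open>K\<close>, the counter \<open>q\<close> and the
  clock \<open>t\<close>, which is what makes refinements compose. \<open>R\<close> ties outcome and
  memory only loosely, so temporaries stay unspecified; the time may be random, since only the
  remaining \<open>t - \<tau>\<close> steps are passed on.\<close>

definition implements ::
  "nat \<Rightarrow> (bool list \<Rightarrow> bool) \<Rightarrow> bool list pmf \<Rightarrow> com \<Rightarrow> mem \<Rightarrow> 'a pmf \<Rightarrow>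
    ('a \<Rightarrow> mem \<Rightarrow> bool) \<Rightarrow> nat \<Rightarrow> nat \<Rightarrow> bool" where
  "implements n f D c m p R T Q \<longleftrightarrow> (\<exists>P :: ('a \<times> mem \<times> nat \<times> nat) pmf.
     map_pmf fst P = p \<and>
     (\<forall>(a, m', q, \<tau>)\<in>set_pmf P. R a m' \<and> q \<le> Q \<and> \<tau> \<le> T) \<and>
     (\<forall>K q t. T \<le> t \<longrightarrow> run n f D t (c # K, m, q) =
        bind_pmf P (\<lambda>(a, m', q', \<tau>). run n f D (t - \<tau>) (K, m', q + q'))))"

lemma implements_weaken:
  assumes "implements n f D c m p R T Q" "\<And>a m'. a \<in> set_pmf p \<Longrightarrow> R a m' \<Longrightarrow> R' a m'" "T \<le> T'" "Q \<le> Q'"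
  shows "implements n f D c m p R' T' Q'"
proof -
  obtain P where P: "map_pmf fst P = p"
    "\<forall>(a, m', q, \<tau>)\<in>set_pmf P. R a m' \<and> q \<le> Q \<and> \<tau> \<le> T"
    "\<forall>K q t. T \<le> t \<longrightarrow> run n f D t (c # K, m, q) =
        bind_pmf P (\<lambda>(a, m', q', \<tau>). run n f D (t - \<tau>) (K, m', q + q'))"
    using assms(1) unfolding implements_def by blast
  have "a \<in> set_pmf p" if "(a, m', q, \<tau>) \<in> set_pmf P" for a m' q \<tau>
    using that P(1) by force
  then show ?thesis
    unfolding implements_def using P assms(2-4) by (intro exI[of _ P]) fastforce
qed

lemma implements_mono:
  "implements n f D c m p R T Q \<Longrightarrow> T \<le> T' \<Longrightarrow> implements n f D c m p R T' Q"
  by (rule implements_weaken) auto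

lemma implements_single_step:
  assumes "\<And>K q. step n f D (c # K, m, q) = map_pmf (\<lambda>a. (K, g a, q + i)) p"
    and "\<And>a. a \<in> set_pmf p \<Longrightarrow> R a (g a)"
  shows "implements n f D c m p R 1 i"
  unfolding implements_def
proof (intro exI[of _ "map_pmf (\<lambda>a. (a, g a, i, 1::nat)) p"] conjI allI impI)
  show "map_pmf fst (map_pmf (\<lambda>a. (a, g a, i, 1::nat)) p) = p"
    by (simp add: pmf.map_comp o_def)
  show "\<forall>(a, m', q, \<tau>)\<in>set_pmf (map_pmf (\<lambda>a. (a, g a, i, 1::nat)) p). R a m' \<and> q \<le> i \<and> \<tau> \<le> 1"
    using assms(2) by auto
next
  fix K q and t :: nat
  assume "1 \<le> t"
  then obtain t' where "t = Suc t'"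
    by (cases t) auto
  then show "run n f D t (c # K, m, q) = bind_pmf (map_pmf (\<lambda>a. (a, g a, i, 1::nat)) p)
      (\<lambda>(a, m', q', \<tau>). run n f D (t - \<tau>) (K, m', q + q'))"
    by (simp add: assms(1) bind_map_pmf)
qed

lemma implements_Store: "R x (m(val m a := val m e)) \<Longrightarrow> implements n f D (Store a e) m (return_pmf x) R 1 0"
  by (rule implements_single_step[where g = "\<lambda>_. m(val m a := val m e)"]) auto

lemma implements_Flip:
  "(\<And>b. R b (m(val m a := of_bool b))) \<Longrightarrow> implements n f D (Flip a) m (bernoulli_pmf (1/2)) R 1 0"
  by (rule implements_single_step[where g = "\<lambda>b. m(val m a := of_bool b)"]) auto

lemma implements_Query:
  "R x (m(val m a := of_bool (f (read_point n m (val m e))))) \<Longrightarrow>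
    implements n f D (Query a e) m (return_pmf x) R 1 1"
  by (rule implements_single_step
      [where g = "\<lambda>_. m(val m a := of_bool (f (read_point n m (val m e))))"]) auto

lemma implements_Sample:
  "(\<And>x. x \<in> set_pmf D \<Longrightarrow> R x (write_point n x (val m a) m)) \<Longrightarrow>
    implements n f D (Sample a) m D R 1 1"
  by (rule implements_single_step[where g = "\<lambda>x. write_point n x (val m a) m"]) auto

lemma implements_map:
  assumes "implements n f D c m p R T Q" "\<And>a m'. a \<in> set_pmf p \<Longrightarrow> R a m' \<Longrightarrow> R' (g a) m'"
  shows "implements n f D c m (map_pmf g p) R' T Q"
proof -
  obtain P where P: "map_pmf fst P = p"
    "\<forall>(a, m', q, \<tau>)\<in>set_pmf P. R a m' \<and> q \<le> Q \<and> \<tau> \<le> T"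
    "\<forall>K q t. T \<le> t \<longrightarrow> run n f D t (c # K, m, q) =
        bind_pmf P (\<lambda>(a, m', q', \<tau>). run n f D (t - \<tau>) (K, m', q + q'))"
    using assms(1) unfolding implements_def by blast
  have *: "a \<in> set_pmf p" if "(a, m', q, \<tau>) \<in> set_pmf P" for a m' q \<tau>
    using that P(1) by force
  show ?thesis
    unfolding implements_def
  proof (intro exI[of _ "map_pmf (\<lambda>(a, m', q, \<tau>). (g a, m', q, \<tau>)) P"] conjI allI impI)
    show "map_pmf fst (map_pmf (\<lambda>(a, m', q, \<tau>). (g a, m', q, \<tau>)) P) = map_pmf g p"
      unfolding P(1)[symmetric] by (simp add: pmf.map_comp o_def case_prod_beta)
    show "\<forall>(a, m', q, \<tau>)\<in>set_pmf (map_pmf (\<lambda>(a, m', q, \<tau>). (g a, m', q, \<tau>)) P).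
        R' a m' \<and> q \<le> Q \<and> \<tau> \<le> T"
      using P(2) * assms(2) by fastforce
  next
    fix K q and t :: nat
    assume "T \<le> t"
    then show "run n f D t (c # K, m, q) = bind_pmf (map_pmf (\<lambda>(a, m', q, \<tau>). (g a, m', q, \<tau>)) P)
        (\<lambda>(a, m', q', \<tau>). run n f D (t - \<tau>) (K, m', q + q'))"
      using P(3) by (simp add: bind_map_pmf case_prod_unfold)
  qed
qed

text \<open>\<open>Seq\<close>, \<open>Cond\<close> and \<open>Loop\<close> all replace the top
  command by some list \<open>cs\<close> in one deterministic step without a query; their rules
  differ only in what is known about \<open>cs\<close>.\<close>

lemma implements_prefix_step:
  assumes "\<And>K q. step n f D (c # K, m, q) = return_pmf (cs @ K, m, q)"
    and "\<exists>P :: ('a \<times> mem \<times> nat \<times> nat) pmf. map_pmf fst P = p \<and>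
     (\<forall>(a, m', q, \<tau>)\<in>set_pmf P. R a m' \<and> q \<le> Q \<and> \<tau> \<le> T) \<and>
     (\<forall>K q t. T \<le> t \<longrightarrow> run n f D t (cs @ K, m, q) =
        bind_pmf P (\<lambda>(a, m', q', \<tau>). run n f D (t - \<tau>) (K, m', q + q')))"
  shows "implements n f D c m p R (Suc T) Q"
proof -
  obtain P where P: "map_pmf fst P = p"
    "\<forall>(a, m', q, \<tau>)\<in>set_pmf P. R a m' \<and> q \<le> Q \<and> \<tau> \<le> T"
    "\<forall>K q t. T \<le> t \<longrightarrow> run n f D t (cs @ K, m, q) =
        bind_pmf P (\<lambda>(a, m', q', \<tau>). run n f D (t - \<tau>) (K, m', q + q'))"
    using assms(2) by blast
  show ?thesis
    unfolding implements_def
  proof (intro exI[of _ "map_pmf (\<lambda>(a, m', q, \<tau>). (a, m', q, Suc \<tau>)) P"] conjI allI impI)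
    show "map_pmf fst (map_pmf (\<lambda>(a, m', q, \<tau>). (a, m', q, Suc \<tau>)) P) = p"
      unfolding P(1)[symmetric] pmf.map_comp by (rule map_pmf_cong) auto
    show "\<forall>(a, m', q, \<tau>)\<in>set_pmf (map_pmf (\<lambda>(a, m', q, \<tau>). (a, m', q, Suc \<tau>)) P).
        R a m' \<and> q \<le> Q \<and> \<tau> \<le> Suc T"
      using P(2) by fastforce
  next
    fix K q and t :: nat
    assume "Suc T \<le> t"
    then obtain t' where t': "t = Suc t'" "T \<le> t'"
      by (cases t) auto
    then show "run n f D t (c # K, m, q) = bind_pmf (map_pmf (\<lambda>(a, m', q, \<tau>). (a, m', q, Suc \<tau>)) P)
        (\<lambda>(a, m', q', \<tau>). run n f D (t - \<tau>) (K, m', q + q'))"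
      using P(3) by (simp add: assms(1) bind_map_pmf bind_return_pmf case_prod_unfold)
  qed
qed

text \<open>Stated for the stack \<open>[c1, c2]\<close> instead of \<open>Seq\<close>, so that a
  loop body followed by its loop is covered too. The two joint laws are chained and their costs
  added.\<close>

lemma implements_two:
  fixes p1 :: "'a pmf" and p2 :: "'a \<Rightarrow> 'b pmf"
  assumes "implements n f D c1 m p1 R1 T1 Q1"
    and "\<And>a m'. a \<in> set_pmf p1 \<Longrightarrow> R1 a m' \<Longrightarrow> implements n f D c2 m' (p2 a) R2 T2 Q2"
  shows "\<exists>P :: ('b \<times> mem \<times> nat \<times> nat) pmf. map_pmf fst P = bind_pmf p1 p2 \<and>
     (\<forall>(a, m', q, \<tau>)\<in>set_pmf P. R2 a m' \<and> q \<le> Q1 + Q2 \<and> \<tau> \<le> T1 + T2) \<and>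
     (\<forall>K q t. T1 + T2 \<le> t \<longrightarrow> run n f D t ([c1, c2] @ K, m, q) =
        bind_pmf P (\<lambda>(a, m', q', \<tau>). run n f D (t - \<tau>) (K, m', q + q')))"
proof -
  obtain P1 where P1: "map_pmf fst P1 = p1"
    "\<forall>(a, m', q, \<tau>)\<in>set_pmf P1. R1 a m' \<and> q \<le> Q1 \<and> \<tau> \<le> T1"
    "\<forall>K q t. T1 \<le> t \<longrightarrow> run n f D t (c1 # K, m, q) =
        bind_pmf P1 (\<lambda>(a, m', q', \<tau>). run n f D (t - \<tau>) (K, m', q + q'))"
    using assms(1) unfolding implements_def by blast
  \<comment> \<open>The law of the second command depends on the outcome and the memory left by the
    first, so it is chosen for all of them at once.\<close>
  have "\<forall>a m'. \<exists>P. a \<in> set_pmf p1 \<longrightarrow> R1 a m' \<longrightarrow> map_pmf fst P = p2 a \<and>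
     (\<forall>(a, m', q, \<tau>)\<in>set_pmf P. R2 a m' \<and> q \<le> Q2 \<and> \<tau> \<le> T2) \<and>
     (\<forall>K q t. T2 \<le> t \<longrightarrow> run n f D t (c2 # K, m', q) =
        bind_pmf P (\<lambda>(a, m', q', \<tau>). run n f D (t - \<tau>) (K, m', q + q')))"
    using assms(2) unfolding implements_def by blast
  then obtain P2 where P2: "\<And>a m'. a \<in> set_pmf p1 \<Longrightarrow> R1 a m' \<Longrightarrow> map_pmf fst (P2 a m') = p2 a \<and>
     (\<forall>(a, m', q, \<tau>)\<in>set_pmf (P2 a m'). R2 a m' \<and> q \<le> Q2 \<and> \<tau> \<le> T2) \<and>
     (\<forall>K q t. T2 \<le> t \<longrightarrow> run n f D t (c2 # K, m', q) =
        bind_pmf (P2 a m') (\<lambda>(a, m', q', \<tau>). run n f D (t - \<tau>) (K, m', q + q')))"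
    by metis
  have P1': "a \<in> set_pmf p1" "R1 a m'" "q \<le> Q1" "\<tau> \<le> T1" if "(a, m', q, \<tau>) \<in> set_pmf P1" for a m' q \<tau>
    using that P1(1,2) by force+
  define P where "P = bind_pmf P1 (\<lambda>(a, m1, q1, \<tau>1).
    map_pmf (\<lambda>(b, m2, q2, \<tau>2). (b, m2, q1 + q2, \<tau>1 + \<tau>2)) (P2 a m1))"
  show ?thesis
  proof (intro exI[of _ P] conjI allI impI)
    have "map_pmf fst P = bind_pmf P1 (\<lambda>(a, m1, q1, \<tau>1). map_pmf fst (P2 a m1))"
      unfolding P_def map_bind_pmf
      by (rule bind_pmf_cong) (simp_all add: pmf.map_comp o_def case_prod_unfold)
    also have "\<dots> = bind_pmf P1 (\<lambda>x. p2 (fst x))"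
      by (rule bind_pmf_cong) (use P2 P1' in auto)
    also have "\<dots> = bind_pmf p1 p2"
      unfolding P1(1)[symmetric] by (simp add: bind_map_pmf)
    finally show "map_pmf fst P = bind_pmf p1 p2" .
    show "\<forall>(a, m', q, \<tau>)\<in>set_pmf P. R2 a m' \<and> q \<le> Q1 + Q2 \<and> \<tau> \<le> T1 + T2"
      unfolding P_def using P1' P2 by (fastforce intro: add_mono)
  next
    fix K q and t :: nat
    assume t: "T1 + T2 \<le> t"
    then have "run n f D t ([c1, c2] @ K, m, q) =
      bind_pmf P1 (\<lambda>(a, m', q', \<tau>). run n f D (t - \<tau>) (c2 # K, m', q + q'))"
      using P1(3) by simp
    also have "\<dots> = bind_pmf P (\<lambda>(a, m', q', \<tau>). run n f D (t - \<tau>) (K, m', q + q'))"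
      unfolding P_def bind_assoc_pmf
    proof (rule bind_pmf_cong[OF refl])
      fix x assume x: "x \<in> set_pmf P1"
      obtain a m' q' \<tau> where [simp]: "x = (a, m', q', \<tau>)" by (cases x)
      have "T2 \<le> t - \<tau>" using P1'[of a m' q' \<tau>] x t by simp
      then show "(case x of (a, m', q', \<tau>) \<Rightarrow> run n f D (t - \<tau>) (c2 # K, m', q + q')) =
        bind_pmf (case x of (a, m1, q1, \<tau>1) \<Rightarrow>
            map_pmf (\<lambda>(b, m2, q2, \<tau>2). (b, m2, q1 + q2, \<tau>1 + \<tau>2)) (P2 a m1))
          (\<lambda>(a, m', q', \<tau>). run n f D (t - \<tau>) (K, m', q + q'))"
        using P1'[of a m' q' \<tau>] P2[of a m'] x by (simp add: bind_map_pmf case_prod_unfold add.assoc)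
    qed
    finally show "run n f D t ([c1, c2] @ K, m, q) =
      bind_pmf P (\<lambda>(a, m', q', \<tau>). run n f D (t - \<tau>) (K, m', q + q'))" .
  qed
qed

lemma implements_Seq:
  assumes "implements n f D c1 m p1 R1 T1 Q1"
    and "\<And>a m'. a \<in> set_pmf p1 \<Longrightarrow> R1 a m' \<Longrightarrow> implements n f D c2 m' (p2 a) R2 T2 Q2"
  shows "implements n f D (Seq c1 c2) m (bind_pmf p1 p2) R2 (Suc (T1 + T2)) (Q1 + Q2)"
  by (rule implements_prefix_step[OF _ implements_two[OF assms]]) auto

lemma implements_Cond:
  assumes "val m e \<noteq> 0 \<Longrightarrow> implements n f D c1 m p R T Q"
    and "val m e = 0 \<Longrightarrow> implements n f D c2 m p R T Q"
  shows "implements n f D (Cond e c1 c2) m p R (Suc T) Q"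
  by (rule implements_prefix_step[where cs = "[if val m e \<noteq> 0 then c1 else c2]"])
    (use assms in \<open>auto simp: implements_def\<close>)

lemma implements_Loop_stop:
  assumes "val m e = 0" "R a m"
  shows "implements n f D (Loop e c) m (return_pmf a) R 1 0"
  by (rule implements_single_step[where g = "\<lambda>_. m"]) (use assms in auto)

lemma implements_Loop_go:
  assumes "val m e \<noteq> 0" "implements n f D c m p1 R1 T1 Q1"
    and "\<And>a m'. a \<in> set_pmf p1 \<Longrightarrow> R1 a m' \<Longrightarrow> implements n f D (Loop e c) m' (p2 a) R2 T2 Q2"
  shows "implements n f D (Loop e c) m (bind_pmf p1 p2) R2 (Suc (T1 + T2)) (Q1 + Q2)"
  by (rule implements_prefix_step[OF _ implements_two[OF assms(2,3)]]) (use assms(1) in auto)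

text \<open>The index passed to \<open>g\<close> is the number of iterations still to come, which is
  what the counter cell of \<open>For\<close> holds while the body runs.\<close>

primrec countdown :: "nat \<Rightarrow> (nat \<Rightarrow> 'a \<Rightarrow> 'a pmf) \<Rightarrow> 'a \<Rightarrow> 'a pmf" where
  "countdown 0 g a = return_pmf a"
| "countdown (Suc i) g a = bind_pmf (g i a) (countdown i g)"

definition For :: "nat \<Rightarrow> expr \<Rightarrow> com \<Rightarrow> com" where
  "For i e c = Seq (Store (Lit i) e)
     (Loop (Cell (Lit i)) (Seq (Store (Lit i) (Sub (Cell (Lit i)) (Lit 1))) c))"

text \<open>\<open>I j\<close> describes the memory with \<open>j\<close> iterations left. An
  iteration takes three steps besides the body: the loop test, the unfolding of the sequence and the
  decrement.\<close>

lemma implements_For: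
  assumes "val m e = N" "I N a (m(i := N))"
    and "\<And>j a m. I j a m \<Longrightarrow> m i = j"
    and "\<And>j a m. j < N \<Longrightarrow> I (Suc j) a m \<Longrightarrow> implements n f D c (m(i := j)) (g j a) (I j) T Q"
  shows "implements n f D (For i e c) m (countdown N g a) (I 0) (N * (T + 3) + 3) (N * Q)"
proof -
  let ?B = "Seq (Store (Lit i) (Sub (Cell (Lit i)) (Lit 1))) c"
  have body: "implements n f D ?B m (g j a) (I j) (T + 2) Q" if "j < N" "I (Suc j) a m" for j a m
  proof -
    have "implements n f D ?B m (bind_pmf (return_pmf ()) (\<lambda>_. g j a)) (I j) (Suc (1 + T)) (0 + Q)"
      by (rule implements_Seq, rule implements_Store[where R = "\<lambda>_ m'. m' = m(i := j)"])
        (use that assms(3)[OF that(2)] assms(4)[of j a m] in auto)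
    then show ?thesis by (simp add: bind_return_pmf)
  qed
  have loop: "implements n f D (Loop (Cell (Lit i)) ?B) m (countdown j g a) (I 0) (j * (T + 3) + 1) (j * Q)"
    if "j \<le> N" "I j a m" for j a m
    using that
  proof (induction j arbitrary: a m)
    case 0
    then show ?case using assms(3)[OF 0(2)] by (simp del: One_nat_def add: implements_Loop_stop)
  next
    case (Suc j)
    have "implements n f D (Loop (Cell (Lit i)) ?B) m (bind_pmf (g j a) (countdown j g)) (I 0)
        (Suc (T + 2 + (j * (T + 3) + 1))) (Q + j * Q)"
      by (rule implements_Loop_go[OF _ body[of j a m]]) (use Suc assms(3)[OF Suc(3)] in auto)
    then show ?case
      unfolding countdown.simps
      by (rule implements_weaken) (auto simp: algebra_simps)
  qed
  have "implements n f D (For i e c) m (bind_pmf (return_pmf ()) (\<lambda>_. countdown N g a)) (I 0)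
      (Suc (1 + (N * (T + 3) + 1))) (0 + N * Q)"
    unfolding For_def
    by (rule implements_Seq, rule implements_Store[where R = "\<lambda>_ m'. m' = m(i := N)"])
      (use loop assms(1,2) in auto)
  then show ?thesis
    unfolding bind_return_pmf by (rule implements_weaken) auto
qed

section \<open>Halting, query counts and verdicts of refined programs\<close>

lemma run_halted [simp]: "run n f D t ([], m, q) = return_pmf ([], m, q)"
  by (induction t) (simp_all add: bind_return_pmf)

lemma run_add: "run n f D (t + t') s = bind_pmf (run n f D t s) (run n f D t')"
proof (induction t arbitrary: s)
  case (Suc t)
  then have "run n f D (t + t') = (\<lambda>s. bind_pmf (run n f D t s) (run n f D t'))"
    by blast
  then show ?case
    by (simp add: bind_assoc_pmf)
qed (simp add: bind_return_pmf)

lemma queries_step: "s' \<in> set_pmf (step n f D s) \<Longrightarrow> queries s \<le> queries s'"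
  by (cases "(n, f, D, s)" rule: step.cases) (auto simp: queries_def)

lemma queries_run: "s' \<in> set_pmf (run n f D t s) \<Longrightarrow> queries s \<le> queries s'"
proof (induction t arbitrary: s)
  case (Suc t)
  then obtain s1 where "s1 \<in> set_pmf (step n f D s)" "s' \<in> set_pmf (run n f D t s1)"
    by auto
  with Suc.IH queries_step show ?case
    by (meson order_trans)
qed simp

lemma halted_run:
  assumes "implements n f D P m p R T Q" "T \<le> t" "s \<in> set_pmf (run n f D t ([P], m, 0))"
  shows "halted s" "queries s \<le> Q"
proof -
  obtain P' where P: "\<forall>(a, m', q, \<tau>)\<in>set_pmf P'. R a m' \<and> q \<le> Q \<and> \<tau> \<le> T"
    "run n f D t ([P], m, 0) =
        bind_pmf P' (\<lambda>(a, m', q', \<tau>). run n f D (t - \<tau>) ([], m', 0 + q'))"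
    using assms(1,2) unfolding implements_def by blast
  then show "halted s" "queries s \<le> Q"
    using assms(3) by (auto simp: halted_def queries_def)
qed

text \<open>Refinement bounds the counter only after the full time bound. Running \<open>T\<close>
  more steps from \<open>s\<close> reaches such a configuration, and the counter never
  decreases.\<close>

lemma queries_run_le:
  assumes "implements n f D P m p R T Q" "s \<in> set_pmf (run n f D t ([P], m, 0))"
  shows "queries s \<le> Q"
proof -
  obtain s' where s': "s' \<in> set_pmf (run n f D T s)"
    using set_pmf_not_empty[of "run n f D T s"] by blast
  then have "s' \<in> set_pmf (run n f D (t + T) ([P], m, 0))"
    using assms(2) unfolding run_add by auto
  then have "queries s' \<le> Q"
    using halted_run(2)[OF assms(1) le_add2] by blast
  with queries_run[OF s'] show ?thesis by simp
qed

text \<open>After \<open>T\<close> steps every run has halted, so the verdict is an event of the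
  abstract outcome.\<close>

lemma prob_run_verdict:
  assumes "implements n f D P m p (\<lambda>a m'. (m' 0 \<noteq> 0) = a) T Q"
  shows "measure_pmf.prob (run n f D T ([P], m, 0)) {s. halted s \<and> (fst (snd s) 0 \<noteq> 0) = b} = pmf p b"
proof -
  obtain P' where P: "map_pmf fst P' = p"
    "\<forall>(a, m', q, \<tau>)\<in>set_pmf P'. (m' 0 \<noteq> 0) = a \<and> q \<le> Q \<and> \<tau> \<le> T"
    "run n f D T ([P], m, 0) =
        bind_pmf P' (\<lambda>(a, m', q', \<tau>). run n f D (T - \<tau>) ([], m', 0 + q'))"
    using assms unfolding implements_def by blast
  have "run n f D T ([P], m, 0) = map_pmf (\<lambda>(a, m', q', \<tau>). ([], m', q')) P'"
    unfolding P(3) map_pmf_def by (rule bind_pmf_cong) auto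
  then have "measure_pmf.prob (run n f D T ([P], m, 0)) {s. halted s \<and> (fst (snd s) 0 \<noteq> 0) = b} =
      measure_pmf.prob P' {x. (fst (snd x) 0 \<noteq> 0) = b}"
    by (simp add: halted_def case_prod_unfold vimage_def)
  also have "\<dots> = measure_pmf.prob P' (fst -` {b})"
    by (rule measure_pmf.finite_measure_eq_AE) (use P(2) in \<open>auto simp: AE_measure_pmf_iff\<close>)
  also have "\<dots> = pmf p b"
    unfolding P(1)[symmetric] by (simp add: pmf_map)
  finally show ?thesis .
qed

lemma accept_prob_ge:
  assumes "implements n f D P (m) p (\<lambda>a m'. (m' 0 \<noteq> 0) = a) T Q" "start P n k \<epsilon> = ([P], m, 0)"
  shows "pmf p True \<le> accept_prob P n k \<epsilon> f D" "pmf p False \<le> reject_prob P n k \<epsilon> f D"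
proof -
  show "pmf p True \<le> accept_prob P n k \<epsilon> f D"
    unfolding accept_prob_def assms(2)
    by (rule cSUP_upper2[where x = T])
      (auto intro!: bdd_aboveI[where M = 1] simp flip: prob_run_verdict[OF assms(1)])
  show "pmf p False \<le> reject_prob P n k \<epsilon> f D"
    unfolding reject_prob_def assms(2)
    by (rule cSUP_upper2[where x = T])
      (auto intro!: bdd_aboveI[where M = 1] simp flip: prob_run_verdict[OF assms(1)])
qed

section \<open>Influences under random resampling\<close>

lemma measure_bind_pmf:
  "measure_pmf.prob (bind_pmf p g) (X :: 'b set) =
    measure_pmf.expectation p (\<lambda>a. measure_pmf.prob (g a) X)"
proof -
  have "measure_pmf.prob q X = pmf (map_pmf (\<lambda>b. b \<in> X) q) True" for q :: "'b pmf"
    by (simp add: pmf_map vimage_def)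
  then show ?thesis
    by (simp add: map_bind_pmf pmf_bind)
qed

lemma prob_bind_le_expectation:
  assumes "\<And>a. a \<in> set_pmf p \<Longrightarrow> measure_pmf.prob (g a) X \<le> h a" "\<And>a. \<bar>h a\<bar> \<le> c"
  shows "measure_pmf.prob (bind_pmf p g) X \<le> measure_pmf.expectation p h"
  unfolding measure_bind_pmf
proof (rule integral_mono_AE)
  show "integrable p (\<lambda>a. measure_pmf.prob (g a) X)"
    by (rule measure_pmf.integrable_const_bound[where B = 1]) auto
  show "integrable p h"
    by (rule measure_pmf.integrable_const_bound[where B = c]) (use assms(2) in auto)
qed (use assms(1) in \<open>simp add: AE_measure_pmf_iff\<close>)

text \<open>\<open>Z\<close> is the set of bad intermediate outcomes: they are charged in full, all
  others with \<open>\<delta>\<close>.\<close>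

lemma prob_bind_le:
  assumes "\<And>a. a \<in> set_pmf p \<Longrightarrow> a \<notin> Z \<Longrightarrow> measure_pmf.prob (g a) X \<le> \<delta>" "0 \<le> \<delta>"
  shows "measure_pmf.prob (bind_pmf p g) X \<le> measure_pmf.prob p Z + \<delta>"
proof -
  have "measure_pmf.prob (bind_pmf p g) X \<le> measure_pmf.expectation p (\<lambda>a. indicator Z a + \<delta>)"
  proof (rule prob_bind_le_expectation[where c = "1 + \<delta>"])
    show "measure_pmf.prob (g a) X \<le> indicator Z a + \<delta>" if "a \<in> set_pmf p" for a
      using assms(1)[OF that] assms(2)
      by (cases "a \<in> Z") (simp_all add: add_increasing2)
  qed (use assms(2) in \<open>simp add: indicator_def\<close>)
  also have "\<dots> = measure_pmf.prob p Z + \<delta>"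
    by (subst Bochner_Integration.integral_add)
      (auto intro!: measure_pmf.integrable_const_bound[where B = 1])
  finally show ?thesis .
qed

text \<open>Here \<open>Z\<close> is the favourable set: only from there is \<open>X\<close> known
  to be avoided, with probability at least \<open>\<eta>\<close>.\<close>

lemma prob_bind_le_on:
  assumes "\<And>a. a \<in> Z \<Longrightarrow> measure_pmf.prob (g a) X \<le> 1 - \<eta>" "0 \<le> \<eta>"
  shows "measure_pmf.prob (bind_pmf p g) X \<le> 1 - \<eta> * measure_pmf.prob p Z"
proof -
  have "measure_pmf.prob (bind_pmf p g) X \<le> measure_pmf.expectation p (\<lambda>a. 1 - \<eta> * indicator Z a)"
  proof (rule prob_bind_le_expectation[where c = "1 + \<eta>"])
    show "measure_pmf.prob (g a) X \<le> 1 - \<eta> * indicator Z a" for a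
      using assms(1)[of a] by (cases "a \<in> Z") simp_all
  qed (use assms(2) in \<open>auto simp: indicator_def\<close>)
  also have "\<dots> = 1 - \<eta> * measure_pmf.prob p Z"
    by (subst Bochner_Integration.integral_diff)
      (auto intro!: measure_pmf.integrable_const_bound[where B = 1] integrable_mult_right)
  finally show ?thesis .
qed

lemma prob_bind_le':
  assumes "\<And>a. a \<in> set_pmf p \<Longrightarrow> measure_pmf.prob (g a) X \<le> \<delta>"
  shows "measure_pmf.prob (bind_pmf p g) X \<le> \<delta>"
proof -
  obtain a where "a \<in> set_pmf p"
    using set_pmf_not_empty[of p] by blast
  then have "0 \<le> \<delta>"
    using assms measure_nonneg order_trans by blast
  then show ?thesis
    using prob_bind_le[of p "{}" g X \<delta>] assms by simp
qed

lemma pmf_True_eq: "pmf p True = 1 - pmf p False"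
proof -
  have "sum (pmf p) (UNIV :: bool set) = 1"
    by (rule sum_pmf_eq_1) auto
  then show ?thesis
    by (simp add: UNIV_bool)
qed

lemma pmf_countdown_or:
  "pmf (countdown N (\<lambda>_ a. map_pmf (\<lambda>t. a \<or> t) q) a) False = (if a then 0 else pmf q False ^ N)"
proof (induction N arbitrary: a)
  case (Suc N)
  have "pmf (countdown (Suc N) (\<lambda>_ a. map_pmf (\<lambda>t. a \<or> t) q) a) False =
      measure_pmf.expectation q (\<lambda>t. if a \<or> t then 0 else pmf q False ^ N)"
    by (simp add: pmf_bind bind_map_pmf Suc.IH)
  also have "\<dots> = (\<Sum>t\<in>UNIV. pmf q t *\<^sub>R (if a \<or> t then 0 else pmf q False ^ N))"
    by (rule integral_measure_pmf) auto
  finally show ?case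
    by (simp add: UNIV_bool)
qed simp

lemma pmf_countdown_and:
  "pmf (countdown N (\<lambda>_ a. map_pmf (\<lambda>r. a \<and> r) q) a) True = (if a then pmf q True ^ N else 0)"
proof (induction N arbitrary: a)
  case (Suc N)
  have "pmf (countdown (Suc N) (\<lambda>_ a. map_pmf (\<lambda>r. a \<and> r) q) a) True =
      measure_pmf.expectation q (\<lambda>t. if a \<and> t then pmf q True ^ N else 0)"
    by (simp add: pmf_bind bind_map_pmf Suc.IH)
  also have "\<dots> = (\<Sum>t\<in>UNIV. pmf q t *\<^sub>R (if a \<and> t then pmf q True ^ N else 0))"
    by (rule integral_measure_pmf) auto
  finally show ?case
    by (simp add: UNIV_bool)
qed simp

text \<open>Union bound over the iteration in which the invariant \<open>I\<close> is lost for the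
  first time.\<close>

lemma prob_countdown_le:
  assumes step: "\<And>i a. i < N \<Longrightarrow> I (Suc i) a \<Longrightarrow> measure_pmf.prob (g i a) {b. \<not> I i b} \<le> \<delta>"
    and "I N a"
  shows "measure_pmf.prob (countdown N g a) {b. \<not> I 0 b} \<le> real N * \<delta>"
  using assms
proof (induction N arbitrary: a)
  case (Suc N)
  have "0 \<le> \<delta>"
    using Suc.prems(1)[of N a] Suc.prems(2) by (meson lessI measure_nonneg order_trans)
  have "measure_pmf.prob (countdown (Suc N) g a) {b. \<not> I 0 b} \<le>
      measure_pmf.prob (g N a) {b. \<not> I N b} + real N * \<delta>"
    unfolding countdown.simps
    by (rule prob_bind_le) (use Suc \<open>0 \<le> \<delta>\<close> in \<open>auto intro: mult_nonneg_nonneg\<close>)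
  with Suc.prems(1)[of N a] Suc.prems(2) show ?case
    by (simp add: algebra_simps)
qed simp

lemma set_countdown:
  assumes "\<And>i a b. i < N \<Longrightarrow> I (Suc i) a \<Longrightarrow> b \<in> set_pmf (g i a) \<Longrightarrow> I i b" "I N a"
  shows "\<forall>b\<in>set_pmf (countdown N g a). I 0 b"
  using assms
proof (induction N arbitrary: a)
  case (Suc N)
  have "\<forall>b\<in>set_pmf (countdown N g a'). I 0 b" if "a' \<in> set_pmf (g N a)" for a'
    by (rule Suc.IH) (use Suc.prems that in \<open>auto intro: less_SucI\<close>)
  then show ?case by simp
qed simp

section \<open>Uniform points, resampling and influences\<close>

definition uniform :: "nat set \<Rightarrow> (nat \<Rightarrow> bool) pmf" where
  "uniform B = Pi_pmf B False (\<lambda>_. bernoulli_pmf (1/2))"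

definition resample :: "nat set \<Rightarrow> (nat \<Rightarrow> bool) \<Rightarrow> (nat \<Rightarrow> bool) \<Rightarrow> nat \<Rightarrow> bool" where
  "resample S u w = (\<lambda>j. if j \<in> S then u j else w j)"

lemma finite_uniform: "finite B \<Longrightarrow> finite (set_pmf (uniform B))"
  unfolding uniform_def by (subst set_Pi_pmf) auto

lemma integrable_uniform: "finite B \<Longrightarrow> integrable (uniform B) (g :: _ \<Rightarrow> real)"
  by (rule integrable_measure_pmf_finite[OF finite_uniform])

lemma uniform_insert:
  assumes "finite B" "b \<notin> B"
  shows "uniform (insert b B) = bind_pmf (bernoulli_pmf (1/2)) (\<lambda>c. map_pmf (\<lambda>w. w(b := c)) (uniform B))"
  using assms unfolding uniform_def by (subst Pi_pmf_insert') (auto simp: map_pmf_def)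

lemma expectation_uniform_insert:
  assumes "finite B" "b \<notin> B"
  shows "measure_pmf.expectation (uniform (insert b B)) (g :: _ \<Rightarrow> real) =
    (measure_pmf.expectation (uniform B) (\<lambda>w. g (w(b := True))) +
     measure_pmf.expectation (uniform B) (\<lambda>w. g (w(b := False)))) / 2"
  unfolding uniform_insert[OF assms]
  by (subst pmf_expectation_bind[where A = UNIV])
    (auto simp: UNIV_bool finite_uniform[OF assms(1)])

lemma expectation_uniform_add:
  "finite B \<Longrightarrow> measure_pmf.expectation (uniform B) (\<lambda>w. g w + h w :: real) =
    measure_pmf.expectation (uniform B) g + measure_pmf.expectation (uniform B) h"
  by (intro Bochner_Integration.integral_add integrable_uniform)

lemma expectation_uniform_diff:
  "finite B \<Longrightarrow> measure_pmf.expectation (uniform B) (\<lambda>w. g w - h w :: real) =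
    measure_pmf.expectation (uniform B) g - measure_pmf.expectation (uniform B) h"
  by (intro Bochner_Integration.integral_diff integrable_uniform)

lemma expectation_uniform_mono:
  "finite B \<Longrightarrow> (\<And>w. g w \<le> (h w :: real)) \<Longrightarrow>
    measure_pmf.expectation (uniform B) g \<le> measure_pmf.expectation (uniform B) h"
  by (intro integral_mono integrable_uniform)

text \<open>The weights are the squared Fourier coefficients of \<open>\<phi>\<close>.\<close>

lemma correlation_weights:
  fixes \<phi> :: "(nat \<Rightarrow> bool) \<Rightarrow> real"
  assumes "finite B"
  shows "\<exists>a :: nat set \<Rightarrow> real. (\<forall>U. 0 \<le> a U) \<and> (\<forall>S.
    measure_pmf.expectation (uniform B) (\<lambda>w.
      measure_pmf.expectation (uniform B) (\<lambda>u. \<phi> w * \<phi> (resample S u w))) =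
    (\<Sum>U | U \<subseteq> B \<and> U \<inter> S = {}. a U))"
  using assms
proof (induction B arbitrary: \<phi>)
  case empty
  have [simp]: "resample S (\<lambda>_. False) (\<lambda>_. False) = (\<lambda>_. False)" for S
    by (auto simp: resample_def)
  have "{U. U = {} \<and> U \<inter> S = {}} = {{}}" for S :: "nat set"
    by auto
  then show ?case
    by (intro exI[of _ "\<lambda>_. \<phi> (\<lambda>_. False) * \<phi> (\<lambda>_. False)"]) (simp add: uniform_def)
next
  case (insert b B)
  define E where "E = (\<lambda>(\<phi> :: (nat \<Rightarrow> bool) \<Rightarrow> real) \<psi> S. measure_pmf.expectation (uniform B) (\<lambda>w.
    measure_pmf.expectation (uniform B) (\<lambda>u. \<phi> w * \<psi> (resample S u w))))"
  define \<phi>1 where "\<phi>1 = (\<lambda>w. \<phi> (w(b := True)))"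
  define \<phi>0 where "\<phi>0 = (\<lambda>w. \<phi> (w(b := False)))"
  \<comment> \<open>Mean and half-difference of \<open>\<phi>\<close> with respect to coordinate
    \<open>b\<close>. Resampling \<open>b\<close> averages the half-difference out; if
    \<open>b\<close> is kept, both parts contribute and their cross terms cancel. The factors
    \<open>1\<close> and \<open>- 1\<close> bring both into the form of
    \<open>bilinear\<close>.\<close>
  define p where "p = (\<lambda>w. (\<phi>1 w + 1 * \<phi>0 w) / 2)"
  define d where "d = (\<lambda>w. (\<phi>1 w + - 1 * \<phi>0 w) / 2)"
  note lin = expectation_uniform_add[OF insert(1)] expectation_uniform_diff[OF insert(1)]
  obtain ap where ap: "\<And>U. 0 \<le> ap U" "\<And>S. E p p S = (\<Sum>U | U \<subseteq> B \<and> U \<inter> S = {}. ap U)"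
    using insert.IH[of p] unfolding E_def by blast
  obtain ad where ad: "\<And>U. 0 \<le> ad U" "\<And>S. E d d S = (\<Sum>U | U \<subseteq> B \<and> U \<inter> S = {}. ad U)"
    using insert.IH[of d] unfolding E_def by blast
  have resample_in: "b \<in> S \<Longrightarrow> resample S (u(b := x)) (w(b := y)) = (resample S u w)(b := x)"
    and resample_out: "b \<notin> S \<Longrightarrow> resample S (u(b := x)) (w(b := y)) = (resample S u w)(b := y)" for S u w x y
    by (simp_all add: resample_def fun_eq_iff)
  have bilinear: "E (\<lambda>w. (f w + s * g w) / 2) (\<lambda>w. (f' w + s' * g' w) / 2) S =
      (E f f' S + s * E g f' S + s' * E f g' S + s * s' * E g g' S) / 4"
    for f g f' g' :: "(nat \<Rightarrow> bool) \<Rightarrow> real" and s s' S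
  proof -
    have "(f w + s * g w) / 2 * ((f' v + s' * g' v) / 2) =
        f w * f' v * (1 / 4) + g w * f' v * (s / 4) + f w * g' v * (s' / 4) + g w * g' v * (s * s' / 4)"
      for w v
      by (simp add: field_simps)
    then show ?thesis
      unfolding E_def by (simp only: lin integral_mult_left_zero add_divide_distrib) (simp add: mult_ac)
  qed
  have fin: "finite {U. U \<subseteq> B \<and> P U}" for P
    by (rule finite_subset[of _ "Pow B"]) (use insert(1) in auto)
  \<comment> \<open>Sets containing \<open>b\<close> get their weight from the half-difference, the
    others from the mean.\<close>
  define a where "a U = (if b \<in> U then ad (U - {b}) else ap U)" for U
  show ?case
  proof (intro exI[of _ a] conjI allI)
    show "0 \<le> a U" for U
      using ap(1) ad(1) by (simp add: a_def)
    fix S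
    let ?L = "measure_pmf.expectation (uniform (insert b B)) (\<lambda>w.
      measure_pmf.expectation (uniform (insert b B)) (\<lambda>u. \<phi> w * \<phi> (resample S u w)))"
    have sum_p: "(\<Sum>U | U \<subseteq> B \<and> U \<inter> S = {}. a U) = E p p S"
      unfolding ap(2) by (rule sum.cong) (use insert(2) in \<open>auto simp: a_def\<close>)
    show "?L = (\<Sum>U | U \<subseteq> insert b B \<and> U \<inter> S = {}. a U)"
    proof (cases "b \<in> S")
      case True
      have "?L = ((E \<phi>1 \<phi>1 S + E \<phi>1 \<phi>0 S) / 2 + (E \<phi>0 \<phi>1 S + E \<phi>0 \<phi>0 S) / 2) / 2"
        unfolding E_def \<phi>1_def \<phi>0_def
        by (simp only: expectation_uniform_insert[OF insert(1,2)] resample_in[OF True] lin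
            integral_divide_zero add_divide_distrib add.assoc)
      also have "\<dots> = E p p S"
        unfolding p_def bilinear by (simp add: field_simps)
      also have "\<dots> = (\<Sum>U | U \<subseteq> insert b B \<and> U \<inter> S = {}. a U)"
        unfolding sum_p[symmetric] by (rule sum.cong) (use True in auto)
      finally show ?thesis .
    next
      case False
      have "?L = ((E \<phi>1 \<phi>1 S + E \<phi>1 \<phi>1 S) / 2 + (E \<phi>0 \<phi>0 S + E \<phi>0 \<phi>0 S) / 2) / 2"
        unfolding E_def \<phi>1_def \<phi>0_def
        by (simp only: expectation_uniform_insert[OF insert(1,2)] resample_out[OF False] lin
            integral_divide_zero add_divide_distrib add.assoc)
      also have "\<dots> = E p p S + E d d S"
        unfolding p_def d_def bilinear by (simp add: field_simps)
      also have "E d d S = (\<Sum>U | U \<subseteq> insert b B \<and> b \<in> U \<and> U \<inter> S = {}. a U)"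
        unfolding ad(2)
        by (rule sum.reindex_bij_witness[of _ "\<lambda>U. U - {b}" "insert b"])
          (use insert(2) False in \<open>auto simp: a_def intro!: arg_cong[of _ _ ad]\<close>)
      also have "E p p S + \<dots> = (\<Sum>U\<in>{U. U \<subseteq> B \<and> U \<inter> S = {}} \<union>
          {U. U \<subseteq> insert b B \<and> b \<in> U \<and> U \<inter> S = {}}. a U)"
        unfolding sum_p[symmetric]
        by (subst sum.union_disjoint)
          (use insert(1,2) fin in \<open>auto intro: finite_subset[of _ "Pow (insert b B)"]\<close>)
      also have "\<dots> = (\<Sum>U | U \<subseteq> insert b B \<and> U \<inter> S = {}. a U)"
        by (rule sum.cong) auto
      finally show ?thesis .
    qed
  qed
qed

definition trial :: "nat \<Rightarrow> ((nat \<Rightarrow> bool) \<Rightarrow> bool) \<Rightarrow> nat set \<Rightarrow> bool pmf" where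
  "trial n h S = bind_pmf (uniform {..<n}) (\<lambda>w. map_pmf (\<lambda>u. h w \<noteq> h (resample S u w)) (uniform {..<n}))"

text \<open>A resampled bit keeps its old value half of the time, so a set containing the variable
  of a literal has influence 1/2 and not 1.\<close>

definition influence :: "nat \<Rightarrow> ((nat \<Rightarrow> bool) \<Rightarrow> bool) \<Rightarrow> nat set \<Rightarrow> real" where
  "influence n h S = pmf (trial n h S) True"

text \<open>In terms of the signs \<open>?\<phi>\<close>, a disagreement has probability
  \<open>(1 - C S) / 2\<close>, where the correlation \<open>C S\<close> collects the weights of the
  sets disjoint from \<open>S\<close>. All weights add up to 1, so half the weights of the sets
  meeting \<open>S\<close> remain.\<close>

lemma influence_weights:
  "\<exists>a :: nat set \<Rightarrow> real. (\<forall>U. 0 \<le> a U) \<and>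
    (\<forall>S. influence n h S = (\<Sum>U | U \<subseteq> {..<n} \<and> U \<inter> S \<noteq> {}. a U))"
proof -
  let ?\<phi> = "\<lambda>w. if h w then 1 else - 1 :: real"
  let ?U = "uniform {..<n}"
  define C where "C = (\<lambda>S. measure_pmf.expectation ?U (\<lambda>w.
    measure_pmf.expectation ?U (\<lambda>u. ?\<phi> w * ?\<phi> (resample S u w))))"
  obtain a where a: "\<And>U. 0 \<le> a U" "\<And>S. C S = (\<Sum>U | U \<subseteq> {..<n} \<and> U \<inter> S = {}. a U)"
    using correlation_weights[of "{..<n}" ?\<phi>] unfolding C_def by blast
  have influence: "influence n h S = (1 - C S) / 2" for S
  proof -
    have "pmf (map_pmf (\<lambda>u. h w \<noteq> h (resample S u w)) ?U) True =
        measure_pmf.expectation ?U (\<lambda>u. 1 / 2 - ?\<phi> w * ?\<phi> (resample S u w) / 2)" for w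
    proof -
      have "pmf (map_pmf (\<lambda>u. h w \<noteq> h (resample S u w)) ?U) True =
          measure_pmf.expectation ?U (indicator {u. h w \<noteq> h (resample S u w)})"
        by (simp add: pmf_map vimage_def)
      also have "\<dots> = measure_pmf.expectation ?U (\<lambda>u. 1 / 2 - ?\<phi> w * ?\<phi> (resample S u w) / 2)"
        by (rule Bochner_Integration.integral_cong) auto
      finally show ?thesis .
    qed
    then show ?thesis
      unfolding influence_def trial_def pmf_bind C_def
      by (simp add: expectation_uniform_diff diff_divide_distrib)
  qed
  \<comment> \<open>Resampling nothing compares a sign with itself.\<close>
  have one: "(\<Sum>U | U \<subseteq> {..<n}. a U) = 1"
  proof -
    have "C {} = measure_pmf.expectation ?U (\<lambda>w. measure_pmf.expectation ?U (\<lambda>u. 1))"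
      unfolding C_def by (intro Bochner_Integration.integral_cong) (auto simp: resample_def)
    then show ?thesis
      using a(2)[of "{}"] by simp
  qed
  have fin: "finite {U. U \<subseteq> {..<n} \<and> P U}" for P
    by (rule finite_subset[of _ "Pow {..<n}"]) auto
  have "influence n h S = (\<Sum>U | U \<subseteq> {..<n} \<and> U \<inter> S \<noteq> {}. a U / 2)" for S
  proof -
    have "(\<Sum>U | U \<subseteq> {..<n}. a U) =
        (\<Sum>U\<in>{U. U \<subseteq> {..<n} \<and> U \<inter> S = {}} \<union> {U. U \<subseteq> {..<n} \<and> U \<inter> S \<noteq> {}}. a U)"
      by (rule sum.cong) auto
    also have "\<dots> = C S + (\<Sum>U | U \<subseteq> {..<n} \<and> U \<inter> S \<noteq> {}. a U)"
      unfolding a(2) by (rule sum.union_disjoint) (use fin in auto)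
    finally show ?thesis
      unfolding influence one sum_divide_distrib[symmetric] by simp
  qed
  then show ?thesis
    using a(1) by (intro exI[of _ "\<lambda>U. a U / 2"]) auto
qed

text \<open>In terms of the weights, a larger set only adds nonnegative summands. Coordinates from
  \<open>n\<close> on do not count, because the weights belong to subsets of
  \<open>{..<n}\<close>.\<close>

lemma influence_mono:
  assumes "S \<inter> {..<n} \<subseteq> S'"
  shows "influence n h S \<le> influence n h S'"
proof -
  obtain a where a: "\<And>U. 0 \<le> a U"
    "\<And>S. influence n h S = (\<Sum>U | U \<subseteq> {..<n} \<and> U \<inter> S \<noteq> {}. a U)"
    using influence_weights[of n h] by blast
  show ?thesis
    unfolding a(2)
  proof (rule sum_mono2)
    show "finite {U. U \<subseteq> {..<n} \<and> U \<inter> S' \<noteq> {}}"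
      by (rule finite_subset[of _ "Pow {..<n}"]) auto
  qed (use assms a(1) in auto)
qed

lemma expectation_two_coordinates:
  assumes "i < n" "i' < n" "i \<noteq> i'"
  shows "measure_pmf.expectation (uniform {..<n}) (\<lambda>x. of_bool (\<not> x i \<and> x i') :: real) = 1 / 4"
proof -
  obtain B where B: "{..<n} = insert i (insert i' B)" "finite B" "i \<notin> insert i' B" "i' \<notin> B"
  proof
    show "{..<n} = insert i (insert i' ({..<n} - {i, i'}))"
      using assms by auto
  qed (use assms in auto)
  show ?thesis
    unfolding B(1) using B(2-) assms(3) by (simp add: expectation_uniform_insert)
qed

text \<open>
  For weights \<open>a\<close> as in \<open>influence_weights\<close>, a pair of sets \<open>U\<close>, \<open>U'\<close> contributes to the
  expectation with probability at least 1/4, unless both are the same singleton.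
\<close>

lemma expectation_influence_split:
  assumes "\<And>i. i < n \<Longrightarrow> influence n h {i} \<le> c" "0 \<le> c"
  shows "influence n h UNIV * (influence n h UNIV - c) / 4 \<le>
    measure_pmf.expectation (uniform {..<n})
      (\<lambda>x. influence n h {j. x j = False} * influence n h {j. x j = True})"
proof -
  obtain a where a: "\<And>U. 0 \<le> a U"
    "\<And>S. influence n h S = (\<Sum>U | U \<subseteq> {..<n} \<and> U \<inter> S \<noteq> {}. a U)"
    using influence_weights[of n h] by blast
  define W where "W = {U. U \<subseteq> {..<n} \<and> U \<noteq> {}}"
  have fin: "finite W"
    unfolding W_def by (rule finite_subset[of _ "Pow {..<n}"]) auto
  define A where "A = influence n h UNIV"
  have A: "A = sum a W"
    unfolding A_def a(2) W_def by simp
  have infl: "influence n h S = (\<Sum>U\<in>W. a U * of_bool (U \<inter> S \<noteq> {}))" for S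
    unfolding a(2) W_def by (rule sum.mono_neutral_cong_left) (use fin in \<open>auto simp: W_def\<close>)
  let ?E = "measure_pmf.expectation (uniform {..<n})"
  let ?P = "\<lambda>U U'. ?E (\<lambda>x. of_bool (U \<inter> {j. x j = False} \<noteq> {} \<and> U' \<inter> {j. x j = True} \<noteq> {}) :: real)"
  have P0: "0 \<le> ?P U U'" for U U'
    by (rule integral_nonneg_AE) auto
  have P: "1 / 4 \<le> ?P U U'" if "i \<in> U" "i' \<in> U'" "i \<noteq> i'" "U \<in> W" "U' \<in> W" for U U' i i'
  proof -
    have "i < n" "i' < n"
      using that by (auto simp: W_def)
    then have "(1 / 4 :: real) = ?E (\<lambda>x. of_bool (\<not> x i \<and> x i'))"
      by (intro expectation_two_coordinates[symmetric] that(3))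
    also have "\<dots> \<le> ?P U U'"
      by (rule expectation_uniform_mono) (use that in auto)
    finally show ?thesis .
  qed
  \<comment> \<open>For a fixed \<open>U\<close> the only partner \<open>U'\<close> to be given up
    is the same singleton, and its weight is at most \<open>c\<close>.\<close>
  have row: "(A - c) / 4 \<le> (\<Sum>U'\<in>W. a U' * ?P U U')" if U: "U \<in> W" for U
  proof (cases "\<exists>i. U = {i}")
    case True
    then obtain i where i: "U = {i}" by blast
    have "a {i} \<le> influence n h {i}"
      unfolding infl by (rule order_trans[OF _ member_le_sum[of "{i}"]])
        (use fin U i a(1) in auto)
    also have "\<dots> \<le> c"
      using assms(1) U i by (auto simp: W_def)
    finally have "(A - c) / 4 \<le> (A - a {i}) / 4" by simp
    also have "\<dots> = (\<Sum>U'\<in>W - {{i}}. a U' * (1 / 4))"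
      using fin U i unfolding A by (simp add: sum.remove[of W "{i}"] sum_distrib_right sum_divide_distrib)
    also have "\<dots> \<le> (\<Sum>U'\<in>W - {{i}}. a U' * ?P U U')"
    proof (intro sum_mono mult_left_mono a(1))
      fix U' assume "U' \<in> W - {{i}}"
      then obtain i' where "i' \<in> U'" "i' \<noteq> i" "U' \<in> W"
        by (auto simp: W_def)
      then show "1 / 4 \<le> ?P U U'"
        using P[of i U i' U'] i U by auto
    qed
    also have "\<dots> \<le> (\<Sum>U'\<in>W. a U' * ?P U U')"
      by (rule sum_mono2) (use fin a(1) P0 in auto)
    finally show ?thesis .
  next
    case False
    have "(A - c) / 4 \<le> A / 4"
      using assms(2) by simp
    also have "\<dots> = (\<Sum>U'\<in>W. a U' * (1 / 4))"
      unfolding A by (simp add: sum_divide_distrib)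
    also have "\<dots> \<le> (\<Sum>U'\<in>W. a U' * ?P U U')"
    proof (intro sum_mono mult_left_mono a(1))
      \<comment> \<open>\<open>U\<close> is neither empty nor a singleton, so it has an element
        different from whichever \<open>i'\<close> is picked in \<open>U'\<close>.\<close>
      fix U' assume U': "U' \<in> W"
      then obtain i' where i': "i' \<in> U'"
        by (auto simp: W_def)
      then obtain i where "i \<in> U" "i \<noteq> i'"
        using U False by (auto simp: W_def)
      then show "1 / 4 \<le> ?P U U'"
        using P[of i U i' U'] i' U U' by auto
    qed
    finally show ?thesis .
  qed
  have "A * (A - c) / 4 = (\<Sum>U\<in>W. a U * ((A - c) / 4))"
    unfolding sum_distrib_right[symmetric] by (simp add: A)
  also have "\<dots> \<le> (\<Sum>U\<in>W. a U * (\<Sum>U'\<in>W. a U' * ?P U U'))"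
    by (intro sum_mono mult_left_mono a(1) row)
  also have "\<dots> = ?E (\<lambda>x. \<Sum>U\<in>W. \<Sum>U'\<in>W. a U * (a U' *
      of_bool (U \<inter> {j. x j = False} \<noteq> {} \<and> U' \<inter> {j. x j = True} \<noteq> {})))"
    by (simp add: Bochner_Integration.integral_sum integrable_uniform sum_distrib_left)
  also have "\<dots> = ?E (\<lambda>x. influence n h {j. x j = False} * influence n h {j. x j = True})"
    unfolding infl sum_product
    by (intro Bochner_Integration.integral_cong sum.cong refl) auto
  finally show ?thesis
    unfolding A_def .
qed

section \<open>The algorithm\<close>

lemma prob_bool: "measure_pmf.prob p {b. b} = pmf p True" "measure_pmf.prob p {b. \<not> b} = pmf p False"
proof -
  have "{b. b} = {True}" "{b. \<not> b} = {False}"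
    by auto
  then show "measure_pmf.prob p {b. b} = pmf p True" "measure_pmf.prob p {b. \<not> b} = pmf p False"
    by (simp_all add: measure_pmf_single)
qed

primrec search :: "(nat \<Rightarrow> bool) \<Rightarrow> bool \<Rightarrow> nat \<Rightarrow> nat \<Rightarrow> nat" where
  "search g t 0 lo = lo"
| "search g t (Suc i) lo = search g t i (if g (lo + 2 ^ i) = t then lo + 2 ^ i else lo)"

text \<open>\<open>g\<close> may change its value many times. Halving keeps the value
  \<open>t\<close> at the left end and the other value at the right end, so that in the end some
  adjacent change is enclosed.\<close>

lemma search_correct:
  assumes "g lo = t" "g (lo + 2 ^ i) \<noteq> t"
  shows "g (search g t i lo) = t \<and> g (Suc (search g t i lo)) \<noteq> t"
  using assms
proof (induction i arbitrary: lo)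
  case (Suc i)
  then show ?case
    by (cases "g (lo + 2 ^ i) = t") (auto simp: mult_2 add.assoc)
qed simp

type_synonym point = "nat \<Rightarrow> bool"

text \<open>A relevant block together with a point on which the block matters.\<close>

type_synonym row = "point \<times> point"

definition found :: "row list \<Rightarrow> point" where
  "found rs = (\<lambda>j. \<exists>r\<in>set rs. fst r j)"

definition masked :: "row list \<Rightarrow> point \<Rightarrow> point" where
  "masked rs x = (\<lambda>j. x j \<and> found rs j)"

text \<open>A path between two points: \<open>c = 0\<close> gives \<open>masked rs x\<close>, and a
  \<open>c\<close> above every label gives \<open>x\<close>. The hybrids for \<open>c\<close> and
  \<open>Suc c\<close> differ at most in coordinates of label \<open>c\<close> that are not yet
  found.\<close>

definition hybrid :: "(nat \<Rightarrow> nat) \<Rightarrow> row list \<Rightarrow> point \<Rightarrow> nat \<Rightarrow> point" where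
  "hybrid bid rs x c = (\<lambda>j. x j \<and> (found rs j \<or> bid j < c))"

definition plug :: "row \<Rightarrow> point \<Rightarrow> point" where
  "plug r w = (\<lambda>j. if fst r j then w j else snd r j)"

definition digits :: "nat \<Rightarrow> nat pmf" where
  "digits s = countdown s (\<lambda>_ b. map_pmf (\<lambda>c. 2 * b + of_bool c) (bernoulli_pmf (1/2))) 0"

locale junta_algorithm =
  fixes n :: nat and f :: "bool list \<Rightarrow> bool" and D :: "bool list pmf"
  assumes D: "set_pmf D \<subseteq> cube n"
begin

definition F :: "point \<Rightarrow> bool" where
  "F p = f (map p [0..<n])"

definition sample :: "point pmf" where
  "sample = map_pmf (\<lambda>x j. j < n \<and> x ! j) D"

definition extend :: "(nat \<Rightarrow> nat) \<Rightarrow> nat \<Rightarrow> row list \<Rightarrow> point \<Rightarrow> row list" where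
  "extend bid s rs x =
    (let lo = search (\<lambda>c. F (hybrid bid rs x c)) (F (masked rs x)) s 0
     in (\<lambda>j. \<not> found rs j \<and> bid j = lo, hybrid bid rs x (Suc lo)) # rs)"

text \<open>After a success the remaining samples of the epoch are still drawn and compared, but
  change nothing; a fixed number of iterations suits \<open>For\<close>.\<close>

definition epoch_step :: "(nat \<Rightarrow> nat) \<Rightarrow> nat \<Rightarrow> row list \<times> bool \<Rightarrow> (row list \<times> bool) pmf" where
  "epoch_step bid s = (\<lambda>(rs, a). map_pmf (\<lambda>x.
     if \<not> a \<and> F x \<noteq> F (masked rs x) then (extend bid s rs x, True) else (rs, a)) sample)"

definition epoch :: "(nat \<Rightarrow> nat) \<Rightarrow> nat \<Rightarrow> nat \<Rightarrow> row list \<times> bool \<Rightarrow> (row list \<times> bool) pmf" where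
  "epoch bid s T = (\<lambda>(rs, a).
     if a then countdown T (\<lambda>_. epoch_step bid s) (rs, False) else return_pmf (rs, False))"

text \<open>The Boolean tells whether the last epoch succeeded. Starting with \<open>True\<close>
  lets the first epoch run, and after a failure all later epochs idle. \<open>True\<close> at the
  end therefore means one row per epoch, hence \<open>k + 1\<close> rows.\<close>

definition collect :: "(nat \<Rightarrow> nat) \<Rightarrow> nat \<Rightarrow> nat \<Rightarrow> nat \<Rightarrow> (row list \<times> bool) pmf" where
  "collect bid s T k = countdown (Suc k) (\<lambda>_. epoch bid s T) ([], True)"

definition flag :: "row \<Rightarrow> nat \<Rightarrow> point \<Rightarrow> bool \<Rightarrow> bool pmf" where
  "flag r m x b = countdown m (\<lambda>_ a. map_pmf (\<lambda>t. a \<or> t)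
     (trial n (\<lambda>w. F (plug r w)) {j. x j = b})) False"

text \<open>\<open>a\<close> and \<open>b\<close> are the flags of the sides where \<open>x\<close>
  is 0 and 1. If they differ, \<open>b\<close> is the bit read off and is written on the whole
  block; if they agree, the Boolean is lost for good.\<close>

primrec read_rows :: "nat \<Rightarrow> point \<Rightarrow> row list \<Rightarrow> point \<times> bool \<Rightarrow> (point \<times> bool) pmf" where
  "read_rows m x [] st = return_pmf st"
| "read_rows m x (r # rs) st =
    bind_pmf (flag r m x False) (\<lambda>a. bind_pmf (flag r m x True) (\<lambda>b.
      read_rows m x rs (\<lambda>j. fst st j \<or> fst r j \<and> b, snd st \<and> a \<noteq> b)))"

definition check :: "nat \<Rightarrow> row list \<Rightarrow> point \<Rightarrow> bool pmf" where
  "check m rs x = map_pmf (\<lambda>(y, ok). ok \<and> F (masked rs x) = F y)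
     (read_rows m x rs (\<lambda>_. False, True))"

definition test_round :: "nat \<Rightarrow> nat \<Rightarrow> row list \<Rightarrow> bool pmf" where
  "test_round m1 m2 rs = bind_pmf (bind_pmf (uniform {..<n}) (check m1 rs))
     (\<lambda>a. map_pmf (\<lambda>b. a \<and> b) (bind_pmf sample (check m2 rs)))"

definition decide :: "nat \<Rightarrow> nat \<Rightarrow> nat \<Rightarrow> row list \<times> bool \<Rightarrow> bool pmf" where
  "decide M m1 m2 = (\<lambda>(rs, a).
     countdown M (\<lambda>_ ok. map_pmf (\<lambda>r. ok \<and> r) (test_round m1 m2 rs)) (\<not> a))"

definition labels :: "nat \<Rightarrow> (nat \<Rightarrow> nat) pmf" where
  "labels s = Pi_pmf {..<n} 0 (\<lambda>_. digits s)"

definition algorithm :: "nat \<Rightarrow> nat \<Rightarrow> nat \<Rightarrow> nat \<Rightarrow> nat \<Rightarrow> nat \<Rightarrow> bool pmf" where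
  "algorithm k s T M m1 m2 =
     bind_pmf (labels s) (\<lambda>bid. bind_pmf (collect bid s T k) (decide M m1 m2))"

section \<open>Distribution of flags, of the bits read off and of rounds\<close>

lemma F_cong: "(\<And>j. j < n \<Longrightarrow> p j = q j) \<Longrightarrow> F p = F q"
  unfolding F_def by (rule arg_cong[of _ _ f]) simp

lemma pmf_flag: "pmf (flag r m x b) False = (1 - influence n (\<lambda>w. F (plug r w)) {j. x j = b}) ^ m"
  unfolding flag_def pmf_countdown_or influence_def by (simp add: pmf_True_eq)

lemma read_rows_pair: "read_rows m x (r # rs) st =
    bind_pmf (pair_pmf (flag r m x False) (flag r m x True)) (\<lambda>(a, b).
      read_rows m x rs (\<lambda>j. fst st j \<or> fst r j \<and> b, snd st \<and> a \<noteq> b))"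
  by (simp add: pair_pmf_def bind_assoc_pmf bind_return_pmf)

lemma read_rows_False: "st' \<in> set_pmf (read_rows m x rs st) \<Longrightarrow> \<not> snd st \<Longrightarrow> \<not> snd st'"
  by (induction rs arbitrary: st) auto

lemma prob_read_rows_False:
  assumes "\<not> snd st" "X \<subseteq> Collect snd"
  shows "measure_pmf.prob (read_rows m x rs st) X = 0"
proof -
  have "\<forall>st'\<in>set_pmf (read_rows m x rs st). st' \<notin> X"
    using read_rows_False[of _ m x rs st] assms by blast
  then have "measure_pmf.prob (read_rows m x rs st) X = measure_pmf.prob (read_rows m x rs st) {}"
    by (intro measure_pmf.finite_measure_eq_AE) (auto simp: AE_measure_pmf_iff)
  then show ?thesis by simp
qed

abbreviation row_flags :: "row \<Rightarrow> nat \<Rightarrow> point \<Rightarrow> (bool \<times> bool) pmf" where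
  "row_flags r m x \<equiv> pair_pmf (flag r m x False) (flag r m x True)"

lemma prob_row_flags:
  "measure_pmf.prob (row_flags r m x) {(a, b). a \<noteq> b} =
    pmf (flag r m x False) True * pmf (flag r m x True) False +
    pmf (flag r m x False) False * pmf (flag r m x True) True"
proof -
  have "{(a, b). a \<noteq> b} = {(True, False), (False, True)}"
    by auto
  then show ?thesis
    by (simp add: measure_measure_pmf_finite pmf_pair)
qed

text \<open>A lost Boolean never recovers. Whatever the other rows do, success requires that the row
  \<open>r\<close> raises exactly one flag.\<close>

lemma prob_read_rows_le:
  assumes "r \<in> set rs"
  shows "measure_pmf.prob (read_rows m x rs st) {st. snd st} \<le>
    measure_pmf.prob (row_flags r m x) {(a, b). a \<noteq> b}"
  using assms
proof (induction rs arbitrary: st)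
  case (Cons r' rs)
  show ?case
  proof (cases "r = r'")
    case True
    have "measure_pmf.prob (read_rows m x (r' # rs) st) {st. snd st} \<le>
        measure_pmf.prob (row_flags r m x) {(a, b). a \<noteq> b} + 0"
      unfolding read_rows_pair True
    proof (rule prob_bind_le)
      fix ab :: "bool \<times> bool"
      assume ab: "ab \<notin> {(a, b). a \<noteq> b}"
      obtain a b where [simp]: "ab = (a, b)" by (cases ab)
      have "a = b"
        using ab by simp
      then show "measure_pmf.prob (case ab of (a, b) \<Rightarrow>
          read_rows m x rs (\<lambda>j. fst st j \<or> fst r' j \<and> b, snd st \<and> a \<noteq> b)) {st. snd st} \<le> 0"
        by (simp add: prob_read_rows_False)
    qed simp
    then show ?thesis by simp
  next
    case False
    then show ?thesis
      unfolding read_rows_pair using Cons by (intro prob_bind_le') auto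
  qed
qed simp

lemma pmf_check_le:
  assumes "r \<in> set rs"
  shows "pmf (check m rs x) True \<le> measure_pmf.prob (row_flags r m x) {(a, b). a \<noteq> b}"
proof -
  have "pmf (check m rs x) True \<le> measure_pmf.prob (read_rows m x rs (\<lambda>_. False, True)) {st. snd st}"
    unfolding check_def pmf_map by (rule measure_pmf.finite_measure_mono) auto
  then show ?thesis
    using prob_read_rows_le[OF assms] order_trans by blast
qed

text \<open>Reading a row fails silently only if the flag of the side of \<open>\<tau>\<close> is not raised.\<close>

lemma prob_read_rows_wrong:
  assumes "\<And>r. r \<in> set rs \<Longrightarrow> pmf (flag r m x (x (\<tau> r))) False \<le> \<delta>"
  shows "measure_pmf.prob (read_rows m x rs st)
    {st'. snd st' \<and> fst st' \<noteq> (\<lambda>j. fst st j \<or> (\<exists>r\<in>set rs. fst r j \<and> x (\<tau> r)))} \<le> real (length rs) * \<delta>"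
  using assms
proof (induction rs arbitrary: st)
  case (Cons r rs)
  have "0 \<le> \<delta>"
    using order_trans[OF pmf_nonneg Cons.prems[of r]] by simp
  let ?Z = "{(a, b). a \<noteq> b \<and> b \<noteq> x (\<tau> r)}"
  let ?Y = "\<lambda>rs st. {st'. snd st' \<and> fst st' \<noteq> (\<lambda>j. fst st j \<or> (\<exists>r\<in>set rs. fst r j \<and> x (\<tau> r)))}"
  have "measure_pmf.prob (read_rows m x (r # rs) st) (?Y (r # rs) st) \<le>
      measure_pmf.prob (row_flags r m x) ?Z + real (length rs) * \<delta>"
    unfolding read_rows_pair
  proof (rule prob_bind_le)
    fix ab assume ab: "ab \<notin> ?Z"
    obtain a b where [simp]: "ab = (a, b)" by (cases ab)
    let ?st = "(\<lambda>j. fst st j \<or> fst r j \<and> b, snd st \<and> a \<noteq> b)"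
    show "measure_pmf.prob (case ab of (a, b) \<Rightarrow>
        read_rows m x rs (\<lambda>j. fst st j \<or> fst r j \<and> b, snd st \<and> a \<noteq> b)) (?Y (r # rs) st) \<le> real (length rs) * \<delta>"
    proof (cases "a = b")
      case True
      have "measure_pmf.prob (read_rows m x rs ?st) (?Y (r # rs) st) = 0"
        by (rule prob_read_rows_False) (use True in auto)
      then show ?thesis
        using \<open>0 \<le> \<delta>\<close> by simp
    next
      case False
      then have b: "b = x (\<tau> r)"
        using ab by auto
      have "?Y (r # rs) st = ?Y rs ?st"
        by (auto simp: b fun_eq_iff)
      then show ?thesis
        using Cons.IH[of ?st] Cons.prems by simp
    qed
  qed (use \<open>0 \<le> \<delta>\<close> in simp)
  moreover have "measure_pmf.prob (row_flags r m x) ?Z \<le> pmf (flag r m x (x (\<tau> r))) False"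
  proof -
    \<comment> \<open>Exactly one flag, and that on the wrong side, leaves a single pair; in it the
      flag of the side of \<open>t\<close> is down.\<close>
    have "{(a, b). a \<noteq> b \<and> b \<noteq> t} = {(t, \<not> t)}" for t
      by auto
    then have "measure_pmf.prob (row_flags r m x) ?Z =
        pmf (flag r m x False) (x (\<tau> r)) * pmf (flag r m x True) (\<not> x (\<tau> r))"
      by (simp only: measure_pmf_single pmf_pair)
    also have "\<dots> \<le> pmf (flag r m x (x (\<tau> r))) False"
      by (cases "x (\<tau> r)") (simp_all add: mult_left_le mult_left_le_one_le pmf_le_1)
    finally show ?thesis .
  qed
  moreover have "pmf (flag r m x (x (\<tau> r))) False \<le> \<delta>"
    using Cons.prems by simp
  ultimately show ?case
    by (simp add: algebra_simps)
qed simp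

text \<open>For rows that act like literals the opposite side never raises its flag. The only
  possible fault is that the right flag stays down, and a union bound over the rows remains.\<close>

lemma prob_read_rows_exact:
  assumes "\<And>r. r \<in> set rs \<Longrightarrow> pmf (flag r m x (x (\<tau> r))) False \<le> \<delta>"
    and "\<And>r. r \<in> set rs \<Longrightarrow> pmf (flag r m x (\<not> x (\<tau> r))) False = 1"
  shows "measure_pmf.prob (read_rows m x rs st)
    {st'. st' \<noteq> (\<lambda>j. fst st j \<or> (\<exists>r\<in>set rs. fst r j \<and> x (\<tau> r)), snd st)} \<le> real (length rs) * \<delta>"
  using assms
proof (induction rs arbitrary: st)
  case (Cons r rs)
  have "0 \<le> \<delta>"
    using order_trans[OF pmf_nonneg Cons.prems(1)[of r]] by simp
  let ?Z = "{(a, b). \<not> (a \<noteq> b \<and> b = x (\<tau> r))}"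
  let ?Y = "\<lambda>rs st. {st'. st' \<noteq> (\<lambda>j. fst st j \<or> (\<exists>r\<in>set rs. fst r j \<and> x (\<tau> r)), snd st)}"
  have "measure_pmf.prob (read_rows m x (r # rs) st) (?Y (r # rs) st) \<le>
      measure_pmf.prob (row_flags r m x) ?Z + real (length rs) * \<delta>"
    unfolding read_rows_pair
  proof (rule prob_bind_le)
    fix ab assume ab: "ab \<notin> ?Z"
    obtain a b where [simp]: "ab = (a, b)" by (cases ab)
    let ?st = "(\<lambda>j. fst st j \<or> fst r j \<and> b, snd st \<and> a \<noteq> b)"
    have "?Y (r # rs) st = ?Y rs ?st"
      using ab by (auto simp: fun_eq_iff prod_eq_iff)
    then show "measure_pmf.prob (case ab of (a, b) \<Rightarrow>
        read_rows m x rs (\<lambda>j. fst st j \<or> fst r j \<and> b, snd st \<and> a \<noteq> b)) (?Y (r # rs) st) \<le> real (length rs) * \<delta>"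
      using Cons.IH[of ?st] Cons.prems by simp
  qed (use \<open>0 \<le> \<delta>\<close> in simp)
  also have "measure_pmf.prob (row_flags r m x) ?Z = 1 - measure_pmf.prob (row_flags r m x) {(\<not> x (\<tau> r), x (\<tau> r))}"
    by (subst measure_pmf.prob_compl[symmetric]) (auto intro!: arg_cong[where f = "measure_pmf.prob _"])
  also have "\<dots> \<le> pmf (flag r m x (x (\<tau> r))) False"
    using Cons.prems(2)[of r] by (cases "x (\<tau> r)") (simp_all add: measure_pmf_single pmf_pair pmf_True_eq)
  also have "\<dots> \<le> \<delta>"
    using Cons.prems by simp
  finally show ?case
    by (simp add: algebra_simps)
qed simp

lemma pmf_round_le:
  "pmf (test_round m1 m2 rs) True \<le> pmf (bind_pmf (uniform {..<n}) (check m1 rs)) True"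
  "pmf (test_round m1 m2 rs) True \<le> pmf (bind_pmf sample (check m2 rs)) True"
proof -
  let ?p = "bind_pmf (uniform {..<n}) (check m1 rs)"
  let ?q = "bind_pmf sample (check m2 rs)"
  have "measure_pmf.prob (test_round m1 m2 rs) {b. b} \<le> measure_pmf.prob ?p {b. b} + 0"
    unfolding test_round_def by (rule prob_bind_le) auto
  then show "pmf (test_round m1 m2 rs) True \<le> pmf ?p True"
    unfolding prob_bool by simp
  have "measure_pmf.prob (test_round m1 m2 rs) {b. b} \<le> measure_pmf.prob ?q {b. b}"
    unfolding test_round_def by (rule prob_bind_le') (auto intro!: measure_pmf.finite_measure_mono)
  then show "pmf (test_round m1 m2 rs) True \<le> pmf ?q True"
    unfolding prob_bool by simp
qed

lemma pmf_round_False_le: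
  "pmf (test_round m1 m2 rs) False \<le> pmf (bind_pmf (uniform {..<n}) (check m1 rs)) False +
    pmf (bind_pmf sample (check m2 rs)) False"
proof -
  let ?p = "bind_pmf (uniform {..<n}) (check m1 rs)"
  let ?q = "bind_pmf sample (check m2 rs)"
  have "measure_pmf.prob (test_round m1 m2 rs) {b. \<not> b} \<le> measure_pmf.prob ?p {b. \<not> b} +
      measure_pmf.prob ?q {b. \<not> b}"
    unfolding test_round_def by (rule prob_bind_le) auto
  then show ?thesis
    unfolding prob_bool by simp
qed

end

section \<open>Soundness\<close>

lemma one_minus_power_le:
  fixes a :: real
  assumes "0 \<le> a" "a \<le> 1"
  shows "1 - (1 - a) ^ m \<le> m * a"
  using Bernoulli_inequality[of "- a" m] assms by simp

lemma one_minus_power_le_exp: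
  fixes a :: real
  assumes "a \<le> 1"
  shows "(1 - a) ^ m \<le> exp (- (a * m))"
proof -
  have "(1 - a) ^ m \<le> exp (- a) ^ m"
    by (rule power_mono) (use assms exp_ge_add_one_self[of "- a"] in auto)
  then show ?thesis
    by (simp add: exp_of_nat_mult[symmetric] mult.commute)
qed

context junta_algorithm
begin

section \<open>Acceptance probability of a single round\<close>

lemma influence_nonneg: "0 \<le> influence n h S" and influence_le_1: "influence n h S \<le> 1"
  unfolding influence_def by (simp_all add: pmf_le_1)

abbreviation row_influence :: "row \<Rightarrow> nat set \<Rightarrow> real" where
  "row_influence r \<equiv> influence n (\<lambda>w. F (plug r w))"

text \<open>Each flag goes up with probability at most \<open>m\<close> times the influence of the
  block, hence at most 1/4, and acceptance needs one of the two.\<close>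

lemma pmf_probe_le_blind:
  assumes "r \<in> set rs" "row_influence r UNIV \<le> 1 / (4 * real m)"
  shows "pmf (bind_pmf (uniform {..<n}) (check m rs)) True \<le> 1 / 2"
proof -
  let ?A = "row_influence r UNIV"
  have p: "pmf (flag r m x b) True \<le> m * ?A" for x b
  proof -
    have "row_influence r {j. x j = b} \<le> ?A"
      by (rule influence_mono) simp
    moreover have "pmf (flag r m x b) True \<le> m * row_influence r {j. x j = b}"
      using one_minus_power_le[OF influence_nonneg influence_le_1]
      by (simp add: pmf_True_eq pmf_flag)
    ultimately show ?thesis
      by (meson mult_left_mono of_nat_0_le_iff order_trans)
  qed
  have A: "m * ?A \<le> 1 / 4"
    using assms(2) by (cases "m = 0") (auto simp: field_simps)
  have "pmf (check m rs x) True \<le> 1 / 2" for x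
  proof -
    have "pmf (check m rs x) True \<le>
        pmf (flag r m x False) True * pmf (flag r m x True) False +
        pmf (flag r m x False) False * pmf (flag r m x True) True"
      using pmf_check_le[OF assms(1), of m x] unfolding prob_row_flags by simp
    also have "\<dots> \<le> pmf (flag r m x False) True * 1 + 1 * pmf (flag r m x True) True"
      by (intro add_mono mult_mono) (auto simp: pmf_le_1)
    also have "\<dots> \<le> 1 / 2"
      using p[of x False] p[of x True] A by simp
    finally show ?thesis .
  qed
  then have "measure_pmf.prob (bind_pmf (uniform {..<n}) (check m rs)) {b. b} \<le> 1 / 2"
    by (intro prob_bind_le') (simp add: prob_bool)
  then show ?thesis
    by (simp add: prob_bool)
qed

text \<open>Two raised flags cause rejection. A single trial already raises the flag of a side with
  probability equal to its influence, so the rejection probability is at least the product for the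
  two sides; \<open>expectation_influence_split\<close> bounds its mean from below.\<close>

lemma pmf_probe_le_spread:
  assumes "r \<in> set rs" "1 \<le> m" "\<And>i. i < n \<Longrightarrow> row_influence r {i} \<le> row_influence r UNIV / 2"
  shows "pmf (bind_pmf (uniform {..<n}) (check m rs)) True \<le> 1 - (row_influence r UNIV)\<^sup>2 / 8"
proof -
  let ?A = "row_influence r UNIV"
  let ?V = "\<lambda>x b. row_influence r {j. x j = b}"
  have p: "?V x b \<le> pmf (flag r m x b) True" for x b
  proof -
    have "(1 - ?V x b) ^ m \<le> (1 - ?V x b) ^ 1"
      by (rule power_decreasing) (use assms(2) influence_nonneg influence_le_1 in auto)
    then show ?thesis
      by (simp add: pmf_True_eq pmf_flag)
  qed
  have "pmf (check m rs x) True \<le> 1 - ?V x False * ?V x True" for x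
  proof -
    have "?V x False * ?V x True \<le> pmf (flag r m x False) True * pmf (flag r m x True) True"
      by (intro mult_mono p influence_nonneg) auto
    moreover have "pmf (check m rs x) True \<le>
        1 - pmf (flag r m x False) True * pmf (flag r m x True) True"
    proof -
      have "pmf (check m rs x) True \<le>
          pmf (flag r m x False) True * pmf (flag r m x True) False +
          pmf (flag r m x False) False * pmf (flag r m x True) True"
        using pmf_check_le[OF assms(1), of m x] unfolding prob_row_flags by simp
      also have "\<dots> = 1 - pmf (flag r m x False) True * pmf (flag r m x True) True -
          pmf (flag r m x False) False * pmf (flag r m x True) False"
        by (simp add: pmf_True_eq algebra_simps)
      also have "\<dots> \<le> 1 - pmf (flag r m x False) True * pmf (flag r m x True) True"
        by simp
      finally show ?thesis .
    qed
    ultimately show ?thesis by linarith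
  qed
  then have "measure_pmf.prob (bind_pmf (uniform {..<n}) (check m rs)) {b. b} \<le>
      measure_pmf.expectation (uniform {..<n}) (\<lambda>x. 1 - ?V x False * ?V x True)"
  proof (intro prob_bind_le_expectation[where c = 1])
    show "\<bar>1 - ?V x False * ?V x True\<bar> \<le> 1" for x
      using influence_nonneg influence_le_1 by (simp add: mult_le_one)
  qed (simp_all add: prob_bool)
  also have "\<dots> = 1 - measure_pmf.expectation (uniform {..<n}) (\<lambda>x. ?V x False * ?V x True)"
    by (simp add: expectation_uniform_diff)
  \<comment> \<open>The split is used with \<open>c = ?A / 2\<close>: no variable has more than half
    of the influence.\<close>
  also have "\<dots> \<le> 1 - ?A * (?A - ?A / 2) / 4"
    using expectation_influence_split[of n "\<lambda>w. F (plug r w)" "?A / 2"] assms(3) influence_nonneg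
    by simp
  finally show ?thesis
    by (simp add: prob_bool power2_eq_square)
qed

text \<open>The junta used for comparison in the soundness proof: it copies bit
  \<open>\<tau> r\<close> to the whole block of \<open>r\<close> and so reads at most one variable
  per row.\<close>

lemma rows_junta: 
  assumes "length rs \<le> k" "\<And>r. r \<in> set rs \<Longrightarrow> \<tau> r < n"
  shows "(\<lambda>z. F (\<lambda>j. \<exists>r\<in>set rs. fst r j \<and> z ! \<tau> r)) \<in> juntas n k"
proof -
  let ?g = "\<lambda>z. F (\<lambda>j. \<exists>r\<in>set rs. fst r j \<and> z ! \<tau> r)"
  have "{i. i < n \<and> depends_on n ?g i} \<subseteq> \<tau> ` set rs"
  proof
    fix i assume i: "i \<in> {i. i < n \<and> depends_on n ?g i}"
    show "i \<in> \<tau> ` set rs"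
    proof (rule ccontr)
      assume "i \<notin> \<tau> ` set rs"
      then have "r \<in> set rs \<Longrightarrow> z[i := c] ! \<tau> r = z ! \<tau> r" for z :: "bool list" and c r
        by (metis image_eqI nth_list_update_neq)
      then have "?g (z[i := c]) = ?g z" for z c
        by (intro F_cong) auto
      then show False
        using i by (auto simp: depends_on_def)
    qed
  qed
  then have "card {i. i < n \<and> depends_on n ?g i} \<le> card (\<tau> ` set rs)"
    by (intro card_mono) auto
  also have "\<dots> \<le> k"
    using card_image_le[of "set rs" \<tau>] card_length[of rs] assms(1) by simp
  finally show ?thesis
    by (simp add: juntas_def)
qed

lemma prob_sample:
  "measure_pmf.prob sample X = measure_pmf.prob D {z. (\<lambda>j. j < n \<and> z ! j) \<in> X}"
  unfolding sample_def by (simp add: vimage_def)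

lemma F_sample: "z \<in> set_pmf D \<Longrightarrow> F (\<lambda>j. j < n \<and> z ! j) = f z"
  unfolding F_def using D by (intro arg_cong[of _ _ f] nth_equalityI) (auto simp: cube_def)

definition disagreement :: "row list \<Rightarrow> real" where
  "disagreement rs = measure_pmf.prob sample {x. F x \<noteq> F (masked rs x)}"

text \<open>\<open>f\<close> is \<epsilon>-far from the junta of the rows but differs from its
  masked version with probability at most \<open>\<epsilon> / 2\<close>, so the masked version and
  the junta disagree with probability at least \<open>\<epsilon> / 2\<close>. On such samples
  acceptance requires a wrongly read bit, which has probability at most 1/2. The product is the loss
  \<open>\<epsilon> / 4\<close>.\<close>

lemma pmf_probe_le_far:
  assumes far: "eps_far D \<epsilon> (juntas n k) f"
    and rs: "length rs \<le> k" "disagreement rs \<le> \<epsilon> / 2"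
    and \<tau>: "\<And>r. r \<in> set rs \<Longrightarrow> \<tau> r < n" "\<And>r. r \<in> set rs \<Longrightarrow> c \<le> row_influence r {\<tau> r}"
    and c: "k * (1 - c) ^ m \<le> 1 / 2"
  shows "pmf (bind_pmf sample (check m rs)) True \<le> 1 - \<epsilon> / 4"
proof -
  let ?y = "\<lambda>x j. \<exists>r\<in>set rs. fst r j \<and> x (\<tau> r)"
  define Z where "Z = {x. F (masked rs x) \<noteq> F (?y x)}"
  have "(\<lambda>z. F (\<lambda>j. \<exists>r\<in>set rs. fst r j \<and> z ! \<tau> r)) \<in> juntas n k"
    by (rule rows_junta) (use rs(1) \<tau>(1) in auto)
  then have "\<epsilon> \<le> measure_pmf.prob D {z. f z \<noteq> F (\<lambda>j. \<exists>r\<in>set rs. fst r j \<and> z ! \<tau> r)}"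
    by (rule far[unfolded eps_far_def, rule_format])
  also have "\<dots> = measure_pmf.prob sample {x. F x \<noteq> F (?y x)}"
    unfolding prob_sample
  proof (rule measure_pmf.finite_measure_eq_AE; simp add: AE_measure_pmf_iff; intro ballI)
    fix z assume z: "z \<in> set_pmf D"
    \<comment> \<open>A sampled point is \<open>False\<close> from \<open>n\<close> on, whereas
      \<open>z ! j\<close> is unspecified there; \<open>\<tau> r < n\<close> reconciles the
      two.\<close>
    have "(\<lambda>j. \<exists>r\<in>set rs. fst r j \<and> z ! \<tau> r) = (\<lambda>j. \<exists>r\<in>set rs. fst r j \<and> \<tau> r < n \<and> z ! \<tau> r)"
      using \<tau>(1) by auto
    then show "(f z = (\<not> F (\<lambda>j. \<exists>r\<in>set rs. fst r j \<and> z ! \<tau> r))) =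
        (F (\<lambda>j. j < n \<and> z ! j) = (\<not> F (\<lambda>j. \<exists>r\<in>set rs. fst r j \<and> \<tau> r < n \<and> z ! \<tau> r)))"
      using F_sample[OF z] by simp
  qed
  also have "\<dots> \<le> measure_pmf.prob sample ({x. F x \<noteq> F (masked rs x)} \<union> Z)"
    by (rule measure_pmf.finite_measure_mono) (auto simp: Z_def)
  also have "\<dots> \<le> disagreement rs + measure_pmf.prob sample Z"
    unfolding disagreement_def by (rule measure_Un_le) auto
  finally have Z: "\<epsilon> / 2 \<le> measure_pmf.prob sample Z"
    using rs(2) by simp
  have c0: "row_influence r S \<le> 1" for r S
    by (rule influence_le_1)
  have "measure_pmf.prob (check m rs x) {b. b} \<le> 1 - 1 / 2" if x: "x \<in> Z" for x
  proof -
    have "measure_pmf.prob (check m rs x) {b. b} \<le>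
        measure_pmf.prob (read_rows m x rs (\<lambda>_. False, True)) {st'. snd st' \<and> fst st' \<noteq> ?y x}"
      unfolding check_def measure_map_pmf
      by (rule measure_pmf.finite_measure_mono) (use x in \<open>auto simp: Z_def\<close>)
    also have "\<dots> \<le> real (length rs) * (1 - c) ^ m"
    proof -
      have "pmf (flag r m x (x (\<tau> r))) False \<le> (1 - c) ^ m" if r: "r \<in> set rs" for r
      proof -
        have "row_influence r {\<tau> r} \<le> row_influence r {j. x j = x (\<tau> r)}"
          by (rule influence_mono) auto
        then show ?thesis
          unfolding pmf_flag using \<tau>(2)[OF r] c0 by (intro power_mono) auto
      qed
      from prob_read_rows_wrong[of rs m x \<tau> "(1 - c) ^ m" "(\<lambda>_. False, True)", OF this]
      show ?thesis by simp
    qed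
    also have "\<dots> \<le> k * (1 - c) ^ m"
    proof (cases "rs = []")
      case False
      then obtain r where "r \<in> set rs" by (cases rs) auto
      then have "c \<le> 1"
        using \<tau>(2) c0 order_trans by blast
      then show ?thesis
        using rs(1) by (intro mult_right_mono) auto
    next
      \<comment> \<open>Without rows nothing bounds \<open>c\<close> by 1, but then both points
        compared are constantly \<open>False\<close>, so \<open>x \<in> Z\<close> is
        impossible.\<close>
      case True
      then show ?thesis
        using c x \<tau> rs by (cases "c \<le> 1") (auto simp: Z_def masked_def found_def)
    qed
    finally show ?thesis
      using c by simp
  qed
  then have "measure_pmf.prob (bind_pmf sample (check m rs)) {b. b} \<le>
      1 - 1 / 2 * measure_pmf.prob sample Z"
    by (rule prob_bind_le_on) simp_all
  then show ?thesis
    using Z unfolding prob_bool by simp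
qed

text \<open>A row of influence at most \<open>1 / (4 m1)\<close> makes the uniform point reject with
  constant probability. Above that, a spread influence loses
  \<open>(1 / (4 m1))^2 / 8 = 1 / (128 m1^2)\<close>. If neither case occurs, every row has a
  variable with more than half of its influence, hence at least \<open>1 / (8 m1)\<close>, and the
  sample loses \<open>\<epsilon> / 4\<close>.\<close>

lemma pmf_round_True_le:
  assumes far: "eps_far D \<epsilon> (juntas n k) f"
    and rs: "length rs \<le> k" "disagreement rs \<le> \<epsilon> / 2"
    and m1: "1 \<le> m1" and m2: "k * (1 - 1 / (8 * real m1)) ^ m2 \<le> 1 / 2"
    and \<rho>: "\<rho> \<le> \<epsilon> / 4" "\<rho> \<le> 1 / (128 * real m1 ^ 2)"
  shows "pmf (test_round m1 m2 rs) True \<le> 1 - \<rho>"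
proof -
  consider (blind) r where "r \<in> set rs" "row_influence r UNIV \<le> 1 / (4 * real m1)"
    | (spread) r where "r \<in> set rs" "1 / (4 * real m1) < row_influence r UNIV"
        "\<And>i. i < n \<Longrightarrow> row_influence r {i} \<le> row_influence r UNIV / 2"
    | (good) "\<forall>r\<in>set rs. \<exists>i<n. 1 / (8 * real m1) \<le> row_influence r {i}"
  proof -
    assume *: thesis if "r \<in> set rs" "row_influence r UNIV \<le> 1 / (4 * real m1)" for r
    assume **: thesis if "r \<in> set rs" "1 / (4 * real m1) < row_influence r UNIV"
        "\<And>i. i < n \<Longrightarrow> row_influence r {i} \<le> row_influence r UNIV / 2" for r
    assume ***: thesis if "\<forall>r\<in>set rs. \<exists>i<n. 1 / (8 * real m1) \<le> row_influence r {i}"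
    have "\<exists>i<n. 1 / (8 * real m1) \<le> row_influence r {i}"
      if "r \<in> set rs" "1 / (4 * real m1) < row_influence r UNIV" "i < n"
        "\<not> row_influence r {i} \<le> row_influence r UNIV / 2" for r i
      using that by (intro exI[of _ i]) (auto simp: field_simps)
    then show thesis
      using * ** *** by (meson not_le)
  qed
  then show ?thesis
  proof cases
    case blind
    have "real m1 ^ 2 \<ge> 1"
      using m1 by simp
    then have "1 / (128 * real m1 ^ 2) \<le> 1 / 2"
      using frac_le[of 1 1 2 "128 * real m1 ^ 2"] by simp
    then show ?thesis
      using pmf_round_le(1)[of m1 m2 rs] pmf_probe_le_blind[OF blind] \<rho>(2) by linarith
  next
    case spread
    have "(1 / (4 * real m1)) ^ 2 \<le> (row_influence r UNIV) ^ 2"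
      using spread(2) by (intro power_mono) auto
    then have "1 / (128 * real m1 ^ 2) \<le> (row_influence r UNIV) ^ 2 / 8"
      by (simp add: power_divide power_mult_distrib)
    then show ?thesis
      using pmf_round_le(1)[of m1 m2 rs] pmf_probe_le_spread[OF spread(1) m1 spread(3)] \<rho>(2)
      by linarith
  next
    case good
    then obtain \<tau> where "\<forall>r\<in>set rs. \<tau> r < n \<and> 1 / (8 * real m1) \<le> row_influence r {\<tau> r}"
      by metis
    then show ?thesis
      using pmf_round_le(2)[of m1 m2 rs] pmf_probe_le_far[OF far rs, of \<tau> _ m2] m2 \<rho>(1)
      by fastforce
  qed
qed

text \<open>Rows change only together with the success flag. An epoch without success has thus
  tested the same rows \<open>T\<close> times, and each sample would have exposed the disagreement
  with probability above \<open>\<epsilon> / 2\<close>.\<close>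

lemma prob_epoch_le:
  "measure_pmf.prob (countdown T (\<lambda>_. epoch_step bid s) (rs, a))
     {st. \<not> snd st \<and> \<epsilon> / 2 < disagreement (fst st)} \<le>
   (if \<not> a \<and> \<epsilon> / 2 < disagreement rs then (1 - \<epsilon> / 2) ^ T else 0)"
proof (induction T arbitrary: rs a)
  case (Suc T)
  let ?X = "{st. \<not> snd st \<and> \<epsilon> / 2 < disagreement (fst st)}"
  let ?g = "\<lambda>x. countdown T (\<lambda>_. epoch_step bid s)
      (if \<not> a \<and> F x \<noteq> F (masked rs x) then (extend bid s rs x, True) else (rs, a))"
  have step: "countdown (Suc T) (\<lambda>_. epoch_step bid s) (rs, a) = bind_pmf sample ?g"
    by (simp add: epoch_step_def bind_map_pmf)
  let ?Z = "{x. F x \<noteq> F (masked rs x)}"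
  show ?case
  proof (cases "\<not> a \<and> \<epsilon> / 2 < disagreement rs")
    case True
    have d1: "disagreement rs \<le> 1"
      by (simp add: disagreement_def)
    have "measure_pmf.prob (bind_pmf sample ?g) ?X \<le>
        measure_pmf.expectation sample (\<lambda>x. (1 - \<epsilon> / 2) ^ T * indicator (- ?Z) x)"
    proof (rule prob_bind_le_expectation[where c = "(1 - \<epsilon> / 2) ^ T"])
      show "measure_pmf.prob (?g x) ?X \<le> (1 - \<epsilon> / 2) ^ T * indicator (- ?Z) x" for x
        using Suc.IH[of "extend bid s rs x" True] Suc.IH[of rs a] True
        by (cases "x \<in> ?Z") auto
      show "\<bar>(1 - \<epsilon> / 2) ^ T * indicator (- ?Z) x\<bar> \<le> (1 - \<epsilon> / 2) ^ T" for x
        using True d1 by (auto simp: indicator_def)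
    qed
    also have "\<dots> = (1 - \<epsilon> / 2) ^ T * (1 - disagreement rs)"
      unfolding disagreement_def
      by (simp add: measure_pmf.prob_compl[symmetric] Compl_eq_Diff_UNIV)
    also have "\<dots> \<le> (1 - \<epsilon> / 2) ^ T * (1 - \<epsilon> / 2)"
      using True d1 by (intro mult_left_mono) auto
    finally show ?thesis
      using True unfolding step by (simp add: mult.commute)
  next
    case False
    have "measure_pmf.prob (bind_pmf sample ?g) ?X \<le> 0"
    proof (rule prob_bind_le')
      show "measure_pmf.prob (?g x) ?X \<le> 0" for x
        using Suc.IH[of "extend bid s rs x" True] Suc.IH[of rs a] False by auto
    qed
    then show ?thesis
      unfolding step if_not_P[OF False] .
  qed
qed (auto simp: indicator_def)

lemma set_epoch:
  assumes "st' \<in> set_pmf (epoch bid s T st)"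
  shows "length (fst st') = length (fst st) + of_bool (snd st')"
proof -
  obtain rs a where st: "st = (rs, a)" by (cases st)
  have "\<forall>st'\<in>set_pmf (countdown T (\<lambda>_. epoch_step bid s) (rs, False)).
      length (fst st') = length rs + of_bool (snd st')"
    by (rule set_countdown[where I = "\<lambda>_ st'. length (fst st') = length rs + of_bool (snd st')"])
      (auto simp: epoch_step_def extend_def Let_def split: if_splits)
  then show ?thesis
    using assms unfolding epoch_def st by (auto split: if_splits)
qed

lemma set_collect:
  assumes "st \<in> set_pmf (collect bid s T k)"
  shows "if snd st then length (fst st) = Suc k else length (fst st) \<le> k"
proof -
  have "\<forall>st\<in>set_pmf (countdown (Suc k) (\<lambda>_. epoch bid s T) ([], True)).
      if snd st then length (fst st) + 0 = Suc k else length (fst st) + 0 \<le> k"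
  \<comment> \<open>\<open>i\<close> is the number of epochs left. While all epochs succeed there is
    a row for each epoch run; the first failure leaves the count behind for good.\<close>
  proof (rule set_countdown[where I =
        "\<lambda>i st. if snd st then length (fst st) + i = Suc k else length (fst st) + i \<le> k"])
    fix i and st st' :: "row list \<times> bool"
    assume *: "if snd st then length (fst st) + Suc i = Suc k else length (fst st) + Suc i \<le> k"
      and st': "st' \<in> set_pmf (epoch bid s T st)"
    have "\<not> snd st'" if "\<not> snd st"
      using that st' by (auto simp: epoch_def split: prod.splits)
    then show "if snd st' then length (fst st') + i = Suc k else length (fst st') + i \<le> k"
      using * set_epoch[OF st'] by (auto split: if_splits)
  qed simp
  from bspec[OF this assms[unfolded collect_def]] show ?thesis
    by (simp split: if_splits)
qed

text \<open>The invariant speaks only about states after a failure. It can break only in the epoch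
  that fails first, since later ones leave the rows alone.\<close>

lemma prob_collect_le:
  assumes "0 \<le> \<epsilon>" "\<epsilon> \<le> 2"
  shows "measure_pmf.prob (collect bid s T k) {st. \<not> (\<not> snd st \<longrightarrow> disagreement (fst st) \<le> \<epsilon> / 2)} \<le>
    real (Suc k) * (1 - \<epsilon> / 2) ^ T"
  unfolding collect_def
proof (rule prob_countdown_le[where I = "\<lambda>_ st. \<not> snd st \<longrightarrow> disagreement (fst st) \<le> \<epsilon> / 2"])
  fix st :: "row list \<times> bool"
  assume st: "\<not> snd st \<longrightarrow> disagreement (fst st) \<le> \<epsilon> / 2"
  obtain rs a where [simp]: "st = (rs, a)" by (cases st)
  have "{st. \<not> (\<not> snd st \<longrightarrow> disagreement (fst st) \<le> \<epsilon> / 2)} =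
      {st. \<not> snd st \<and> \<epsilon> / 2 < disagreement (fst st)}"
    by auto
  moreover have "(if \<epsilon> / 2 < disagreement rs then (1 - \<epsilon> / 2) ^ T else 0) \<le> (1 - \<epsilon> / 2) ^ T"
    using assms by simp
  ultimately show "measure_pmf.prob (epoch bid s T st)
      {st. \<not> (\<not> snd st \<longrightarrow> disagreement (fst st) \<le> \<epsilon> / 2)} \<le> (1 - \<epsilon> / 2) ^ T"
    using st prob_epoch_le[of T bid s rs False \<epsilon>] assms by (auto simp: epoch_def)
qed simp

text \<open>There are two ways to accept wrongly: the collection stops while the disagreement still
  exceeds \<open>\<epsilon> / 2\<close>, or all \<open>M\<close> independent rounds accept. A
  collection of \<open>k + 1\<close> rows is rejected with certainty.\<close>

lemma soundness:
  assumes far: "eps_far D \<epsilon> (juntas n k) f" and \<epsilon>: "0 \<le> \<epsilon>" "\<epsilon> \<le> 2"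
    and m1: "1 \<le> m1" and m2: "k * (1 - 1 / (8 * real m1)) ^ m2 \<le> 1 / 2"
    and \<rho>: "\<rho> \<le> \<epsilon> / 4" "\<rho> \<le> 1 / (128 * real m1 ^ 2)" "0 \<le> \<rho>"
  shows "pmf (algorithm k s T M m1 m2) True \<le> real (Suc k) * (1 - \<epsilon> / 2) ^ T + (1 - \<rho>) ^ M"
proof -
  have "measure_pmf.prob (bind_pmf (collect bid s T k) (decide M m1 m2)) {b. b} \<le>
      real (Suc k) * (1 - \<epsilon> / 2) ^ T + (1 - \<rho>) ^ M" for bid
  proof -
    let ?Z = "{st. \<not> (\<not> snd st \<longrightarrow> disagreement (fst st) \<le> \<epsilon> / 2)}"
    have "measure_pmf.prob (bind_pmf (collect bid s T k) (decide M m1 m2)) {b. b} \<le>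
        measure_pmf.prob (collect bid s T k) ?Z + (1 - \<rho>) ^ M"
    proof (rule prob_bind_le)
      show \<rho>1: "0 \<le> (1 - \<rho>) ^ M"
        using \<rho>(1) \<epsilon>(2) by simp
      fix st assume st: "st \<in> set_pmf (collect bid s T k)" "st \<notin> ?Z"
      obtain rs a where [simp]: "st = (rs, a)" by (cases st)
      show "measure_pmf.prob (decide M m1 m2 st) {b. b} \<le> (1 - \<rho>) ^ M"
      proof (cases a)
        case False
        then have "pmf (test_round m1 m2 rs) True \<le> 1 - \<rho>"
          using set_collect[OF st(1)] st(2) by (intro pmf_round_True_le[OF far _ _ m1 m2 \<rho>(1,2)]) auto
        then show ?thesis
          using False by (simp add: decide_def prob_bool pmf_countdown_and power_mono)
      qed (use \<rho>1 in \<open>simp add: decide_def prob_bool pmf_countdown_and\<close>)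
    qed
    then show ?thesis
      using prob_collect_le[OF \<epsilon>, of bid s T k] by simp
  qed
  then have "measure_pmf.prob (algorithm k s T M m1 m2) {b. b} \<le>
      real (Suc k) * (1 - \<epsilon> / 2) ^ T + (1 - \<rho>) ^ M"
    unfolding algorithm_def by (rule prob_bind_le')
  then show ?thesis
    by (simp add: prob_bool)
qed

end

section \<open>Completeness\<close>

text \<open>Bits arrive with the most significant one first, so after the leading part
  \<open>b\<close> the result is uniform among the numbers with that leading part.\<close>

lemma pmf_digits_aux:
  "pmf (countdown s (\<lambda>_ b. map_pmf (\<lambda>c. 2 * b + of_bool c) (bernoulli_pmf (1/2))) b) v =
    (if b * 2 ^ s \<le> v \<and> v < Suc b * 2 ^ s then 1 / 2 ^ s else 0)"
proof (induction s arbitrary: b)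
  case (Suc s)
  have "pmf (countdown (Suc s) (\<lambda>_ b. map_pmf (\<lambda>c. 2 * b + of_bool c) (bernoulli_pmf (1/2))) b) v =
     ((if Suc (2 * b) * 2 ^ s \<le> v \<and> v < Suc (Suc (2 * b)) * 2 ^ s then 1 / 2 ^ s else 0) +
      (if 2 * b * 2 ^ s \<le> v \<and> v < Suc (2 * b) * 2 ^ s then 1 / 2 ^ s else 0)) / 2"
    by (simp add: bind_map_pmf pmf_bind Suc.IH)
  also have "\<dots> = (if b * 2 ^ Suc s \<le> v \<and> v < Suc b * 2 ^ Suc s then 1 / 2 ^ Suc s else 0)"
    by (auto simp: algebra_simps)
  finally show ?case .
qed (auto simp: indicator_def)

lemma pmf_digits: "pmf (digits s) v = (if v < 2 ^ s then 1 / 2 ^ s else 0)"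
  unfolding digits_def pmf_digits_aux by simp

lemma set_digits: "v \<in> set_pmf (digits s) \<Longrightarrow> v < 2 ^ s"
  by (auto simp: set_pmf_iff pmf_digits split: if_splits)

context junta_algorithm
begin

section \<open>Random labels separate the relevant variables\<close>

lemma set_labels: "bid \<in> set_pmf (labels s) \<Longrightarrow> bid j < 2 ^ s"
  unfolding labels_def
  by (cases "j < n") (use set_digits in \<open>auto simp: set_Pi_pmf PiE_dflt_def\<close>)

text \<open>Given all other labels, the label of \<open>i\<close> would have to hit one particular
  value.\<close>

lemma prob_labels_collide:
  assumes "i < n" "i' < n" "i \<noteq> i'"
  shows "measure_pmf.prob (labels s) {bid. bid i = bid i'} \<le> 1 / 2 ^ s"
proof -
  have n: "{..<n} = insert i ({..<n} - {i})"
    using assms by auto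
  have "labels s = bind_pmf (Pi_pmf ({..<n} - {i}) 0 (\<lambda>_. digits s))
      (\<lambda>g. map_pmf (\<lambda>v. g(i := v)) (digits s))"
    unfolding labels_def by (subst n, subst Pi_pmf_insert')
      (auto simp: map_pmf_def intro: bind_commute_pmf)
  also have "measure_pmf.prob \<dots> {bid. bid i = bid i'} \<le> 1 / 2 ^ s"
  proof (rule prob_bind_le')
    fix g
    have "measure_pmf.prob (map_pmf (\<lambda>v. g(i := v)) (digits s)) {bid. bid i = bid i'} =
        measure_pmf.prob (digits s) {g i'}"
      using assms(3) by (auto intro!: arg_cong[where f = "measure_pmf.prob _"])
    then show "measure_pmf.prob (map_pmf (\<lambda>v. g(i := v)) (digits s)) {bid. bid i = bid i'} \<le> 1 / 2 ^ s"
      by (simp add: measure_pmf_single pmf_digits)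
  qed
  finally show ?thesis .
qed

section \<open>Relevant variables and rows that act like literals\<close>

definition relevant :: "nat set" where
  "relevant = {i. i < n \<and> depends_on n f i}"

lemma finite_relevant: "finite relevant"
  by (simp add: relevant_def)

lemma prob_labels_not_inj:
  "measure_pmf.prob (labels s) {bid. \<not> inj_on bid relevant} \<le> (real (card relevant))\<^sup>2 / 2 ^ s"
proof -
  define P where "P = {(i, i') \<in> relevant \<times> relevant. i \<noteq> i'}"
  have fin: "finite P"
    unfolding P_def by (rule finite_subset[of _ "relevant \<times> relevant"]) (use finite_relevant in auto)
  have "measure_pmf.prob (labels s) {bid. \<not> inj_on bid relevant} \<le>
      measure_pmf.prob (labels s) (\<Union>p\<in>P. {bid. bid (fst p) = bid (snd p)})"
    by (rule measure_pmf.finite_measure_mono) (auto simp: inj_on_def P_def)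
  also have "\<dots> \<le> (\<Sum>p\<in>P. measure_pmf.prob (labels s) {bid. bid (fst p) = bid (snd p)})"
    by (rule measure_pmf.finite_measure_subadditive_finite) (use fin in auto)
  also have "\<dots> \<le> (\<Sum>p\<in>P. 1 / 2 ^ s)"
    by (rule sum_mono) (auto simp: P_def relevant_def intro!: prob_labels_collide)
  also have "\<dots> \<le> real (card (relevant \<times> relevant)) * (1 / 2 ^ s)"
    unfolding sum_constant
    by (intro mult_right_mono of_nat_mono card_mono) (use finite_relevant in \<open>auto simp: P_def\<close>)
  finally show ?thesis
    by (simp add: power2_eq_square card_cartesian_product)
qed

lemma F_flip:
  assumes "j < n" "j \<notin> relevant"
  shows "F (p(j := c)) = F p"
proof -
  have upd: "map (p(j := c)) [0..<n] = (map p [0..<n])[j := c]" for c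
    by (rule nth_equalityI) (auto simp: nth_list_update)
  have "\<forall>x\<in>cube n. f (x[j := \<not> x ! j]) = f x"
    using assms by (auto simp: relevant_def depends_on_def)
  from bspec[OF this, of "map p [0..<n]"]
  have "f ((map p [0..<n])[j := \<not> map p [0..<n] ! j]) = f (map p [0..<n])"
    by (simp add: cube_def)
  then have "F (p(j := \<not> p j)) = F p"
    unfolding F_def upd using assms by simp
  then show ?thesis
    by (cases "c = p j") (auto simp: fun_upd_idem)
qed

text \<open>The coordinates of \<open>p\<close> are replaced by those of \<open>q\<close> one after
  another; each replacement changes nothing or concerns an irrelevant coordinate.\<close>

lemma F_relevant:
  assumes "\<And>j. j \<in> relevant \<Longrightarrow> p j = q j"
  shows "F p = F q"
proof -
  have "F (\<lambda>j. if j < m then q j else p j) = F p" if "m \<le> n" for m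
    using that
  proof (induction m)
    case (Suc m)
    have "(\<lambda>j. if j < Suc m then q j else p j) = (\<lambda>j. if j < m then q j else p j)(m := q m)"
      by (auto simp: less_Suc_eq)
    moreover have "F ((\<lambda>j. if j < m then q j else p j)(m := q m)) = F (\<lambda>j. if j < m then q j else p j)"
      using F_flip[of m] assms Suc.prems by (cases "m \<in> relevant") (auto simp: fun_upd_idem)
    ultimately show ?case
      using Suc by simp
  qed simp
  from this[of n] have "F (\<lambda>j. if j < n then q j else p j) = F p"
    by simp
  moreover have "F (\<lambda>j. if j < n then q j else p j) = F q"
    by (rule F_cong) simp
  ultimately show ?thesis by simp
qed

text \<open>\<open>i\<close> is the only relevant variable of the block and matters at the stored
  point, so \<open>F (plug r w)\<close> is a literal in \<open>w i\<close>.\<close>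

definition sound_row :: "row \<Rightarrow> nat \<Rightarrow> bool" where
  "sound_row r i \<longleftrightarrow> i \<in> relevant \<and> (\<forall>j\<in>relevant. fst r j \<longleftrightarrow> j = i) \<and>
     F ((snd r)(i := True)) \<noteq> F ((snd r)(i := False))"

lemma F_plug:
  assumes "sound_row r i"
  shows "F (plug r w) = F ((snd r)(i := w i))"
  using assms by (intro F_relevant) (auto simp: sound_row_def plug_def)

lemma F_plug_neq:
  assumes "sound_row r i"
  shows "F (plug r w) \<noteq> F (plug r u) \<longleftrightarrow> w i \<noteq> u i"
  unfolding F_plug[OF assms] using assms by (cases "w i"; cases "u i") (auto simp: sound_row_def)

text \<open>For a literal, disagreement means that the bit at \<open>i\<close> has changed: a fair
  coin if \<open>i\<close> is resampled, impossible otherwise.\<close>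

lemma influence_sound_row:
  assumes "sound_row r i"
  shows "influence n (\<lambda>w. F (plug r w)) S = (if i \<in> S then 1 / 2 else 0)"
proof -
  have i: "i < n"
    using assms by (auto simp: sound_row_def relevant_def)
  have comp: "map_pmf (\<lambda>u. u i) (uniform {..<n}) = bernoulli_pmf (1 / 2)"
    unfolding uniform_def using i by (subst Pi_pmf_component) auto
  have "map_pmf (\<lambda>u. F (plug r w) \<noteq> F (plug r (resample S u w))) (uniform {..<n}) =
      (if i \<in> S then bernoulli_pmf (1 / 2) else return_pmf False)" for w
  proof (cases "i \<in> S")
    case True
    have "map_pmf (\<lambda>u. F (plug r w) \<noteq> F (plug r (resample S u w))) (uniform {..<n}) =
        map_pmf (\<lambda>c. w i \<noteq> c) (map_pmf (\<lambda>u. u i) (uniform {..<n}))"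
      unfolding F_plug_neq[OF assms] using True by (simp add: pmf.map_comp o_def resample_def)
    also have "\<dots> = bernoulli_pmf (1 / 2)"
      unfolding comp
    proof (rule pmf_eqI)
      fix c
      have "pmf (map_pmf (\<lambda>c. w i \<noteq> c) (bernoulli_pmf (1 / 2))) c = pmf (bernoulli_pmf (1 / 2)) (w i \<noteq> c)"
      proof -
        have "(\<lambda>c. w i \<noteq> c) -` {c} = {w i \<noteq> c}"
          by auto
        then show ?thesis
          by (simp only: pmf_map measure_pmf_single)
      qed
      then show "pmf (map_pmf (\<lambda>c. w i \<noteq> c) (bernoulli_pmf (1 / 2))) c = pmf (bernoulli_pmf (1 / 2)) c"
        by (cases c; cases "w i") auto
    qed
    finally show ?thesis
      using True by simp
  next
    case False
    then show ?thesis
      unfolding F_plug_neq[OF assms] by (simp add: resample_def map_pmf_const)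
  qed
  then show ?thesis
    unfolding influence_def trial_def by (simp add: bind_pmf_const)
qed

text \<open>The cardinality bound lets every row account for a relevant variable of its own; this is
  what limits the rows of a \<open>k\<close>-junta to \<open>k\<close>.\<close>

definition sound_rows :: "row list \<Rightarrow> bool" where
  "sound_rows rs \<longleftrightarrow> (\<forall>r\<in>set rs. \<exists>i. sound_row r i) \<and>
     length rs \<le> card {j\<in>relevant. found rs j}"

lemma pmf_check_False_le:
  assumes "sound_rows rs"
  shows "pmf (check m rs x) False \<le> real (length rs) * (1 / 2) ^ m"
proof -
  obtain \<tau> where \<tau>: "\<And>r. r \<in> set rs \<Longrightarrow> sound_row r (\<tau> r)"
    using assms unfolding sound_rows_def by metis
  let ?st = "(\<lambda>j. \<exists>r\<in>set rs. fst r j \<and> x (\<tau> r), True)"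
  \<comment> \<open>A relevant coordinate in the block of \<open>r\<close> can only be
    \<open>\<tau> r\<close>, so the masked point and the point read off agree on all relevant
    coordinates.\<close>
  have F: "F (masked rs x) = F (fst ?st)"
    using \<tau> by (intro F_relevant) (auto simp: masked_def found_def sound_row_def)
  have "pmf (check m rs x) False = measure_pmf.prob (read_rows m x rs (\<lambda>_. False, True))
      {st'. \<not> (snd st' \<and> F (masked rs x) = F (fst st'))}"
    unfolding check_def pmf_map
    by (rule arg_cong[where f = "measure_pmf.prob _"]) (simp add: vimage_def case_prod_unfold)
  also have "\<dots> \<le> measure_pmf.prob (read_rows m x rs (\<lambda>_. False, True)) {st'. st' \<noteq> ?st}"
    by (rule measure_pmf.finite_measure_mono, intro subsetI CollectI notI) (use F in simp_all)
  also have "\<dots> \<le> real (length rs) * (1 / 2) ^ m"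
  proof -
    have "pmf (flag r m x (x (\<tau> r))) False \<le> (1 / 2) ^ m"
      "pmf (flag r m x (\<not> x (\<tau> r))) False = 1" if "r \<in> set rs" for r
      by (simp_all add: pmf_flag influence_sound_row[OF \<tau>[OF that]])
    from prob_read_rows_exact[of rs m x \<tau> "(1 / 2) ^ m" "(\<lambda>_. False, True)", OF this]
    show ?thesis by simp
  qed
  finally show ?thesis .
qed

lemma pmf_round_False:
  assumes "sound_rows rs" "length rs \<le> k" "m1 \<le> m2"
  shows "pmf (test_round m1 m2 rs) False \<le> 2 * real k * (1 / 2) ^ m1"
proof -
  have *: "pmf (bind_pmf p (check m rs)) False \<le> real k * (1 / 2) ^ m1" if "m1 \<le> m" for p m
  proof -
    have "measure_pmf.prob (bind_pmf p (check m rs)) {b. \<not> b} \<le> real (length rs) * (1 / 2) ^ m"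
      by (rule prob_bind_le') (simp add: prob_bool pmf_check_False_le[OF assms(1)])
    also have "\<dots> \<le> real k * (1 / 2) ^ m1"
      by (intro mult_mono power_decreasing) (use assms that in auto)
    finally show ?thesis
      by (simp add: prob_bool)
  qed
  show ?thesis
    using pmf_round_False_le[of m1 m2 rs] *[of m1 "uniform {..<n}"] *[of m2 sample] assms(3) by simp
qed

text \<open>Two adjacent hybrids with different values differ only inside the new block. Hence the
  block contains a relevant variable on which they differ, and injectivity of the labels excludes a
  second one.\<close>

lemma sound_rows_extend:
  assumes rs: "sound_rows rs" and bid: "inj_on bid relevant" "\<And>j. bid j < 2 ^ s"
    and x: "F x \<noteq> F (masked rs x)"
  shows "sound_rows (extend bid s rs x)"
proof -
  let ?g = "\<lambda>c. F (hybrid bid rs x c)"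
  define lo where "lo = search ?g (F (masked rs x)) s 0"
  have "?g lo = F (masked rs x) \<and> ?g (Suc lo) \<noteq> F (masked rs x)"
    unfolding lo_def
  proof (rule search_correct)
    show "?g 0 = F (masked rs x)"
      by (simp add: hybrid_def masked_def)
    \<comment> \<open>All labels are below \<open>2 ^ s\<close>, so the last hybrid is
      \<open>x\<close> itself.\<close>
    show "?g (0 + 2 ^ s) \<noteq> F (masked rs x)"
      using x bid(2) by (simp add: hybrid_def)
  qed
  then have lo: "?g (Suc lo) \<noteq> ?g lo" by simp
  let ?B = "\<lambda>j. \<not> found rs j \<and> bid j = lo"
  let ?v = "hybrid bid rs x (Suc lo)"
  obtain i where i: "i \<in> relevant" "?v i \<noteq> hybrid bid rs x lo i"
    using F_relevant[of ?v "hybrid bid rs x lo"] lo by blast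
  then have Bi: "?B i" and vi: "?v i"
    by (auto simp: hybrid_def less_Suc_eq)
  have B: "?B j \<longleftrightarrow> j = i" if "j \<in> relevant" for j
    using that i(1) Bi bid(1) by (auto dest: inj_onD)
  have v1: "?v(i := True) = ?v"
    using vi by (simp add: fun_upd_idem)
  \<comment> \<open>Apart from \<open>i\<close> the block holds only irrelevant coordinates, so
    clearing \<open>i\<close> has the same effect on \<open>F\<close> as clearing the whole
    block.\<close>
  have v0: "F (?v(i := False)) = F (hybrid bid rs x lo)"
    using B Bi by (intro F_relevant) (auto simp: hybrid_def less_Suc_eq)
  have "sound_row (?B, ?v) i"
    unfolding sound_row_def fst_conv snd_conv v1 v0
    by (intro conjI ballI i(1) B lo)
  then have "\<forall>r\<in>set ((?B, ?v) # rs). \<exists>i. sound_row r i"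
    using rs unfolding sound_rows_def by (metis set_ConsD)
  moreover have "length rs \<le> card {j\<in>relevant. found rs j}"
    using rs unfolding sound_rows_def by (rule conjunct2)
  moreover have "Suc (card {j\<in>relevant. found rs j}) \<le> card {j\<in>relevant. found ((?B, ?v) # rs) j}"
  proof -
    have "Suc (card {j\<in>relevant. found rs j}) = card (insert i {j\<in>relevant. found rs j})"
      using Bi finite_relevant by simp
    also have "\<dots> \<le> card {j\<in>relevant. found ((?B, ?v) # rs) j}"
      using i(1) Bi finite_relevant by (intro card_mono) (auto simp: found_def)
    finally show ?thesis .
  qed
  moreover have "extend bid s rs x = (?B, ?v) # rs"
    by (simp add: extend_def lo_def Let_def)
  ultimately show ?thesis
    unfolding sound_rows_def list.size by (intro conjI) (simp_all only: list.size)
qed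

lemma set_collect_sound:
  assumes bid: "inj_on bid relevant" "\<And>j. bid j < 2 ^ s" and "st \<in> set_pmf (collect bid s T k)"
  shows "sound_rows (fst st)"
proof -
  have step: "sound_rows (fst st')" if "sound_rows (fst st)" "st' \<in> set_pmf (epoch_step bid s st)" for st st'
    using that sound_rows_extend[OF _ bid] by (auto simp: epoch_step_def split: if_splits prod.splits)
  have ep: "sound_rows (fst st')" if "sound_rows (fst st)" "st' \<in> set_pmf (epoch bid s T st)" for st st'
  proof -
    have "\<forall>st'\<in>set_pmf (countdown T (\<lambda>_. epoch_step bid s) (fst st, False)). sound_rows (fst st')"
      by (rule set_countdown[where I = "\<lambda>_ st. sound_rows (fst st)"]) (use step that(1) in auto)
    then show ?thesis
      using that by (auto simp: epoch_def split: prod.splits if_splits)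
  qed
  have "sound_rows []"
    by (simp add: sound_rows_def)
  have "\<forall>st\<in>set_pmf (countdown (Suc k) (\<lambda>_. epoch bid s T) ([], True)). sound_rows (fst st)"
    by (rule set_countdown[where I = "\<lambda>_ st. sound_rows (fst st)"])
      (use ep \<open>sound_rows []\<close> in auto)
  then show ?thesis
    using assms(3) unfolding collect_def by blast
qed

lemma sound_rows_length:
  assumes "sound_rows rs" "f \<in> juntas n k"
  shows "length rs \<le> k"
proof -
  have "length rs \<le> card {j\<in>relevant. found rs j}"
    using assms(1) by (simp add: sound_rows_def)
  also have "\<dots> \<le> card relevant"
    by (intro card_mono finite_relevant) auto
  also have "\<dots> \<le> k"
    using assms(2) by (simp add: relevant_def juntas_def)
  finally show ?thesis .
qed

text \<open>Rejection requires a collision of labels or a fault in one of the rounds; with injective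
  labels \<open>k + 1\<close> rows never occur.\<close>

lemma completeness:
  assumes "f \<in> juntas n k" "m1 \<le> m2"
  shows "pmf (algorithm k s T M m1 m2) False \<le>
    (real k)\<^sup>2 / 2 ^ s + real M * (2 * real k * (1 / 2) ^ m1)"
proof -
  let ?\<delta> = "real M * (2 * real k * (1 / 2) ^ m1)"
  let ?Z = "{bid. \<not> inj_on bid relevant}"
  have "measure_pmf.prob (bind_pmf (collect bid s T k) (decide M m1 m2)) {b. \<not> b} \<le> ?\<delta>"
    if bid: "bid \<in> set_pmf (labels s)" "bid \<notin> ?Z" for bid
  proof (rule prob_bind_le')
    fix st assume st: "st \<in> set_pmf (collect bid s T k)"
    obtain rs a where [simp]: "st = (rs, a)" by (cases st)
    have sound: "sound_rows rs"
      using set_collect_sound[OF _ _ st] bid(2) set_labels[OF bid(1)] by simp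
    have len: "length rs \<le> k"
      by (rule sound_rows_length[OF sound assms(1)])
    have "\<not> a"
      using set_collect[OF st] len by (auto split: if_splits)
    then have "measure_pmf.prob (decide M m1 m2 st) {b. \<not> b} = measure_pmf.prob
        (countdown M (\<lambda>_ ok. map_pmf (\<lambda>r. ok \<and> r) (test_round m1 m2 rs)) True) {b. \<not> b}"
      by (simp add: decide_def)
    also have "\<dots> \<le> ?\<delta>"
    proof (rule prob_countdown_le[where I = "\<lambda>_ b. b"])
      fix ok :: bool
      assume ok
      then show "measure_pmf.prob (map_pmf (\<lambda>r. ok \<and> r) (test_round m1 m2 rs)) {b. \<not> b} \<le>
          2 * real k * (1 / 2) ^ m1"
        using pmf_round_False[OF sound len assms(2)] by (simp add: prob_bool)
    qed simp
    finally show "measure_pmf.prob (decide M m1 m2 st) {b. \<not> b} \<le> ?\<delta>" .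
  qed
  then have "measure_pmf.prob (algorithm k s T M m1 m2) {b. \<not> b} \<le>
      measure_pmf.prob (labels s) ?Z + ?\<delta>"
    unfolding algorithm_def by (rule prob_bind_le) auto
  also have "\<dots> \<le> (real (card relevant))\<^sup>2 / 2 ^ s + ?\<delta>"
    by (intro add_right_mono prob_labels_not_inj)
  also have "\<dots> \<le> (real k)\<^sup>2 / 2 ^ s + ?\<delta>"
    using assms(1) by (intro add_right_mono divide_right_mono power_mono) (auto simp: juntas_def relevant_def)
  finally show ?thesis
    by (simp add: prob_bool)
qed

end

section \<open>Expressions, memory layout and basic programs\<close>

lemma countdown_cong:
  "(\<And>i a. i < N \<Longrightarrow> g i a = g' i a) \<Longrightarrow> countdown N g a = countdown N g' a"
proof (induction N arbitrary: a)
  case (Suc N)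
  have "countdown N g = countdown N g'"
    by (rule ext) (use Suc in simp)
  then show ?case
    using Suc.prems by simp
qed simp

lemma countdown_unit: "countdown N (\<lambda>_ _. return_pmf ()) () = return_pmf ()"
  by (induction N) (simp_all add: bind_return_pmf)

text \<open>The bridge from array loops to product distributions: the values are drawn independently
  and no position is visited twice.\<close>

lemma countdown_Pi_pmf:
  "countdown N (\<lambda>i w. map_pmf (\<lambda>v. w(i := v)) q) w =
    map_pmf (\<lambda>g j. if j < N then g j else w j) (Pi_pmf {..<N} d (\<lambda>_. q))"
proof (induction N arbitrary: w)
  case (Suc N)
  have "{..<Suc N} = insert N {..<N}"
    by auto
  then have "map_pmf (\<lambda>g j. if j < Suc N then g j else w j) (Pi_pmf {..<Suc N} d (\<lambda>_. q)) =
      bind_pmf q (\<lambda>v. map_pmf (\<lambda>g j. if j < Suc N then (g(N := v)) j else w j) (Pi_pmf {..<N} d (\<lambda>_. q)))"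
    by (simp add: Pi_pmf_insert' map_bind_pmf) (simp add: map_pmf_def)
  also have "\<dots> = countdown (Suc N) (\<lambda>i w. map_pmf (\<lambda>v. w(i := v)) q) w"
    unfolding countdown.simps bind_map_pmf
  proof (intro bind_pmf_cong refl)
    fix v
    show "map_pmf (\<lambda>g j. if j < Suc N then (g(N := v)) j else w j) (Pi_pmf {..<N} d (\<lambda>_. q)) =
        countdown N (\<lambda>i w. map_pmf (\<lambda>v. w(i := v)) q) (w(N := v))"
      unfolding Suc.IH by (rule map_pmf_cong) auto
  qed
  finally show ?case
    by (rule sym)
qed simp

lemma countdown_Pi_pmf_default:
  "countdown N (\<lambda>i w. map_pmf (\<lambda>v. w(i := v)) q) (\<lambda>_. d) = Pi_pmf {..<N} d (\<lambda>_. q)"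
proof -
  have "map_pmf (\<lambda>g j. if j < N then g j else d) (Pi_pmf {..<N} d (\<lambda>_. q)) =
      map_pmf (\<lambda>g. g) (Pi_pmf {..<N} d (\<lambda>_. q))"
  proof (rule map_pmf_cong[OF refl])
    fix g assume "g \<in> set_pmf (Pi_pmf {..<N} d (\<lambda>_. q))"
    then have "\<forall>j. j \<notin> {..<N} \<longrightarrow> g j = d"
      using set_Pi_pmf_subset[of "{..<N}" d "\<lambda>_. q"] by blast
    then show "(\<lambda>j. if j < N then g j else d) = g"
      by auto
  qed
  then show ?thesis
    unfolding countdown_Pi_pmf[where d = d] by simp
qed

section \<open>Boolean expressions and memory layout\<close>

abbreviation V :: "nat \<Rightarrow> expr" where
  "V i \<equiv> Cell (Lit i)"

abbreviation Assign :: "nat \<Rightarrow> expr \<Rightarrow> com" where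
  "Assign i \<equiv> Store (Lit i)"

text \<open>Truncated subtraction sends 0 to 1 and everything else to 0. A double
  \<open>NotE\<close> normalises a truth value to 0 or 1.\<close>

definition NotE :: "expr \<Rightarrow> expr" where
  "NotE e = Sub (Lit 1) e"

definition OrE :: "expr \<Rightarrow> expr \<Rightarrow> expr" where
  "OrE a b = NotE (NotE (Add a b))"

definition AndE :: "expr \<Rightarrow> expr \<Rightarrow> expr" where
  "AndE a b = NotE (Add (NotE a) (NotE b))"

definition LessE :: "expr \<Rightarrow> expr \<Rightarrow> expr" where
  "LessE a b = NotE (NotE (Sub b a))"

definition NeqE :: "expr \<Rightarrow> expr \<Rightarrow> expr" where
  "NeqE a b = OrE (Sub a b) (Sub b a)"

definition IfE :: "expr \<Rightarrow> expr \<Rightarrow> expr \<Rightarrow> expr" where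
  "IfE c a b = OrE (AndE c a) (AndE (NotE c) b)"

lemma val_boolean [simp]:
  "val m (NotE e) = of_bool (val m e = 0)"
  "val m (OrE a b) = of_bool (val m a \<noteq> 0 \<or> val m b \<noteq> 0)"
  "val m (AndE a b) = of_bool (val m a \<noteq> 0 \<and> val m b \<noteq> 0)"
  "val m (LessE a b) = of_bool (val m a < val m b)"
  "val m (NeqE a b) = of_bool (val m a \<noteq> val m b)"
  "val m (IfE c a b) = of_bool (if val m c \<noteq> 0 then val m a \<noteq> 0 else val m b \<noteq> 0)"
  by (auto simp: NotE_def OrE_def AndE_def LessE_def NeqE_def IfE_def)

text \<open>
  Cells below 40 hold scalars. Cells 0, 1, 2 are the input; 3 to 8 hold the parameters: the
  logarithm of the size of the input, the length of a label, the numbers of trials for uniform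
  points and for samples, the number of rounds, and the number of samples of an epoch; 9 tells
  whether the current epoch has found a block, 10 is the verdict, 11 the number of rows, 13 and 14
  are the two flags of a row, 15 and 16 answers to queries, 17 the position of the binary search,
  28 the current number of trials. The others are counters and temporaries. Array \<open>c\<close> has
  length \<open>n\<close> and starts at \<open>40 + c n\<close>: array 0 holds the labels, 1 the union of the blocks
  found, 2 the point under consideration, 3 and 4 random points, 5 the point to be queried, 6 the values read off the blocks, \<open>7 + 2 i\<close> and \<open>8 + 2 i\<close> the
  components of the \<open>i\<close>-th row. Cell 12 points to the array of the first component of a row.
\<close>

fun array :: "nat \<Rightarrow> expr" where
  "array 0 = Lit 40"
| "array (Suc c) = Add (V 0) (array c)"

lemma val_array [simp]: "val m (array c) = 40 + c * m 0"
  by (induction c) auto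

text \<open>Cell 19 is the index of every array loop, so expressions for elements need no index
  argument.\<close>

definition El :: "nat \<Rightarrow> expr" where
  "El c = Cell (Add (array c) (V 19))"

abbreviation Row_block :: expr where
  "Row_block \<equiv> V 12"

abbreviation Row_point :: expr where
  "Row_point \<equiv> Add (V 12) (V 0)"

abbreviation At :: "expr \<Rightarrow> expr" where
  "At e \<equiv> Cell (Add e (V 19))"

definition Map_array :: "expr \<Rightarrow> expr \<Rightarrow> com" where
  "Map_array a e = For 19 (V 0) (Store (Add a (V 19)) e)"

definition Random_array :: "nat \<Rightarrow> com" where
  "Random_array c = For 19 (V 0) (Flip (Add (array c) (V 19)))"

definition reg :: "nat \<Rightarrow> mem \<Rightarrow> nat \<Rightarrow> nat \<Rightarrow> nat" where
  "reg n m c j = m (40 + c * n + j)"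

section \<open>Cost calculus and frame conditions\<close>

locale ram = junta_algorithm +
  fixes Y :: nat
  assumes Y: "50 \<le> Y" and n_le: "n \<le> Y"
begin

text \<open>
  Time is bounded by powers of a number \<open>Y\<close> exceeding all input parameters, so that composing
  programs only raises the exponent.
\<close>

definition spec :: "com \<Rightarrow> mem \<Rightarrow> 'a pmf \<Rightarrow> ('a \<Rightarrow> mem \<Rightarrow> bool) \<Rightarrow> nat \<Rightarrow> nat \<Rightarrow> bool" where
  "spec c m p R d Q \<longleftrightarrow> implements n f D c m p R (Y ^ d) Q"

lemma Y_power_mono: "d \<le> d' \<Longrightarrow> Y ^ d \<le> Y ^ d'"
  using Y by (intro power_increasing) auto

lemma Y_power_pos: "1 \<le> Y ^ d"
  using Y by (simp add: Suc_leI)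

lemma spec_weaken:
  assumes "spec c m p R d Q" "d \<le> d'" "Q \<le> Q'" "\<And>a m'. a \<in> set_pmf p \<Longrightarrow> R a m' \<Longrightarrow> R' a m'"
  shows "spec c m p R' d' Q'"
  using assms Y_power_mono[OF assms(2)] unfolding spec_def by (blast intro: implements_weaken)

lemma spec_map:
  assumes "spec c m p R d Q" "\<And>a m'. a \<in> set_pmf p \<Longrightarrow> R a m' \<Longrightarrow> R' (g a) m'"
  shows "spec c m (map_pmf g p) R' d Q"
  using assms unfolding spec_def by (rule implements_map)

lemma spec_Store: "spec (Store a e) m (return_pmf ()) (\<lambda>_ m'. m' = m(val m a := val m e)) 0 0"
  unfolding spec_def by (simp add: implements_Store del: One_nat_def)

lemma spec_Flip:
  "spec (Flip a) m (bernoulli_pmf (1/2)) (\<lambda>b m'. m' = m(val m a := of_bool b)) 0 0"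
  unfolding spec_def by (simp add: implements_Flip del: One_nat_def)

lemma spec_Seq:
  assumes "spec c1 m p1 R1 d1 Q1"
    and "\<And>a m'. a \<in> set_pmf p1 \<Longrightarrow> R1 a m' \<Longrightarrow> spec c2 m' (p2 a) R2 d2 Q2"
  shows "spec (Seq c1 c2) m (bind_pmf p1 p2) R2 (Suc (max d1 d2)) (Q1 + Q2)"
proof -
  have "implements n f D (Seq c1 c2) m (bind_pmf p1 p2) R2 (Suc (Y ^ d1 + Y ^ d2)) (Q1 + Q2)"
    using assms unfolding spec_def by (rule implements_Seq)
  \<comment> \<open>A further factor \<open>Y\<close> absorbs the constant 3, so a sequential
    composition costs one exponent.\<close>
  moreover have "Suc (Y ^ d1 + Y ^ d2) \<le> Y ^ Suc (max d1 d2)"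
  proof -
    have "Suc (Y ^ d1 + Y ^ d2) \<le> 3 * Y ^ max d1 d2"
      using Y_power_mono[of d1 "max d1 d2"] Y_power_mono[of d2 "max d1 d2"] Y_power_pos[of "max d1 d2"]
      by simp
    also have "\<dots> \<le> Y ^ Suc (max d1 d2)"
      using Y by simp
    finally show ?thesis .
  qed
  ultimately show ?thesis
    unfolding spec_def by (rule implements_mono)
qed

lemma spec_then:
  assumes "spec c1 m (return_pmf x) R1 d1 Q1" "\<And>m'. R1 x m' \<Longrightarrow> spec c2 m' p R2 d2 Q2"
  shows "spec (Seq c1 c2) m p R2 (Suc (max d1 d2)) (Q1 + Q2)"
  using spec_Seq[of c1 m "return_pmf x" R1 d1 Q1 c2 "\<lambda>_. p" R2 d2 Q2] assms by (simp add: bind_return_pmf)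

lemma spec_Cond:
  assumes "val m e \<noteq> 0 \<Longrightarrow> spec c1 m p R d Q" "val m e = 0 \<Longrightarrow> spec c2 m p R d Q"
  shows "spec (Cond e c1 c2) m p R (Suc d) Q"
proof -
  have "implements n f D (Cond e c1 c2) m p R (Suc (Y ^ d)) Q"
    using assms unfolding spec_def by (rule implements_Cond)
  moreover have "Suc (Y ^ d) \<le> Y ^ Suc d"
  proof -
    have "Suc (Y ^ d) \<le> 2 * Y ^ d"
      using Y_power_pos[of d] by simp
    also have "\<dots> \<le> Y ^ Suc d"
      using Y by simp
    finally show ?thesis .
  qed
  ultimately show ?thesis
    unfolding spec_def by (rule implements_mono)
qed

lemma spec_For:
  assumes "val m e = N" "N \<le> Y ^ b" "I N a (m(i := N))" "\<And>j a m. I j a m \<Longrightarrow> m i = j"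
    and "\<And>j a m. j < N \<Longrightarrow> I (Suc j) a m \<Longrightarrow> spec c (m(i := j)) (g j a) (I j) d Q"
  shows "spec (For i e c) m (countdown N g a) (I 0) (Suc (b + d)) (N * Q)"
proof -
  have "implements n f D (For i e c) m (countdown N g a) (I 0) (N * (Y ^ d + 3) + 3) (N * Q)"
    using assms(1,3,4,5) unfolding spec_def by (rule implements_For)
  moreover have "N * (Y ^ d + 3) + 3 \<le> Y ^ Suc (b + d)"
  proof -
    have "N * (Y ^ d + 3) + 3 \<le> Y ^ b * (4 * Y ^ d) + 3 * (Y ^ b * Y ^ d)"
      using assms(2) Y_power_pos[of d] Y_power_pos[of "b + d"]
      by (intro add_mono mult_mono) (auto simp: power_add)
    also have "\<dots> = 7 * Y ^ (b + d)"
      by (simp add: power_add)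
    also have "\<dots> \<le> Y ^ Suc (b + d)"
      using Y by simp
    finally show ?thesis .
  qed
  ultimately show ?thesis
    unfolding spec_def by (rule implements_mono)
qed

abbreviation cell :: "mem \<Rightarrow> nat \<Rightarrow> nat \<Rightarrow> nat" where
  "cell \<equiv> reg n"

lemma cell_upd_scalar [simp]: "i < 40 \<Longrightarrow> cell (m(i := v)) c j = cell m c j"
  by (simp add: reg_def)

text \<open>Uniqueness of division with remainder by \<open>n\<close>: distinct arrays do not
  overlap.\<close>

lemma address_inject: "j < n \<Longrightarrow> j' < n \<Longrightarrow> c * n + j = c' * n + j' \<longleftrightarrow> c = c' \<and> j = j'"
proof
  assume *: "j < n" "j' < n" "c * n + j = c' * n + j'"
  then have "(c * n + j) div n = (c' * n + j') div n"
    by simp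
  then have "c = c'"
    using *(1,2) by simp
  then show "c = c' \<and> j = j'"
    using *(3) by simp
qed simp

lemma cell_upd_cell [simp]:
  "j < n \<Longrightarrow> j' < n \<Longrightarrow>
    cell (m(40 + c * n + j := v)) c' j' = (if c = c' \<and> j = j' then v else cell m c' j')"
  using address_inject[of j j' c c'] by (auto simp: reg_def)

lemma scalar_upd_cell [simp]: "i < 40 \<Longrightarrow> (m(40 + c * n + j := v)) i = m i"
  by simp

text \<open>A frame condition: only scalars in \<open>S\<close> and arrays in \<open>A\<close> may
  have changed. The array index ranges over all natural numbers, so the stored rows are
  covered.\<close>

definition same :: "nat set \<Rightarrow> nat set \<Rightarrow> mem \<Rightarrow> mem \<Rightarrow> bool" where
  "same S A m m' \<longleftrightarrow> (\<forall>i<40. i \<notin> S \<longrightarrow> m' i = m i) \<and>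
     (\<forall>c j. c \<notin> A \<longrightarrow> j < n \<longrightarrow> cell m' c j = cell m c j)"

lemma same_scalar: "same S A m m' \<Longrightarrow> i < 40 \<Longrightarrow> i \<notin> S \<Longrightarrow> m' i = m i"
  and same_cell: "same S A m m' \<Longrightarrow> c \<notin> A \<Longrightarrow> j < n \<Longrightarrow> cell m' c j = cell m c j"
  by (auto simp: same_def)

lemma same_refl [simp]: "same S A m m"
  by (simp add: same_def)

lemma same_trans:
  "same S' A' m m' \<Longrightarrow> same S A m0 m \<Longrightarrow> S' \<subseteq> S \<Longrightarrow> A' \<subseteq> A \<Longrightarrow> same S A m0 m'"
  unfolding same_def by (metis subsetD)

lemma same_upd: "same S A m0 m \<Longrightarrow> i \<in> S \<Longrightarrow> i < 40 \<Longrightarrow> same S A m0 (m(i := v))"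
  by (auto simp: same_def)

lemma same_upd_cell: "same S A m0 m \<Longrightarrow> c \<in> A \<Longrightarrow> j < n \<Longrightarrow> same S A m0 (m(40 + c * n + j := v))"
  by (auto simp: same_def)

definition holds :: "mem \<Rightarrow> nat \<Rightarrow> point \<Rightarrow> bool" where
  "holds m c x \<longleftrightarrow> (\<forall>j<n. (cell m c j \<noteq> 0) = x j)"

lemma holds_upd [simp]: "i < 40 \<Longrightarrow> holds (m(i := v)) c x = holds m c x"
  by (simp add: holds_def)

lemma holds_same: "same S A m m' \<Longrightarrow> c \<notin> A \<Longrightarrow> holds m' c x = holds m c x"
  by (auto simp: holds_def same_cell)

lemma val_El: "m 0 = n \<Longrightarrow> val m (El c) = cell m c (m 19)"
  by (simp add: El_def reg_def)

lemma spec_Set: "spec (Assign i e) m (return_pmf ()) (\<lambda>_ m'. m' = m(i := val m e)) 0 0"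
  using spec_Store[of "Lit i" e m] by simp

lemma read_point_holds: "holds m c x \<Longrightarrow> map x [0..<n] = read_point n m (40 + c * n)"
  by (simp add: read_point_def holds_def reg_def)

lemma spec_Query:
  assumes "m 0 = n" "holds m c x"
  shows "spec (Query (Lit i) (array c)) m (return_pmf ()) (\<lambda>_ m'. m' = m(i := of_bool (F x))) 0 1"
proof -
  have "F x = f (read_point n m (val m (array c)))"
    using assms by (simp add: F_def read_point_holds)
  then show ?thesis
    unfolding spec_def by (simp add: implements_Query del: One_nat_def)
qed

lemma spec_Sample:
  assumes "m 0 = n"
  shows "spec (Sample (array c)) m sample (\<lambda>x m'. same {} {c} m m' \<and> holds m' c x) 0 1"
proof -
  have "spec (Sample (array c)) m D (\<lambda>x m'. m' = write_point n x (40 + c * n) m) 0 1"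
    unfolding spec_def using assms by (simp add: implements_Sample del: One_nat_def)
  then show ?thesis
    unfolding sample_def
  proof (rule spec_map)
    fix x m' assume "x \<in> set_pmf D" and m': "m' = write_point n x (40 + c * n) m"
    have cells: "cell m' c' j = (if c' = c then of_bool (x ! j) else cell m c' j)" if "j < n" for c' j
    proof (cases "c' = c")
      case True
      then show ?thesis
        using that by (simp add: m' reg_def write_point_def)
    next
      case False
      \<comment> \<open>An address within array \<open>c\<close> would be an element of both
        arrays.\<close>
      have "\<not> (40 + c * n \<le> 40 + c' * n + j \<and> 40 + c' * n + j < 40 + c * n + n)"
      proof
        assume *: "40 + c * n \<le> 40 + c' * n + j \<and> 40 + c' * n + j < 40 + c * n + n"
        then obtain i where "c' * n + j = c * n + i" "i < n"
          by (metis add.assoc add_diff_inverse_nat add_less_cancel_left add_le_cancel_left not_less)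
        then show False
          using address_inject[of j i c' c] that False by simp
      qed
      then have "m' (40 + c' * n + j) = m (40 + c' * n + j)"
        by (auto simp: m' write_point_def)
      then show ?thesis
        using False by (simp add: reg_def)
    qed
    have "m' i = m i" if "i < 40" for i
      using that by (simp add: m' write_point_def)
    with cells show "same {} {c} m m' \<and> holds m' c (\<lambda>j. j < n \<and> x ! j)"
      by (auto simp: same_def holds_def)
  qed
qed

text \<open>The assumption on \<open>e\<close> may use the old entry at index \<open>j\<close> of
  the array being written, since the loop has not overwritten it yet. This permits updates in place,
  as for the union of the blocks.\<close>

lemma spec_Map:
  assumes "m 0 = n"
    and a: "\<And>m'. same {19} {c} m m' \<Longrightarrow> val m' a = 40 + c * n"
    and e: "\<And>m' j. j < n \<Longrightarrow> same {19} {c} m m' \<Longrightarrow> m' 19 = j \<Longrightarrow>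
      cell m' c j = cell m c j \<Longrightarrow> (val m' e \<noteq> 0) = x j"
  shows "spec (Map_array a e) m (return_pmf ()) (\<lambda>_ m'. same {19} {c} m m' \<and> holds m' c x) 2 0"
proof -
  let ?I = "\<lambda>j (_ :: unit) m'. same {19} {c} m m' \<and> m' 19 = j \<and>
    (\<forall>j'<n. if j \<le> j' then (cell m' c j' \<noteq> 0) = x j' else cell m' c j' = cell m c j')"
  have "spec (Map_array a e) m (countdown n (\<lambda>_ _. return_pmf ()) ()) (?I 0) (Suc (1 + 0)) (n * 0)"
    unfolding Map_array_def
  proof (rule spec_For[where I = ?I])
    fix j m' and u :: unit
    assume j: "j < n" and I: "?I (Suc j) u m'"
    define \<mu> where "\<mu> = m'(19 := j)"
    have \<mu>: "\<mu> 19 = j" "\<And>c j. cell \<mu> c j = cell m' c j"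
      by (simp_all add: \<mu>_def)
    have s: "same {19} {c} m \<mu>"
      unfolding \<mu>_def using I by (auto intro: same_upd)
    have addr: "val \<mu> (Add a (V 19)) = 40 + c * n + j"
      using a[OF s] \<mu> by simp
    have v: "(val \<mu> e \<noteq> 0) = x j"
      by (rule e) (use j s I \<mu> in auto)
    have I': "?I j () (\<mu>(40 + c * n + j := val \<mu> e))"
    proof (intro conjI allI impI)
      fix j' assume j': "j' < n"
      have "if Suc j \<le> j' then (cell m' c j' \<noteq> 0) = x j' else cell m' c j' = cell m c j'"
        using I j' by blast
      then show "if j \<le> j' then (cell (\<mu>(40 + c * n + j := val \<mu> e)) c j' \<noteq> 0) = x j'
          else cell (\<mu>(40 + c * n + j := val \<mu> e)) c j' = cell m c j'"
        using j j' v by (cases "j' = j") (auto simp: \<mu> Suc_le_eq simp del: fun_upd_apply)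
    qed (use j s \<mu> in \<open>auto intro!: same_upd_cell simp del: fun_upd_apply simp: scalar_upd_cell\<close>)
    show "spec (Store (Add a (V 19)) e) (m'(19 := j)) (return_pmf ()) (?I j) 0 0"
      unfolding \<mu>_def[symmetric]
    proof (rule spec_weaken[OF spec_Store order_refl order_refl])
      fix u m'' assume m'': "m'' = \<mu>(val \<mu> (Add a (V 19)) := val \<mu> e)"
      show "?I j u m''"
        unfolding m'' addr by (rule I')
    qed
  qed (simp_all add: assms(1) n_le same_upd)
  then show ?thesis
    unfolding countdown_unit by (rule spec_weaken) (auto simp: holds_def)
qed

lemma spec_Random:
  assumes "m 0 = n"
  shows "spec (Random_array c) m (uniform {..<n}) (\<lambda>w m'. same {19} {c} m m' \<and> holds m' c w) 2 0"
proof -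
  let ?I = "\<lambda>j w m'. same {19} {c} m m' \<and> m' 19 = j \<and>
    (\<forall>j'<n. j \<le> j' \<longrightarrow> (cell m' c j' \<noteq> 0) = w j')"
  have "spec (Random_array c) m (countdown n (\<lambda>i w. map_pmf (\<lambda>v. w(i := v)) (bernoulli_pmf (1/2))) (\<lambda>_. False))
      (?I 0) (Suc (1 + 0)) (n * 0)"
    unfolding Random_array_def
  proof (rule spec_For[where I = ?I])
    fix j w m'
    assume j: "j < n" and I: "?I (Suc j) w m'"
    define \<mu> where "\<mu> = m'(19 := j)"
    have \<mu>: "\<mu> 19 = j" "\<And>c j. cell \<mu> c j = cell m' c j"
      by (simp_all add: \<mu>_def)
    have s: "same {19} {c} m \<mu>"
      unfolding \<mu>_def using I by (auto intro: same_upd)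
    have addr: "val \<mu> (Add (array c) (V 19)) = 40 + c * n + j"
      using same_scalar[OF s, of 0] assms \<mu> by simp
    have I': "?I j (w(j := b)) (\<mu>(40 + c * n + j := of_bool b))" for b
    proof (intro conjI allI impI)
      fix j' assume j': "j' < n" "j \<le> j'"
      have "Suc j \<le> j' \<longrightarrow> (cell m' c j' \<noteq> 0) = w j'"
        using I j' by blast
      then show "(cell (\<mu>(40 + c * n + j := of_bool b)) c j' \<noteq> 0) = (w(j := b)) j'"
        using j j' by (cases "j' = j") (auto simp: \<mu> Suc_le_eq simp del: fun_upd_apply simp: fun_upd_apply[of w])
    qed (use j s \<mu> in \<open>auto intro!: same_upd_cell simp del: fun_upd_apply simp: scalar_upd_cell\<close>)
    show "spec (Flip (Add (array c) (V 19))) (m'(19 := j))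
        (map_pmf (\<lambda>v. w(j := v)) (bernoulli_pmf (1/2))) (?I j) 0 0"
      unfolding \<mu>_def[symmetric]
    proof (rule spec_map[OF spec_Flip])
      fix b m'' assume m'': "m'' = \<mu>(val \<mu> (Add (array c) (V 19)) := of_bool b)"
      show "?I j (w(j := b)) m''"
        unfolding m'' addr by (rule I')
    qed
  qed (simp_all add: assms(1) n_le same_upd)
  then show ?thesis
    unfolding uniform_def countdown_Pi_pmf_default by (rule spec_weaken) (auto simp: holds_def)
qed

end

section \<open>The program\<close>

definition Ask :: "nat \<Rightarrow> expr \<Rightarrow> com" where
  "Ask i e = Seq (Map_array (array 5) e) (Query (Lit i) (array 5))"

abbreviation flag_cell :: "bool \<Rightarrow> nat" where
  "flag_cell b \<equiv> (if b then 14 else 13)"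

definition Trial :: "bool \<Rightarrow> com" where
  "Trial b = Seq (Random_array 3) (Seq (Random_array 4)
     (Seq (Ask 15 (IfE (At Row_block) (El 3) (At Row_point)))
     (Seq (Ask 16 (IfE (At Row_block) (IfE (if b then El 2 else NotE (El 2)) (El 4) (El 3)) (At Row_point)))
       (Assign (flag_cell b) (OrE (V (flag_cell b)) (NeqE (V 15) (V 16)))))))"

definition Flag :: "bool \<Rightarrow> com" where
  "Flag b = Seq (Assign (flag_cell b) (Lit 0)) (For 25 (V 28) (Trial b))"

text \<open>The row pointer rests just behind the next row to be read, hence it is moved down by two
  arrays first. \<open>NotE\<close> normalises the two flags, which are specified only up to being
  nonzero.\<close>

definition Read_row :: com where
  "Read_row = Seq (Assign 12 (Sub (V 12) (Add (V 0) (V 0)))) (Seq (Flag False) (Seq (Flag True)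
     (Seq (Assign 10 (AndE (V 10) (NeqE (NotE (V 13)) (NotE (V 14)))))
       (Map_array (array 6) (OrE (El 6) (AndE (At Row_block) (V 14)))))))"

text \<open>Reading the rows moves the row pointer, so it is saved in cell 29. Cell 10 accumulates
  the conjunction over all checks.\<close>

definition Check :: com where
  "Check = Seq (Assign 29 (V 12)) (Seq (Map_array (array 6) (Lit 0)) (Seq (For 24 (V 11) Read_row)
     (Seq (Assign 12 (V 29)) (Seq (Ask 15 (AndE (El 2) (El 1))) (Seq (Query (Lit 16) (array 6))
       (Assign 10 (AndE (V 10) (NotE (NeqE (V 15) (V 16))))))))))"

definition Round :: com where
  "Round = Seq (Random_array 2) (Seq (Assign 28 (V 5)) (Seq Check
     (Seq (Sample (array 2)) (Seq (Assign 28 (V 6)) Check))))"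

context ram
begin

lemma spec_Seq':
  assumes "spec c1 m p1 R1 d1 Q1"
    and "\<And>a m'. a \<in> set_pmf p1 \<Longrightarrow> R1 a m' \<Longrightarrow> spec c2 m' (p2 a) R2 d2 Q2"
    and "d1 < d" "d2 < d" "Q1 + Q2 \<le> Q"
  shows "spec (Seq c1 c2) m (bind_pmf p1 p2) R2 d Q"
  by (rule spec_weaken[OF spec_Seq[OF assms(1,2)]]) (use assms(3-) in auto)

lemma spec_then':
  assumes "spec c1 m (return_pmf x) R1 d1 Q1" "\<And>m'. R1 x m' \<Longrightarrow> spec c2 m' p R2 d2 Q2"
    and "d1 < d" "d2 < d" "Q1 + Q2 \<le> Q"
  shows "spec (Seq c1 c2) m p R2 d Q"
  by (rule spec_weaken[OF spec_then[OF assms(1,2)]]) (use assms(3-) in auto)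

lemma spec_Set':
  assumes "R x (m(i := val m e))"
  shows "spec (Assign i e) m (return_pmf x) R 0 0"
proof -
  have "spec (Assign i e) m (map_pmf (\<lambda>_. x) (return_pmf ())) R 0 0"
    by (rule spec_map[OF spec_Set]) (use assms in auto)
  then show ?thesis by simp
qed

lemma holdsD:
  "holds m c x \<Longrightarrow> j < n \<Longrightarrow> (0 < cell m c j) = x j"
  "holds m c x \<Longrightarrow> j < n \<Longrightarrow> (cell m c j = 0) = (\<not> x j)"
  by (auto simp: holds_def)

lemma spec_Ask:
  assumes "m 0 = n" "i < 40"
    and "\<And>m' j. j < n \<Longrightarrow> same {19} {5} m m' \<Longrightarrow> m' 19 = j \<Longrightarrow> (val m' e \<noteq> 0) = p j"
  shows "spec (Ask i e) m (return_pmf ())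
    (\<lambda>_ m'. same {i, 19} {5} m m' \<and> m' i = of_bool (F p)) 3 1"
  unfolding Ask_def
proof (rule spec_then')
  show "spec (Map_array (array 5) e) m (return_pmf ()) (\<lambda>_ m'. same {19} {5} m m' \<and> holds m' 5 p) 2 0"
  proof (rule spec_Map[where m = m, OF assms(1)])
    fix m' assume s: "same {19} {5} m m'"
    show "val m' (array 5) = 40 + 5 * n"
      using assms(1) by (simp add: same_scalar[OF s])
  qed (use assms(3) in simp)
next
  fix m' assume *: "same {19} {5} m m' \<and> holds m' 5 p"
  show "spec (Query (Lit i) (array 5)) m' (return_pmf ())
      (\<lambda>_ m'. same {i, 19} {5} m m' \<and> m' i = of_bool (F p)) 0 1"
  proof (rule spec_weaken[OF spec_Query order_refl order_refl])
    show "m' 0 = n"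
      using assms(1) by (simp add: same_scalar[OF conjunct1[OF *]])
    show "holds m' 5 p"
      using * by simp
    fix m'' assume "m'' = m'(i := of_bool (F p))"
    moreover have "same {i, 19} {5} m m'"
      by (rule same_trans[of "{19}" "{5}" m]) (use * in auto)
    ultimately show "same {i, 19} {5} m m'' \<and> m'' i = of_bool (F p)"
      using assms(2) by (simp add: same_upd)
  qed
qed simp_all

definition row_at :: "mem \<Rightarrow> nat \<Rightarrow> row \<Rightarrow> bool" where
  "row_at m i r \<longleftrightarrow> m 12 = 40 + (7 + 2 * i) * n \<and> holds m (7 + 2 * i) (fst r) \<and>
     holds m (8 + 2 * i) (snd r)"

lemma row_at_same:
  assumes "same S A m m'" "12 \<notin> S" "A \<subseteq> {..6}"
  shows "row_at m' i r = row_at m i r"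
proof -
  have "7 + 2 * i \<notin> A" "8 + 2 * i \<notin> A"
    using assms(3) by auto
  then show ?thesis
    using assms(2) by (simp add: row_at_def same_scalar[OF assms(1)] holds_same[OF assms(1)])
qed

lemmas same_facts = same_scalar holds_same row_at_same

lemma val_row:
  assumes "row_at m i r" "m 0 = n" "m 19 < n"
  shows "(val m (At Row_block) \<noteq> 0) = fst r (m 19)" "(val m (At Row_point) \<noteq> 0) = snd r (m 19)"
proof -
  have "val m (At Row_block) = cell m (7 + 2 * i) (m 19)" "val m (At Row_point) = cell m (8 + 2 * i) (m 19)"
    using assms by (simp_all add: row_at_def reg_def algebra_simps)
  then show "(val m (At Row_block) \<noteq> 0) = fst r (m 19)" "(val m (At Row_point) \<noteq> 0) = snd r (m 19)"
    using assms holdsD by (auto simp: row_at_def)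
qed

lemma spec_Trial:
  assumes m: "m 0 = n" and row: "row_at m i r" and x: "holds m 2 x"
  shows "spec (Trial b) m (trial n (\<lambda>w. F (plug r w)) {j. x j = b})
    (\<lambda>t m'. same {flag_cell b, 15, 16, 19} {3, 4, 5} m m' \<and>
      (m' (flag_cell b) \<noteq> 0) = (m (flag_cell b) \<noteq> 0 \<or> t)) 9 2"
  unfolding Trial_def trial_def map_pmf_def
proof (rule spec_Seq'[OF spec_Random[where m = m, OF m]])
  let ?P1 = "Seq (Ask 16 (IfE (At Row_block) (IfE (if b then El 2 else NotE (El 2)) (El 4) (El 3)) (At Row_point))) (Assign (flag_cell b) (OrE (V (flag_cell b)) (NeqE (V 15) (V 16))))"
  let ?P2 = "Seq (Ask 15 (IfE (At Row_block) (El 3) (At Row_point))) ?P1"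
  let ?P3 = "Seq (Random_array 4) ?P2"
  let ?h = "\<lambda>w. F (plug r w)"
  fix w m1 assume 1: "same {19} {3} m m1 \<and> holds m1 3 w"
  have m1: "m1 0 = n"
    using m by (simp add: same_facts[OF conjunct1[OF 1]])
  show "spec ?P3 m1
    (bind_pmf (uniform {..<n}) (\<lambda>u. return_pmf (?h w \<noteq> ?h (resample {j. x j = b} u w))))
    (\<lambda>t m'. same {flag_cell b, 15, 16, 19} {3, 4, 5} m m' \<and>
      (m' (flag_cell b) \<noteq> 0) = (m (flag_cell b) \<noteq> 0 \<or> t)) 8 2"
  proof (rule spec_Seq'[OF spec_Random[where m = m1, OF m1]])
    fix u m2 assume 2: "same {19} {4} m1 m2 \<and> holds m2 4 u"
    have s2: "same {19} {3, 4} m m2"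
      using 1 2 by (auto simp: same_def)
    have m2: "m2 0 = n"
      using m by (simp add: same_facts[OF s2])
    have h2: "holds m2 2 x" "holds m2 3 w" "holds m2 4 u" "row_at m2 i r"
      using 1 2 x row by (simp_all add: same_facts[OF s2] same_facts[OF conjunct1[OF 2]])
    show "spec ?P2 m2
      (return_pmf (?h w \<noteq> ?h (resample {j. x j = b} u w)))
      (\<lambda>t m'. same {flag_cell b, 15, 16, 19} {3, 4, 5} m m' \<and>
        (m' (flag_cell b) \<noteq> 0) = (m (flag_cell b) \<noteq> 0 \<or> t)) 7 2"
    proof (rule spec_then'[OF spec_Ask[where m = m2, OF m2]])
      fix m' j assume j: "j < n" "m' 19 = j" and s: "same {19} {5} m2 m'"
      have "m' 0 = n"
        using m2 by (simp add: same_facts[OF s])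
      moreover have "holds m' 3 w" "row_at m' i r"
        using h2 by (simp_all add: same_facts[OF s])
      ultimately show "(val m' (IfE (At Row_block) (El 3) (At Row_point)) \<noteq> 0) = plug r w j"
        using j val_row[of m' i r] by (simp add: val_El holdsD plug_def)
    next
      fix m3 assume 3: "same {15, 19} {5} m2 m3 \<and> m3 15 = of_bool (?h w)"
      have m3: "m3 0 = n"
        using m2 by (simp add: same_facts[OF conjunct1[OF 3]])
      have h3: "holds m3 2 x" "holds m3 3 w" "holds m3 4 u" "row_at m3 i r"
        using h2 by (simp_all add: same_facts[OF conjunct1[OF 3]])
      show "spec ?P1 m3
        (return_pmf (?h w \<noteq> ?h (resample {j. x j = b} u w)))
        (\<lambda>t m'. same {flag_cell b, 15, 16, 19} {3, 4, 5} m m' \<and>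
          (m' (flag_cell b) \<noteq> 0) = (m (flag_cell b) \<noteq> 0 \<or> t)) 6 1"
      proof (rule spec_then'[OF spec_Ask[where m = m3, OF m3]])
        fix m' j assume j: "j < n" "m' 19 = j" and s: "same {19} {5} m3 m'"
        have "m' 0 = n"
          using m3 by (simp add: same_facts[OF s])
        moreover have "holds m' 2 x" "holds m' 3 w" "holds m' 4 u" "row_at m' i r"
          using h3 by (simp_all add: same_facts[OF s])
        ultimately show "(val m' (IfE (At Row_block) (IfE (if b then El 2 else NotE (El 2)) (El 4) (El 3)) (At Row_point)) \<noteq> 0) =
            plug r (resample {j. x j = b} u w) j"
          using j val_row[of m' i r] by (simp add: val_El holdsD plug_def resample_def)
      next
        fix m4 assume 4: "same {16, 19} {5} m3 m4 \<and> m4 16 = of_bool (?h (resample {j. x j = b} u w))"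
        have s: "same {flag_cell b, 15, 16, 19} {3, 4, 5} m m4"
          using s2 3 4 by (auto simp: same_def)
        have f: "m4 (flag_cell b) = m (flag_cell b)" "m4 15 = of_bool (?h w)"
          using 3 by (simp_all add: same_facts[OF s2] same_facts[OF conjunct1[OF 3]] same_facts[OF conjunct1[OF 4]])
        show "spec (Assign (flag_cell b) (OrE (V (flag_cell b)) (NeqE (V 15) (V 16)))) m4
            (return_pmf (?h w \<noteq> ?h (resample {j. x j = b} u w)))
            (\<lambda>t m'. same {flag_cell b, 15, 16, 19} {3, 4, 5} m m' \<and>
              (m' (flag_cell b) \<noteq> 0) = (m (flag_cell b) \<noteq> 0 \<or> t)) 0 0"
          by (rule spec_Set') (use s f 4 in \<open>simp add: same_upd\<close>)
      qed simp_all
    qed simp_all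
  qed simp_all
qed simp_all

abbreviation flag_cells :: "nat set" where
  "flag_cells \<equiv> {15, 16, 19, 25}"

lemma spec_Flag:
  assumes m: "m 0 = n" "m 28 = N" and N: "N \<le> Y ^ 6" and row: "row_at m i r" and x: "holds m 2 x"
  shows "spec (Flag b) m (flag r N x b)
    (\<lambda>a m'. same ({flag_cell b} \<union> flag_cells) {3, 4, 5} m m' \<and> (m' (flag_cell b) \<noteq> 0) = a) 17 (N * 2)"
  unfolding Flag_def
proof (rule spec_then'[OF spec_Set])
  fix m1 assume 1: "m1 = m(flag_cell b := val m (Lit 0))"
  let ?I = "\<lambda>j a m'. same ({flag_cell b} \<union> flag_cells) {3, 4, 5} m m' \<and> m' 25 = j \<and> (m' (flag_cell b) \<noteq> 0) = a"
  have "spec (For 25 (V 28) (Trial b)) m1 (flag r N x b) (?I 0) (Suc (6 + 9)) (N * 2)"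
    unfolding flag_def
  proof (rule spec_For[where I = ?I])
    fix j a m' assume I: "?I (Suc j) a m'"
    let ?m = "m'(25 := j)"
    have s: "same ({flag_cell b} \<union> flag_cells) {3, 4, 5} m ?m"
      using I by (simp add: same_upd)
    show "spec (Trial b) ?m (map_pmf (\<lambda>t. a \<or> t) (trial n (\<lambda>w. F (plug r w)) {j. x j = b})) (?I j) 9 2"
    proof (rule spec_map[OF spec_Trial[where m = ?m]])
      show "?m 0 = n"
        using same_scalar[OF s, of 0] m by simp
      show "row_at ?m i r"
        using row_at_same[OF s, of i r] row by simp
      show "holds ?m 2 x"
        using holds_same[OF s, of 2 x] x by simp
    next
      fix t m'' assume t: "same {flag_cell b, 15, 16, 19} {3, 4, 5} ?m m'' \<and>
        (m'' (flag_cell b) \<noteq> 0) = (?m (flag_cell b) \<noteq> 0 \<or> t)"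
      have "same ({flag_cell b} \<union> flag_cells) {3, 4, 5} m m''"
        by (rule same_trans[OF conjunct1[OF t] s]) auto
      moreover have "m'' 25 = j"
        using same_scalar[OF conjunct1[OF t], of 25] by simp
      moreover have "(m'' (flag_cell b) \<noteq> 0) = (a \<or> t)"
        using conjunct2[OF t] I by auto
      ultimately show "?I j (a \<or> t) m''"
        by blast
    qed
  qed (use 1 m N in \<open>simp_all add: same_upd\<close>)
  then show "spec (For 25 (V 28) (Trial b)) m1 (flag r N x b)
     (\<lambda>a m'. same ({flag_cell b} \<union> flag_cells) {3, 4, 5} m m' \<and> (m' (flag_cell b) \<noteq> 0) = a) 16 (N * 2)"
    by (rule spec_weaken) auto
qed simp_all

definition read_row :: "nat \<Rightarrow> point \<Rightarrow> row \<Rightarrow> point \<times> bool \<Rightarrow> (point \<times> bool) pmf" where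
  "read_row N x r st = bind_pmf (flag r N x False) (\<lambda>a. bind_pmf (flag r N x True) (\<lambda>b.
     return_pmf (\<lambda>j. fst st j \<or> fst r j \<and> b, snd st \<and> a \<noteq> b)))"

text \<open>The head of \<open>rs\<close> is the newest row and lies in the highest arrays. A
  descending loop meets the rows in list order, with \<open>rev rs ! i\<close> at index
  \<open>i\<close>.\<close>

lemma read_rows_countdown:
  "read_rows N x rs st = countdown (length rs) (\<lambda>i. read_row N x (rev rs ! i)) st"
proof (induction rs arbitrary: st)
  case (Cons r rs)
  have "countdown (length rs) (\<lambda>i. read_row N x (rev (r # rs) ! i)) =
      countdown (length rs) (\<lambda>i. read_row N x (rev rs ! i))"
    by (intro ext countdown_cong) (simp add: nth_append)
  also have "\<dots> = read_rows N x rs"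
    using Cons.IH by (intro ext) simp
  moreover have last: "rev (r # rs) ! length rs = r"
    by (simp add: nth_append)
  ultimately show ?case
    by (simp only: length_Cons countdown.simps last)
      (simp add: read_row_def bind_assoc_pmf bind_return_pmf)
qed simp

lemma spec_Read_row:
  assumes m: "m 0 = n" "m 28 = N" "m 12 = 40 + (7 + 2 * Suc i) * n" and N: "N \<le> Y ^ 6"
    and row: "holds m (7 + 2 * i) (fst r)" "holds m (8 + 2 * i) (snd r)"
    and x: "holds m 2 x" and y: "holds m 6 (fst st)" and ok: "(m 10 \<noteq> 0) = (ok \<and> snd st)"
  shows "spec Read_row m (read_row N x r st)
    (\<lambda>st' m'. same ({10, 12, 13, 14} \<union> flag_cells) {3, 4, 5, 6} m m' \<and>
      m' 12 = 40 + (7 + 2 * i) * n \<and> holds m' 6 (fst st') \<and> (m' 10 \<noteq> 0) = (ok \<and> snd st')) 21 (4 * N)"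
  (is "spec _ _ _ ?R _ _")
  unfolding Read_row_def read_row_def
proof (rule spec_then'[OF spec_Set])
  let ?P1 = "Seq (Assign 10 (AndE (V 10) (NeqE (NotE (V 13)) (NotE (V 14))))) (Map_array (array 6) (OrE (El 6) (AndE (At Row_block) (V 14))))"
  let ?P2 = "Seq (Flag True) ?P1"
  let ?P3 = "Seq (Flag False) ?P2"
  fix m1 assume 1: "m1 = m(12 := val m (Sub (V 12) (Add (V 0) (V 0))))"
  have s1: "same {12} {} m m1"
    unfolding 1 by (rule same_upd) auto
  have m1: "m1 0 = n" "m1 28 = N" "m1 10 = m 10"
    using m by (simp_all add: same_facts[OF s1])
  have p1: "m1 12 = 40 + (7 + 2 * i) * n"
    unfolding 1 using m by (simp add: algebra_simps)
  have h1: "row_at m1 i r" "holds m1 2 x" "holds m1 6 (fst st)"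
    using row x y p1 by (simp_all add: row_at_def same_facts[OF s1])
  show "spec ?P3 m1
    (bind_pmf (flag r N x False) (\<lambda>a. bind_pmf (flag r N x True) (\<lambda>b.
       return_pmf (\<lambda>j. fst st j \<or> fst r j \<and> b, snd st \<and> a \<noteq> b)))) ?R 20 (4 * N)"
  proof (rule spec_Seq'[OF spec_Flag[where m = m1, OF m1(1,2) N h1(1,2)]])
    fix a m2 assume 2: "same ({flag_cell False} \<union> flag_cells) {3, 4, 5} m1 m2 \<and> (m2 (flag_cell False) \<noteq> 0) = a"
    have s2: "same ({12, 13} \<union> flag_cells) {3, 4, 5} m m2"
      using 2 s1 by (auto simp: same_def)
    have m2: "m2 0 = n" "m2 28 = N" "m2 10 = m 10" "m2 12 = 40 + (7 + 2 * i) * n"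
      using m1 p1 by (simp_all add: same_facts[OF conjunct1[OF 2]])
    have h2: "row_at m2 i r" "holds m2 2 x" "holds m2 6 (fst st)"
      using h1 by (simp_all add: same_facts[OF conjunct1[OF 2]])
    show "spec ?P2 m2
      (bind_pmf (flag r N x True) (\<lambda>b.
         return_pmf (\<lambda>j. fst st j \<or> fst r j \<and> b, snd st \<and> a \<noteq> b))) ?R 19 (2 * N)"
    proof (rule spec_Seq'[OF spec_Flag[where m = m2, OF m2(1,2) N h2(1,2)]])
      fix b m3 assume 3: "same ({flag_cell True} \<union> flag_cells) {3, 4, 5} m2 m3 \<and> (m3 (flag_cell True) \<noteq> 0) = b"
      have s3: "same ({12, 13, 14} \<union> flag_cells) {3, 4, 5} m m3"
        using 3 s2 by (auto simp: same_def)
      have m3: "m3 0 = n" "m3 10 = m 10" "m3 12 = 40 + (7 + 2 * i) * n" "(m3 14 \<noteq> 0) = b" "m3 13 = m2 13"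
        using m2 conjunct2[OF 3] by (simp_all add: same_facts[OF conjunct1[OF 3]])
      have fa: "(m3 13 \<noteq> 0) = a"
        using m3(5) 2 by simp
      have h3: "row_at m3 i r" "holds m3 6 (fst st)"
        using h2 by (simp_all add: same_facts[OF conjunct1[OF 3]])
      show "spec ?P1 m3
        (return_pmf (\<lambda>j. fst st j \<or> fst r j \<and> b, snd st \<and> a \<noteq> b)) ?R 18 0"
      proof (rule spec_then'[OF spec_Set])
        fix m4 assume 4: "m4 = m3(10 := val m3 (AndE (V 10) (NeqE (NotE (V 13)) (NotE (V 14)))))"
        have s4: "same ({10, 12, 13, 14} \<union> flag_cells) {3, 4, 5} m m4"
          unfolding 4 by (rule same_upd[OF same_trans[OF s3 same_refl]]) auto
        have m4: "m4 0 = n" "m4 12 = 40 + (7 + 2 * i) * n" "(m4 14 \<noteq> 0) = b"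
          unfolding 4 using m3 by simp_all
        have ok4: "(m4 10 \<noteq> 0) = (ok \<and> snd st \<and> a \<noteq> b)"
          unfolding 4 using m3(2,4) fa ok by auto
        have h4: "row_at m4 i r" "holds m4 6 (fst st)"
          using h3 unfolding 4 by (simp_all add: row_at_def)
        have "spec (Map_array (array 6) (OrE (El 6) (AndE (At Row_block) (V 14)))) m4 (return_pmf ())
          (\<lambda>_ m'. same {19} {6} m4 m' \<and> holds m' 6 (\<lambda>j. fst st j \<or> fst r j \<and> b)) 2 0"
        proof (rule spec_Map[where m = m4, OF m4(1)])
          fix m' assume s: "same {19} {6} m4 m'"
          show "val m' (array 6) = 40 + 6 * n"
            using m4(1) by (simp add: same_facts[OF s])
          fix j assume j: "j < n" "m' 19 = j" "cell m' 6 j = cell m4 6 j"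
          have "m' 0 = n" "(m' 14 \<noteq> 0) = b" "row_at m' i r"
            using m4 h4 by (simp_all add: same_facts[OF s])
          then show "(val m' (OrE (El 6) (AndE (At Row_block) (V 14))) \<noteq> 0) = (fst st j \<or> fst r j \<and> b)"
            using j h4(2) val_row[of m' i r] by (simp add: val_El holdsD)
        qed
        then have "spec (Map_array (array 6) (OrE (El 6) (AndE (At Row_block) (V 14)))) m4
          (map_pmf (\<lambda>_. (\<lambda>j. fst st j \<or> fst r j \<and> b, snd st \<and> a \<noteq> b)) (return_pmf ())) ?R 2 0"
        proof (rule spec_map)
          fix m' assume *: "same {19} {6} m4 m' \<and> holds m' 6 (\<lambda>j. fst st j \<or> fst r j \<and> b)"
          have "same ({10, 12, 13, 14} \<union> flag_cells) {3, 4, 5, 6} m m'"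
            using s4 * by (auto simp: same_def)
          moreover have "m' 12 = 40 + (7 + 2 * i) * n" "m' 10 = m4 10"
            using m4 by (simp_all add: same_facts[OF conjunct1[OF *]])
          ultimately show "?R (\<lambda>j. fst st j \<or> fst r j \<and> b, snd st \<and> a \<noteq> b) m'"
            using * ok4 by simp
        qed
        then show "spec (Map_array (array 6) (OrE (El 6) (AndE (At Row_block) (V 14)))) m4
          (return_pmf (\<lambda>j. fst st j \<or> fst r j \<and> b, snd st \<and> a \<noteq> b)) ?R 2 0"
          by simp
      qed simp_all
    qed simp_all
  qed simp_all
qed simp_all

definition stored :: "mem \<Rightarrow> row list \<Rightarrow> bool" where
  "stored m rs \<longleftrightarrow> (\<forall>i<length rs.
     holds m (7 + 2 * i) (fst (rev rs ! i)) \<and> holds m (8 + 2 * i) (snd (rev rs ! i)))"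

lemma stored_same:
  assumes "same S A m m'" "A \<subseteq> {..6}"
  shows "stored m' rs = stored m rs"
proof -
  have "7 + 2 * i \<notin> A" "8 + 2 * i \<notin> A" for i
    using assms(2) by auto
  then show ?thesis
    by (simp add: stored_def holds_same[OF assms(1)])
qed

abbreviation check_cells :: "nat set" where
  "check_cells \<equiv> {10, 13, 14, 24, 29} \<union> flag_cells"

text \<open>\<open>ok\<close> is the verdict accumulated before. Each row costs two flags of
  \<open>N\<close> trials with two queries per trial; the final comparison costs two more.\<close>

lemma spec_Check:
  assumes m: "m 0 = n" "m 28 = N" "m 11 = length rs" "m 12 = 40 + (7 + 2 * length rs) * n"
    and le: "N \<le> Y ^ 6" "length rs \<le> Y"
    and h: "stored m rs" "holds m 2 x" "holds m 1 (found rs)" and ok: "(m 10 \<noteq> 0) = ok"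
  shows "spec Check m (check N rs x)
    (\<lambda>r m'. same check_cells {3, 4, 5, 6} m m' \<and> (m' 10 \<noteq> 0) = (ok \<and> r)) 30 (length rs * (4 * N) + 2)"
  (is "spec _ _ _ ?R _ _")
  unfolding Check_def check_def map_pmf_def
proof (rule spec_then'[OF spec_Set])
  let ?P1 = "Seq (Query (Lit 16) (array 6)) (Assign 10 (AndE (V 10) (NotE (NeqE (V 15) (V 16)))))"
  let ?P2 = "Seq (Ask 15 (AndE (El 2) (El 1))) ?P1"
  let ?P3 = "Seq (Assign 12 (V 29)) ?P2"
  let ?P4 = "Seq (For 24 (V 11) Read_row) ?P3"
  let ?P5 = "Seq (Map_array (array 6) (Lit 0)) ?P4"
  let ?S = "{12} \<union> check_cells"
  fix m1 assume 1: "m1 = m(29 := val m (V 12))"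
  have s1: "same ?S {3, 4, 5, 6} m m1"
    unfolding 1 by (rule same_upd) auto
  have m1: "m1 0 = n"
    unfolding 1 using m by simp
  show "spec ?P5 m1
    (bind_pmf (read_rows N x rs (\<lambda>_. False, True)) (\<lambda>st.
      return_pmf (case st of (y, ok) \<Rightarrow> ok \<and> F (masked rs x) = F y))) ?R 29 (length rs * (4 * N) + 2)"
  proof (rule spec_then'[OF spec_Map[where m = m1 and c = 6 and x = "\<lambda>_. False", OF m1]])
    fix m' assume s: "same {19} {6} m1 m'"
    show "val m' (array 6) = 40 + 6 * n"
      using m1 by (simp add: same_facts[OF s])
  next
    fix m2 assume 2: "same {19} {6} m1 m2 \<and> holds m2 6 (\<lambda>_. False)"
    have s2: "same ?S {3, 4, 5, 6} m m2"
      using s1 2 by (auto simp: same_def)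
    have m2: "m2 29 = m 12" "m2 12 = m 12" "m2 11 = length rs" "m2 10 = m 10"
      unfolding same_scalar[OF conjunct1[OF 2], simplified] by (simp_all add: same_facts[OF conjunct1[OF 2]] 1 m)
    let ?I = "\<lambda>j st m'. same ?S {3, 4, 5, 6} m m' \<and> m' 24 = j \<and> m' 29 = m 12 \<and>
      m' 12 = 40 + (7 + 2 * j) * n \<and> holds m' 6 (fst st) \<and> (m' 10 \<noteq> 0) = (ok \<and> snd st)"
    have loop: "spec (For 24 (V 11) Read_row) m2 (read_rows N x rs (\<lambda>_. False, True)) (?I 0)
        (Suc (1 + 21)) (length rs * (4 * N))"
      unfolding read_rows_countdown
    proof (rule spec_For[where I = ?I])
      show "?I (length rs) (\<lambda>_. False, True) (m2(24 := length rs))"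
        using s2 m2 m(4) 2 ok by (simp add: same_upd)
    next
      fix j st m' assume j: "j < length rs" and I: "?I (Suc j) st m'"
      let ?m = "m'(24 := j)" and ?r = "rev rs ! j"
      have s: "same ?S {3, 4, 5, 6} m ?m"
        using I by (simp add: same_upd)
      show "spec Read_row ?m (read_row N x ?r st) (?I j) 21 (4 * N)"
      proof (rule spec_weaken[OF spec_Read_row[where m = ?m and N = N and i = j and ok = ok]])
        show "?m 0 = n" "?m 28 = N"
          using same_scalar[OF s, of 0] same_scalar[OF s, of 28] m by simp_all
        have "stored ?m rs"
          using stored_same[OF s] h(1) by (simp add: atMost_def)
        then show "holds ?m (7 + 2 * j) (fst ?r)" "holds ?m (8 + 2 * j) (snd ?r)"
          using j unfolding stored_def by blast+
        show "holds ?m 2 x"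
          using holds_same[OF s, of 2 x] h(2) by simp
        show "?m 12 = 40 + (7 + 2 * Suc j) * n" "holds ?m 6 (fst st)" "(?m 10 \<noteq> 0) = (ok \<and> snd st)"
          using I by simp_all
      next
        fix st' m'' assume *: "same ({10, 12, 13, 14} \<union> flag_cells) {3, 4, 5, 6} ?m m'' \<and>
          m'' 12 = 40 + (7 + 2 * j) * n \<and> holds m'' 6 (fst st') \<and> (m'' 10 \<noteq> 0) = (ok \<and> snd st')"
        have "same ?S {3, 4, 5, 6} m m''"
          by (rule same_trans[OF conjunct1[OF *] s]) auto
        moreover have "m'' 24 = j" "m'' 29 = m 12"
          using same_scalar[OF conjunct1[OF *], of 24] same_scalar[OF conjunct1[OF *], of 29] I by simp_all
        ultimately show "?I j st' m''"
          using * by blast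
      qed (use le in simp_all)
    qed (use m2 le in simp_all)
    show "spec ?P4 m2
      (bind_pmf (read_rows N x rs (\<lambda>_. False, True)) (\<lambda>st.
        return_pmf (case st of (y, ok) \<Rightarrow> ok \<and> F (masked rs x) = F y))) ?R 28 (length rs * (4 * N) + 2)"
    proof (rule spec_Seq'[OF loop])
      fix st m3 assume I3: "?I 0 st m3"
      obtain y b where st: "st = (y, b)" by (cases st)
      let ?v = "b \<and> F (masked rs x) = F y"
      show "spec ?P3 m3
        (return_pmf (case st of (y, ok) \<Rightarrow> ok \<and> F (masked rs x) = F y)) ?R 10 2"
        unfolding st prod.case
      proof (rule spec_then'[OF spec_Set])
        fix m4 assume 4: "m4 = m3(12 := val m3 (V 29))"
        have s4: "same check_cells {3, 4, 5, 6} m m4"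
          unfolding 4 using I3 by (auto simp: same_def)
        have m4: "m4 0 = n" "holds m4 2 x" "holds m4 1 (found rs)"
          using m h by (simp_all add: same_facts[OF s4])
        have y4: "holds m4 6 y" "(m4 10 \<noteq> 0) = (ok \<and> b)"
          unfolding 4 using I3 st by simp_all
        show "spec ?P2 m4 (return_pmf ?v) ?R 9 2"
        proof (rule spec_then'[OF spec_Ask[where m = m4 and p = "masked rs x", OF m4(1)]])
          fix m' j assume j: "j < n" "m' 19 = j" and s: "same {19} {5} m4 m'"
          show "(val m' (AndE (El 2) (El 1)) \<noteq> 0) = masked rs x j"
            using j m4 by (simp add: val_El same_facts[OF s] same_cell[OF s] holdsD masked_def)
        next
          fix m5 assume 5: "same {15, 19} {5} m4 m5 \<and> m5 15 = of_bool (F (masked rs x))"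
          have s5: "same check_cells {3, 4, 5, 6} m m5"
            by (rule same_trans[OF conjunct1[OF 5] s4]) auto
          have m5: "m5 0 = n" "holds m5 6 y" "(m5 10 \<noteq> 0) = (ok \<and> b)"
            using m4 y4 by (simp_all add: same_facts[OF conjunct1[OF 5]])
          show "spec ?P1 m5 (return_pmf ?v) ?R 8 1"
          proof (rule spec_then'[OF spec_Query[where m = m5, OF m5(1,2)]])
            fix m6 assume 6: "m6 = m5(16 := of_bool (F y))"
            have s6: "same check_cells {3, 4, 5, 6} m m6"
              unfolding 6 by (rule same_upd[OF s5]) auto
            show "spec (Assign 10 (AndE (V 10) (NotE (NeqE (V 15) (V 16))))) m6 (return_pmf ?v) ?R 0 0"
            proof (rule spec_Set', rule conjI)
              show "same check_cells {3, 4, 5, 6} m (m6(10 := val m6 (AndE (V 10) (NotE (NeqE (V 15) (V 16))))))"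
                by (rule same_upd[OF s6]) auto
              show "((m6(10 := val m6 (AndE (V 10) (NotE (NeqE (V 15) (V 16)))))) 10 \<noteq> 0) = (ok \<and> ?v)"
                unfolding 6 using m5(3) conjunct2[OF 5] by auto
            qed
          qed simp_all
        qed simp_all
      qed simp_all
    qed simp_all
  qed simp_all
qed simp_all

lemma spec_Round:
  assumes m: "m 0 = n" "m 5 = N1" "m 6 = N2" "m 11 = length rs" "m 12 = 40 + (7 + 2 * length rs) * n"
    and le: "N1 \<le> Y ^ 6" "N2 \<le> Y ^ 6" "length rs \<le> Y"
    and h: "stored m rs" "holds m 1 (found rs)" and ok: "(m 10 \<noteq> 0) = ok"
  shows "spec Round m (test_round N1 N2 rs)
    (\<lambda>r m'. same ({28} \<union> check_cells) {2, 3, 4, 5, 6} m m' \<and> (m' 10 \<noteq> 0) = (ok \<and> r)) 40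
    (length rs * (4 * N1) + length rs * (4 * N2) + 5)"
  (is "spec _ _ _ ?R _ _")
proof -
  let ?S = "{28} \<union> check_cells" and ?A = "{2, 3, 4, 5, 6}"
  have test_round: "test_round N1 N2 rs = bind_pmf (uniform {..<n}) (\<lambda>x. bind_pmf (check N1 rs x) (\<lambda>a.
      bind_pmf sample (\<lambda>x'. map_pmf (\<lambda>b. a \<and> b) (check N2 rs x'))))"
    by (simp add: test_round_def bind_assoc_pmf map_bind_pmf)
  show ?thesis
    unfolding test_round Round_def
  proof (rule spec_Seq'[OF spec_Random[where m = m, OF m(1)]])
    fix x m1 assume 1: "same {19} {2} m m1 \<and> holds m1 2 x"
    have s1: "same ?S ?A m m1"
      using 1 by (auto simp: same_def)
    show "spec (Seq (Assign 28 (V 5)) (Seq Check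
       (Seq (Sample (array 2)) (Seq (Assign 28 (V 6)) Check)))) m1
       (bind_pmf (check N1 rs x) (\<lambda>a.
          bind_pmf sample (\<lambda>x'. map_pmf (\<lambda>b. a \<and> b) (check N2 rs x')))) ?R
       (Suc (Suc (max 30 37))) (length rs * (4 * N1) + 2 + (1 + (length rs * (4 * N2) + 2 + 0)))"
    proof (rule spec_then'[OF spec_Set])
      fix m' assume m': "m' = m1(28 := val m1 (V 5))"
      have s': "same ?S ?A m m'"
        unfolding m' by (rule same_upd[OF s1]) auto
      have h': "holds m' 2 x" "m' 28 = N1" "(m' 10 \<noteq> 0) = ok"
        unfolding m' using 1 m ok by (simp_all add: same_facts[OF s1] same_facts[OF conjunct1[OF 1]])
      show "spec (Seq Check (Seq (Sample (array 2)) (Seq (Assign 28 (V 6)) Check))) m'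
        (bind_pmf (check N1 rs x) (\<lambda>a.
          bind_pmf sample (\<lambda>x'. map_pmf (\<lambda>b. a \<and> b) (check N2 rs x')))) ?R 38
        (length rs * (4 * N1) + 2 + (1 + (length rs * (4 * N2) + 2 + 0)))"
      proof (rule spec_Seq'[OF spec_Check[where m = m' and N = N1 and x = x and ok = ok]])
        show "m' 0 = n" "m' 11 = length rs" "m' 12 = 40 + (7 + 2 * length rs) * n"
          using m by (simp_all add: same_facts[OF s'])
        show "stored m' rs" "holds m' 1 (found rs)"
          using stored_same[OF s'] h by (simp_all add: same_facts[OF s'])
      next
        fix a m2 assume 2: "same check_cells {3, 4, 5, 6} m' m2 \<and> (m2 10 \<noteq> 0) = (ok \<and> a)"
        have s2: "same ?S ?A m m2"
          by (rule same_trans[OF conjunct1[OF 2] s']) auto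
        note ok2 = conjunct2[OF 2]
        have m2: "m2 0 = n"
          using m by (simp add: same_facts[OF s2])
        show "spec (Seq (Sample (array 2)) (Seq (Assign 28 (V 6)) Check)) m2
          (bind_pmf sample (\<lambda>x'. map_pmf (\<lambda>b. a \<and> b) (check N2 rs x'))) ?R 37
          (1 + (length rs * (4 * N2) + 2 + 0))"
        proof (rule spec_Seq'[OF spec_Sample[where m = m2, OF m2]])
          fix x' m3 assume 3: "same {} {2} m2 m3 \<and> holds m3 2 x'"
          have s3: "same ?S ?A m m3"
            by (rule same_trans[OF conjunct1[OF 3] s2]) auto
          show "spec (Seq (Assign 28 (V 6)) Check) m3 (map_pmf (\<lambda>b. a \<and> b) (check N2 rs x')) ?R
              36 (length rs * (4 * N2) + 2 + 0)"
          proof (rule spec_then'[OF spec_Set])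
            fix m4 assume 4: "m4 = m3(28 := val m3 (V 6))"
            have s4: "same ?S ?A m m4"
              unfolding 4 by (rule same_upd[OF s3]) auto
            have ok4: "(m4 10 \<noteq> 0) = (ok \<and> a)"
              unfolding 4 using ok2 by (simp add: same_facts[OF conjunct1[OF 3]])
            have h4: "holds m4 2 x'" "m4 28 = N2"
              unfolding 4 using 3 m by (simp_all add: same_facts[OF s3])
            show "spec Check m4 (map_pmf (\<lambda>b. a \<and> b) (check N2 rs x')) ?R 30 (length rs * (4 * N2) + 2)"
            proof (rule spec_map[OF spec_Check[where m = m4 and N = N2 and x = x' and ok = "ok \<and> a"]])
              show "m4 0 = n" "m4 11 = length rs" "m4 12 = 40 + (7 + 2 * length rs) * n"
                using m by (simp_all add: same_facts[OF s4])
              show "stored m4 rs" "holds m4 1 (found rs)"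
                using stored_same[OF s4] h by (simp_all add: same_facts[OF s4])
              fix b m' assume *: "same check_cells {3, 4, 5, 6} m4 m' \<and> (m' 10 \<noteq> 0) = ((ok \<and> a) \<and> b)"
              have "same ?S ?A m m'"
                by (rule same_trans[OF conjunct1[OF *] s4]) auto
              then show "?R (a \<and> b) m'"
                using * by simp
            qed (use h4 ok4 le in auto)
          qed auto
        qed auto
      qed (use h' le in auto)
    qed auto
  qed auto
qed

end

section \<open>Programs for the labels and the collection of blocks\<close>

abbreviation Skip :: com where
  "Skip \<equiv> Assign 19 (Lit 0)"

definition Hybrid :: expr where
  "Hybrid = AndE (El 2) (OrE (El 1) (LessE (El 0) (V 18)))"

text \<open>The power of two is rebuilt by doubling in every step, because the machine can neither
  multiply nor halve.\<close>

definition Search_step :: com where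
  "Search_step = Seq (Assign 18 (Lit 1)) (Seq (For 23 (V 22) (Assign 18 (Add (V 18) (V 18))))
     (Seq (Assign 18 (Add (V 17) (V 18))) (Seq (Ask 26 Hybrid)
       (Cond (NeqE (V 26) (V 16)) Skip (Assign 17 (V 18))))))"

text \<open>Block and point are written before the union is updated, because both refer to the union
  without the new block.\<close>

definition Extend :: com where
  "Extend = Seq (Assign 17 (Lit 0)) (Seq (For 22 (V 4) Search_step)
     (Seq (Map_array Row_block (AndE (NotE (El 1)) (NotE (NeqE (El 0) (V 17)))))
     (Seq (Assign 18 (Add (V 17) (Lit 1))) (Seq (Map_array Row_point Hybrid)
     (Seq (Map_array (array 1) (OrE (El 1) (At Row_block)))
     (Seq (Assign 12 (Add (V 12) (Add (V 0) (V 0)))) (Seq (Assign 11 (Add (V 11) (Lit 1)))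
       (Assign 9 (Lit 1)))))))))"

definition Epoch_step :: com where
  "Epoch_step = Seq (Sample (array 2)) (Seq (Query (Lit 15) (array 2))
     (Seq (Ask 16 (AndE (El 2) (El 1)))
       (Cond (AndE (NotE (V 9)) (NeqE (V 15) (V 16))) Extend Skip)))"

definition Epoch :: com where
  "Epoch = Cond (V 9) (Seq (Assign 9 (Lit 0)) (For 21 (V 8) Epoch_step)) Skip"

definition Collect_rows :: com where
  "Collect_rows = Seq (Assign 9 (Lit 1)) (Seq (Assign 11 (Lit 0)) (Seq (Assign 12 (array 7))
     (Seq (Map_array (array 1) (Lit 0)) (For 20 (Add (V 1) (Lit 1)) Epoch))))"

definition Label :: com where
  "Label = Seq (Assign 26 (Lit 0)) (Seq
     (For 21 (V 4) (Seq (Flip (Lit 27)) (Assign 26 (Add (Add (V 26) (V 26)) (V 27)))))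
     (Store (Add (array 0) (V 20)) (V 26)))"

lemma search_countdown:
  "countdown i (\<lambda>i lo. return_pmf (if g (lo + 2 ^ i) = t then lo + 2 ^ i else lo)) lo =
    return_pmf (search g t i lo)"
  by (induction i arbitrary: lo) (simp_all add: bind_return_pmf)

context ram
begin

lemma same_upd_refl: "i < 40 \<Longrightarrow> i \<in> S \<Longrightarrow> same S A m (m(i := v))"
  by (rule same_upd) auto

lemma spec_power:
  assumes "m 22 = i" "i \<le> Y ^ 2"
  shows "spec (For 23 (V 22) (Assign 18 (Add (V 18) (V 18)))) (m(18 := 1)) (return_pmf ())
    (\<lambda>_ m'. same {18, 23} {} m m' \<and> m' 18 = 2 ^ i) 3 0"
proof -
  let ?I = "\<lambda>j (_ :: unit) m'. same {18, 23} {} m m' \<and> m' 23 = j \<and> m' 18 = 2 ^ (i - j)"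
  have "spec (For 23 (V 22) (Assign 18 (Add (V 18) (V 18)))) (m(18 := 1))
    (countdown i (\<lambda>_ _. return_pmf ()) ()) (?I 0) (Suc (2 + 0)) (i * 0)"
  proof (rule spec_For[where I = ?I])
    fix j m' and u :: unit assume j: "j < i" and I: "?I (Suc j) u m'"
    have "same {18, 23} {} m (m'(23 := j))"
      using I by (simp add: same_upd)
    moreover have "2 * 2 ^ (i - Suc j) = (2 :: nat) ^ (i - j)"
      using j by (metis Suc_diff_Suc power_Suc)
    ultimately show "spec (Assign 18 (Add (V 18) (V 18))) (m'(23 := j)) (return_pmf ()) (?I j) 0 0"
      using I by (intro spec_Set') (simp add: same_upd)
  qed (use assms in \<open>simp_all add: same_upd\<close>)
  then show ?thesis
    unfolding countdown_unit by (rule spec_weaken) auto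
qed

abbreviation search_cells :: "nat set" where
  "search_cells \<equiv> {17, 18, 19, 22, 23, 26}"

definition ready :: "mem \<Rightarrow> (nat \<Rightarrow> nat) \<Rightarrow> row list \<Rightarrow> bool" where
  "ready m bid rs \<longleftrightarrow> m 0 = n \<and> holds m 1 (found rs) \<and> (\<forall>j<n. cell m 0 j = bid j)"

lemma ready_same:
  assumes "same S A m m'" "0 \<notin> S" "0 \<notin> A" "1 \<notin> A"
  shows "ready m' bid rs = ready m bid rs"
  using assms(2-) by (simp add: ready_def same_facts[OF assms(1)] same_cell[OF assms(1)])

lemma val_Hybrid:
  assumes "ready m bid rs" "holds m 2 x" "m 19 < n"
  shows "(val m Hybrid \<noteq> 0) = hybrid bid rs x (m 18) (m 19)"
proof -
  have "m 0 = n" "holds m 1 (found rs)" "cell m 0 (m 19) = bid (m 19)"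
    using assms by (simp_all add: ready_def)
  then show ?thesis
    using assms(2,3) by (simp add: Hybrid_def val_El holdsD hybrid_def)
qed

text \<open>Cell 22 is excluded from the frame because it is the counter of the surrounding loop and
  must survive the body.\<close>

lemma spec_Search_step:
  assumes m: "ready m bid rs" "holds m 2 x" "m 22 = i" "m 16 = of_bool t" "m 17 = lo" and i: "i \<le> Y ^ 2"
  shows "spec Search_step m
    (return_pmf (if F (hybrid bid rs x (lo + 2 ^ i)) = t then lo + 2 ^ i else lo))
    (\<lambda>lo' m'. same (search_cells - {22}) {5} m m' \<and> m' 17 = lo') 8 1" (is "spec _ _ ?p ?R _ _")
  unfolding Search_step_def
proof (rule spec_then'[OF spec_Set])
  fix m1 assume 1: "m1 = m(18 := val m (Lit 1))"
  have pw: "spec (For 23 (V 22) (Assign 18 (Add (V 18) (V 18)))) m1 (return_pmf ())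
      (\<lambda>_ m'. same {18, 23} {} m m' \<and> m' 18 = 2 ^ i) 3 0"
    using spec_power[of m i] m(3) i unfolding 1 by simp
  show "spec (Seq (For 23 (V 22) (Assign 18 (Add (V 18) (V 18))))
     (Seq (Assign 18 (Add (V 17) (V 18))) (Seq (Ask 26 Hybrid)
       (Cond (NeqE (V 26) (V 16)) Skip (Assign 17 (V 18)))))) m1 ?p ?R 7 1"
  proof (rule spec_then'[OF pw])
    fix m2 assume 2: "same {18, 23} {} m m2 \<and> m2 18 = 2 ^ i"
    have lo2: "m2 17 = lo"
      using m by (simp add: same_facts[OF conjunct1[OF 2]])
    show "spec (Seq (Assign 18 (Add (V 17) (V 18))) (Seq (Ask 26 Hybrid)
       (Cond (NeqE (V 26) (V 16)) Skip (Assign 17 (V 18))))) m2 ?p ?R 6 1"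
    proof (rule spec_then'[OF spec_Set])
      fix m3 assume 3: "m3 = m2(18 := val m2 (Add (V 17) (V 18)))"
      have s3: "same (search_cells - {22}) {5} m m3"
        unfolding 3 by (rule same_upd[OF same_trans[OF conjunct1[OF 2] same_refl]]) auto
      have m3: "ready m3 bid rs" "holds m3 2 x" "m3 16 = of_bool t"
        using m by (simp_all add: ready_same[OF s3] same_facts[OF s3])
      have v3: "m3 18 = lo + 2 ^ i" "m3 17 = lo"
        unfolding 3 using 2 lo2 by simp_all
      have z3: "m3 0 = n"
        using m3 by (simp add: ready_def)
      let ?b = "F (hybrid bid rs x (lo + 2 ^ i))"
      show "spec (Seq (Ask 26 Hybrid) (Cond (NeqE (V 26) (V 16)) Skip (Assign 17 (V 18)))) m3 ?p ?R 5 1"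
      proof (rule spec_then'[OF spec_Ask[where m = m3 and p = "hybrid bid rs x (lo + 2 ^ i)", OF z3]])
        fix m' j assume j: "j < n" "m' 19 = j" and s: "same {19} {5} m3 m'"
        show "(val m' Hybrid \<noteq> 0) = hybrid bid rs x (lo + 2 ^ i) j"
          using val_Hybrid[of m' bid rs x] j m3 v3
          by (simp add: ready_same[OF s] same_facts[OF s])
      next
        fix m4 assume 4: "same {26, 19} {5} m3 m4 \<and> m4 26 = of_bool ?b"
        have s4: "same (search_cells - {22}) {5} m m4"
          by (rule same_trans[OF conjunct1[OF 4] s3]) auto
        have m4: "m4 26 = of_bool ?b" "m4 16 = of_bool t" "m4 18 = lo + 2 ^ i" "m4 17 = lo"
          using 4 m3 v3 by (simp_all add: same_facts[OF conjunct1[OF 4]])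
        show "spec (Cond (NeqE (V 26) (V 16)) Skip (Assign 17 (V 18))) m4 ?p ?R (Suc 0) 0"
        proof (rule spec_Cond)
          assume "val m4 (NeqE (V 26) (V 16)) \<noteq> 0"
          then have "?b \<noteq> t"
            using m4 by auto
          then show "spec Skip m4 ?p ?R 0 0"
            using m4 by (intro spec_Set') (simp add: same_upd[OF s4])
        next
          assume "val m4 (NeqE (V 26) (V 16)) = 0"
          then have "?b = t"
            using m4 by (cases ?b; cases t) auto
          then show "spec (Assign 17 (V 18)) m4 ?p ?R 0 0"
            using m4 by (intro spec_Set') (simp add: same_upd[OF s4])
        qed
      qed simp_all
    qed simp_all
  qed simp_all
qed simp_all

lemma spec_Search:
  assumes m: "ready m bid rs" "holds m 2 x" "m 16 = of_bool t" "m 4 = s" and s: "s \<le> Y ^ 2"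
  shows "spec (For 22 (V 4) Search_step) (m(17 := 0))
    (return_pmf (search (\<lambda>c. F (hybrid bid rs x c)) t s 0))
    (\<lambda>lo m'. same search_cells {5} m m' \<and> m' 17 = lo) 12 s"
proof -
  let ?I = "\<lambda>j lo m'. same search_cells {5} m m' \<and> m' 22 = j \<and> m' 17 = lo"
  have "spec (For 22 (V 4) Search_step) (m(17 := 0))
    (countdown s (\<lambda>i lo. return_pmf (if F (hybrid bid rs x (lo + 2 ^ i)) = t then lo + 2 ^ i else lo)) 0)
    (?I 0) (Suc (2 + 8)) (s * 1)"
  proof (rule spec_For[where I = ?I])
    fix j lo m' assume j: "j < s" and I: "?I (Suc j) lo m'"
    let ?m = "m'(22 := j)"
    have same: "same search_cells {5} m ?m"
      using I by (simp add: same_upd)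
    show "spec Search_step ?m
      (return_pmf (if F (hybrid bid rs x (lo + 2 ^ j)) = t then lo + 2 ^ j else lo)) (?I j) 8 1"
    proof (rule spec_weaken[OF spec_Search_step[where m = ?m and i = j and t = t and lo = lo]])
      show "ready ?m bid rs" "holds ?m 2 x" "?m 16 = of_bool t"
        using m ready_same[OF same] holds_same[OF same, of 2 x] same_scalar[OF same, of 16] by simp_all
      fix lo' m'' assume *: "same (search_cells - {22}) {5} ?m m'' \<and> m'' 17 = lo'"
      have "same search_cells {5} m m''"
        by (rule same_trans[OF conjunct1[OF *] same]) auto
      then show "?I j lo' m''"
        using * same_scalar[OF conjunct1[OF *], of 22] by simp
    qed (use j s I in simp_all)
  qed (use m s in \<open>simp_all add: same_upd\<close>)
  then show ?thesis
    unfolding search_countdown[of s "\<lambda>c. F (hybrid bid rs x c)" t] by (rule spec_weaken) auto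
qed

text \<open>The memory during the search for relevant blocks, relative to the memory \<open>m0\<close> before it.\<close>

definition collected :: "mem \<Rightarrow> (nat \<Rightarrow> nat) \<Rightarrow> row list \<times> bool \<Rightarrow> mem \<Rightarrow> bool" where
  "collected m0 bid st m \<longleftrightarrow>
     same ({9, 11, 12, 15, 16} \<union> search_cells) (- {0}) m0 m \<and> ready m bid (fst st) \<and>
     m 11 = length (fst st) \<and> m 12 = 40 + (7 + 2 * length (fst st)) * n \<and> stored m (fst st) \<and>
     (m 9 \<noteq> 0) = snd st"

lemma collected_same:
  assumes "same S A m m'" "collected m0 bid st m"
    "S \<subseteq> {15, 16} \<union> search_cells" "A \<subseteq> {2..6}"
  shows "collected m0 bid st m'"
proof -
  have "same ({9, 11, 12, 15, 16} \<union> search_cells) (- {0}) m0 m'"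
    by (rule same_trans[OF assms(1) conjunct1[OF assms(2)[unfolded collected_def]]]) (use assms(3,4) in auto)
  moreover have "0 \<notin> S" "9 \<notin> S" "11 \<notin> S" "12 \<notin> S" "0 \<notin> A" "1 \<notin> A" "A \<subseteq> {..6}"
    using assms(3,4) by auto
  ultimately show ?thesis
    using assms(2) unfolding collected_def
    by (simp add: same_facts[OF assms(1)] ready_same[OF assms(1)] stored_same[OF assms(1)])
qed

lemma collected_scalar:
  assumes "collected m0 bid st m" "i < 40" "i \<notin> {9, 11, 12, 15, 16} \<union> search_cells"
  shows "m i = m0 i"
  using assms(1) unfolding collected_def by (blast intro: same_scalar[OF _ assms(2,3)])

text \<open>The loop counters 20 and 21 are not among the cells allowed to change, so the reference
  memory moves along with them. The loop invariants record the counter in this way.\<close>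

lemma collected_upd:
  assumes "collected m0 bid st m" "i \<in> {20, 21}"
  shows "collected (m0(i := v)) bid st (m(i := v))"
proof -
  have i: "i < 40" "i \<noteq> 0" "i \<noteq> 9" "i \<noteq> 11" "i \<noteq> 12"
    using assms(2) by auto
  have "same S A (m0(i := v)) (m(i := v))" if "same S A m0 m" for S A
    using that i(1) by (simp add: same_def)
  then show ?thesis
    using assms(1) i unfolding collected_def ready_def stored_def by simp
qed

lemma spec_Extend:
  assumes c: "collected m0 bid (rs, a) m" and x: "holds m 2 x" and t: "m 16 = of_bool (F (masked rs x))"
    and s: "m0 4 = s" "s \<le> Y ^ 2"
  shows "spec Extend m (return_pmf (extend bid s rs x, True)) (\<lambda>st m'. collected m0 bid st m') 30 s"
  (is "spec _ _ ?p ?R _ _")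
  unfolding Extend_def
proof (rule spec_then'[OF spec_Set])
  let ?P1 = "Seq (Assign 11 (Add (V 11) (Lit 1))) (Assign 9 (Lit 1))"
  let ?P2 = "Seq (Assign 12 (Add (V 12) (Add (V 0) (V 0)))) ?P1"
  let ?P3 = "Seq (Map_array (array 1) (OrE (El 1) (At Row_block))) ?P2"
  let ?P4 = "Seq (Map_array Row_point Hybrid) ?P3"
  let ?P5 = "Seq (Assign 18 (Add (V 17) (Lit 1))) ?P4"
  let ?P6 = "Seq (Map_array Row_block (AndE (NotE (El 1)) (NotE (NeqE (El 0) (V 17))))) ?P5"
  let ?P7 = "Seq (For 22 (V 4) Search_step) ?P6"
  let ?S = "{9, 11, 12, 15, 16} \<union> search_cells" and ?k = "length rs"
  define lo where "lo = search (\<lambda>c. F (hybrid bid rs x c)) (F (masked rs x)) s 0"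
  let ?B = "\<lambda>j. \<not> found rs j \<and> bid j = lo" and ?v = "hybrid bid rs x (Suc lo)"
  have ext: "extend bid s rs x = (?B, ?v) # rs"
    by (simp add: extend_def lo_def Let_def)
  fix m1 assume 1: "m1 = m(17 := val m (Lit 0))"
  have cm: "same ?S (- {0}) m0 m" "ready m bid rs" "m 12 = 40 + (7 + 2 * ?k) * n" "m 11 = ?k" "stored m rs"
    using c unfolding collected_def by simp_all
  have m4: "m 4 = s"
    using s by (simp add: same_facts[OF cm(1)])
  have search: "spec (For 22 (V 4) Search_step) m1 (return_pmf lo)
      (\<lambda>lo m'. same search_cells {5} m m' \<and> m' 17 = lo) 12 s"
    unfolding lo_def using spec_Search[OF cm(2) x t m4 s(2)] unfolding 1 by simp
  show "spec ?P7 m1 ?p ?R 29 s"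
  proof (rule spec_then'[OF search])
    fix m2 assume 2: "same search_cells {5} m m2 \<and> m2 17 = lo"
    note s2 = conjunct1[OF 2]
    have m2: "ready m2 bid rs" "m2 12 = 40 + (7 + 2 * ?k) * n" "m2 11 = ?k" "stored m2 rs" "holds m2 2 x" "m2 17 = lo"
      using cm x 2 by (simp_all add: ready_same[OF s2] same_facts[OF s2] stored_same[OF s2])
    have z2: "m2 0 = n"
      using m2 by (simp add: ready_def)
    show "spec ?P6 m2 ?p ?R 28 0"
    proof (rule spec_then'[OF spec_Map[where m = m2 and c = "7 + 2 * ?k" and x = ?B, OF z2]])
      fix m' assume s: "same {19} {7 + 2 * ?k} m2 m'"
      show "val m' Row_block = 40 + (7 + 2 * ?k) * n"
        using m2 by (simp add: same_scalar[OF s])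
      fix j assume j: "j < n" "m' 19 = j"
      have "m' 0 = n" "holds m' 1 (found rs)" "cell m' 0 j = bid j" "m' 17 = lo"
        using m2 j(1) by (simp_all add: ready_def same_scalar[OF s] holds_same[OF s] same_cell[OF s])
      then show "(val m' (AndE (NotE (El 1)) (NotE (NeqE (El 0) (V 17)))) \<noteq> 0) = ?B j"
        using j by (simp add: val_El holdsD)
    next
      fix m3 assume 3: "same {19} {7 + 2 * ?k} m2 m3 \<and> holds m3 (7 + 2 * ?k) ?B"
      note s3 = conjunct1[OF 3]
      show "spec ?P5 m3 ?p ?R 27 0"
      proof (rule spec_then'[OF spec_Set])
        fix m4 assume 4: "m4 = m3(18 := val m3 (Add (V 17) (Lit 1)))"
        have s4: "same search_cells {5, 7 + 2 * ?k} m m4"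
          unfolding 4 using s2 s3 by (auto simp: same_def)
        have m4: "ready m4 bid rs" "m4 12 = 40 + (7 + 2 * ?k) * n" "m4 11 = ?k" "holds m4 2 x"
          using cm x by (simp_all add: ready_same[OF s4] same_scalar[OF s4] holds_same[OF s4])
        have v4: "m4 18 = Suc lo" "holds m4 (7 + 2 * ?k) ?B"
          unfolding 4 using m2(6) 3 by (simp_all add: same_scalar[OF s3])
        have z4: "m4 0 = n"
          using m4 by (simp add: ready_def)
        show "spec ?P4 m4 ?p ?R 26 0"
        proof (rule spec_then'[OF spec_Map[where m = m4 and c = "8 + 2 * ?k" and x = ?v, OF z4]])
          fix m' assume s: "same {19} {8 + 2 * ?k} m4 m'"
          show "val m' Row_point = 40 + (8 + 2 * ?k) * n"
            using m4 z4 by (simp add: same_scalar[OF s] algebra_simps)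
          fix j assume j: "j < n" "m' 19 = j"
          have "ready m' bid rs" "holds m' 2 x" "m' 18 = Suc lo"
            using m4 v4 by (simp_all add: ready_same[OF s] same_scalar[OF s] holds_same[OF s])
          then show "(val m' Hybrid \<noteq> 0) = ?v j"
            using val_Hybrid[of m' bid rs x] j by simp
        next
          fix m5 assume 5: "same {19} {8 + 2 * ?k} m4 m5 \<and> holds m5 (8 + 2 * ?k) ?v"
          note s5 = conjunct1[OF 5]
          have m5: "ready m5 bid rs" "m5 12 = 40 + (7 + 2 * ?k) * n" "m5 11 = ?k" "holds m5 (7 + 2 * ?k) ?B"
            using m4 v4 by (simp_all add: ready_same[OF s5] same_scalar[OF s5] holds_same[OF s5])
          have z5: "m5 0 = n"
            using m5 by (simp add: ready_def)
          show "spec ?P3 m5 ?p ?R 25 0"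
          proof (rule spec_then'[OF spec_Map[where m = m5 and c = 1 and x = "found ((?B, ?v) # rs)", OF z5]])
            fix m' assume s: "same {19} {1} m5 m'"
            show "val m' (array 1) = 40 + 1 * n"
              using z5 by (simp add: same_scalar[OF s])
            fix j assume j: "j < n" "m' 19 = j" "cell m' 1 j = cell m5 1 j"
            have "m' 0 = n" "m' 12 = 40 + (7 + 2 * ?k) * n" "holds m' (7 + 2 * ?k) ?B"
              using m5 z5 by (simp_all add: same_scalar[OF s] holds_same[OF s])
            moreover from this have "val m' (At Row_block) = cell m' (7 + 2 * ?k) j"
              using j by (simp add: reg_def)
            ultimately show "(val m' (OrE (El 1) (At Row_block)) \<noteq> 0) = found ((?B, ?v) # rs) j"
              using j m5(1) holdsD[of m5 1 "found rs" j] holdsD[of m' "7 + 2 * ?k" ?B j]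
              by (simp add: val_El ready_def found_def) blast
          next
            fix m6 assume 6: "same {19} {1} m5 m6 \<and> holds m6 1 (found ((?B, ?v) # rs))"
            note s6 = conjunct1[OF 6]
            have z6: "m6 0 = n" "m6 12 = 40 + (7 + 2 * ?k) * n" "m6 11 = ?k"
              using z5 m5 by (simp_all add: same_scalar[OF s6])
            define \<mu> where "\<mu> = m6(12 := 40 + (7 + 2 * Suc ?k) * n, 11 := Suc ?k, 9 := 1)"
            have same6: "same ?S (- {0}) m0 m6"
            proof (rule same_trans[OF s6 same_trans[OF s5 same_trans[OF s4 cm(1)]]])
            qed auto
            have "collected m0 bid ((?B, ?v) # rs, True) \<mu>"
              unfolding collected_def fst_conv snd_conv
            proof (intro conjI)
              show "same ?S (- {0}) m0 \<mu>"
                unfolding \<mu>_def by (intro same_upd same6) auto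
              show "ready \<mu> bid ((?B, ?v) # rs)"
                using 6 z6 m5(1) by (simp add: ready_def \<mu>_def same_cell[OF s6])
              \<comment> \<open>The new row occupies the arrays \<open>7 + 2 * ?k\<close> and
                \<open>8 + 2 * ?k\<close>, above those of all earlier rows.\<close>
              have "stored m5 rs"
              proof -
                have "stored m4 rs"
                  unfolding stored_def
                proof (intro allI impI)
                  fix i assume i: "i < ?k"
                  then show "holds m4 (7 + 2 * i) (fst (rev rs ! i)) \<and> holds m4 (8 + 2 * i) (snd (rev rs ! i))"
                    using cm(5) by (simp add: stored_def holds_same[OF s4])
                qed
                then show ?thesis
                  by (simp add: stored_def holds_same[OF s5])
              qed
              then have "stored m6 rs"
                by (simp add: stored_def holds_same[OF s6])
              moreover have "holds m6 (7 + 2 * ?k) ?B" "holds m6 (8 + 2 * ?k) ?v"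
                using m5(4) 5 by (simp_all add: holds_same[OF s6])
              ultimately show "stored \<mu> ((?B, ?v) # rs)"
                unfolding stored_def \<mu>_def by (simp add: nth_append less_Suc_eq)
            qed (simp_all add: \<mu>_def)
            then have R: "?R ((?B, ?v) # rs, True) \<mu>" .
            show "spec ?P2 m6 ?p ?R 24 0"
              unfolding ext
            proof (rule spec_then'[OF spec_Set])
              fix m7 assume 7: "m7 = m6(12 := val m6 (Add (V 12) (Add (V 0) (V 0))))"
              show "spec ?P1 m7
                (return_pmf ((?B, ?v) # rs, True)) ?R 23 0"
              proof (rule spec_then'[OF spec_Set])
                fix m8 assume 8: "m8 = m7(11 := val m7 (Add (V 11) (Lit 1)))"
                have "m8(9 := val m8 (Lit 1)) = \<mu>"
                  unfolding 8 7 \<mu>_def using z6 by (simp add: algebra_simps)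
                then show "spec (Assign 9 (Lit 1)) m8 (return_pmf ((?B, ?v) # rs, True)) ?R 0 0"
                  using R by (intro spec_Set') simp
              qed simp_all
            qed simp_all
          qed simp_all
        qed simp_all
      qed simp_all
    qed simp_all
  qed simp_all
qed simp_all

lemma spec_Epoch_step:
  assumes c: "collected m0 bid st m" and s: "m0 4 = s" "s \<le> Y ^ 2"
  shows "spec Epoch_step m (epoch_step bid s st) (\<lambda>st m'. collected m0 bid st m') 40 (s + 3)"
proof -
  obtain rs a where st: "st = (rs, a)" by (cases st)
  let ?q = "\<lambda>x. return_pmf (if \<not> a \<and> F x \<noteq> F (masked rs x) then (extend bid s rs x, True) else (rs, a))"
  have m: "m 0 = n"
    using c by (simp add: collected_def ready_def)
  show ?thesis
    unfolding Epoch_step_def epoch_step_def st prod.case map_pmf_def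
  proof (rule spec_Seq'[OF spec_Sample[where m = m, OF m]])
    fix x m1 assume 1: "same {} {2} m m1 \<and> holds m1 2 x"
    note s1 = conjunct1[OF 1]
    have c1: "collected m0 bid (rs, a) m1"
      by (rule collected_same[OF s1 c[unfolded st]]) auto
    have m1: "m1 0 = n" "holds m1 2 x"
      using c1 1 by (simp_all add: collected_def ready_def)
    show "spec (Seq (Query (Lit 15) (array 2)) (Seq (Ask 16 (AndE (El 2) (El 1)))
       (Cond (AndE (NotE (V 9)) (NeqE (V 15) (V 16))) Extend Skip))) m1 (?q x)
       (\<lambda>st m'. collected m0 bid st m') 39 (s + 2)"
    proof (rule spec_then'[OF spec_Query[where m = m1, OF m1]])
      fix m2 assume 2: "m2 = m1(15 := of_bool (F x))"
      have s2: "same {15} {} m1 m2"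
        unfolding 2 by (rule same_upd) auto
      have c2: "collected m0 bid (rs, a) m2"
        by (rule collected_same[OF s2 c1]) auto
      have m2: "m2 0 = n" "holds m2 2 x" "holds m2 1 (found rs)" "m2 15 = of_bool (F x)"
        using c2 m1 unfolding 2 by (simp_all add: collected_def ready_def)
      show "spec (Seq (Ask 16 (AndE (El 2) (El 1)))
         (Cond (AndE (NotE (V 9)) (NeqE (V 15) (V 16))) Extend Skip)) m2 (?q x)
         (\<lambda>st m'. collected m0 bid st m') 38 (s + 1)"
      proof (rule spec_then'[OF spec_Ask[where m = m2 and p = "masked rs x", OF m2(1)]])
        fix m' j assume j: "j < n" "m' 19 = j" and s': "same {19} {5} m2 m'"
        show "(val m' (AndE (El 2) (El 1)) \<noteq> 0) = masked rs x j"
          using j m2 by (simp add: val_El same_facts[OF s'] same_cell[OF s'] holdsD masked_def)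
      next
        fix m3 assume 3: "same {16, 19} {5} m2 m3 \<and> m3 16 = of_bool (F (masked rs x))"
        note s3 = conjunct1[OF 3]
        have c3: "collected m0 bid (rs, a) m3"
          by (rule collected_same[OF s3 c2]) auto
        have m3: "holds m3 2 x" "m3 15 = of_bool (F x)" "(m3 9 \<noteq> 0) = a"
          using c3 m2 by (simp_all add: collected_def same_facts[OF s3])
        have guard: "val m3 (AndE (NotE (V 9)) (NeqE (V 15) (V 16))) \<noteq> 0 \<longleftrightarrow> \<not> a \<and> F x \<noteq> F (masked rs x)"
          using m3 3 by auto
        show "spec (Cond (AndE (NotE (V 9)) (NeqE (V 15) (V 16))) Extend Skip) m3 (?q x)
           (\<lambda>st m'. collected m0 bid st m') (Suc 30) s"
        proof (rule spec_Cond)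
          assume "val m3 (AndE (NotE (V 9)) (NeqE (V 15) (V 16))) \<noteq> 0"
          then show "spec Extend m3 (?q x) (\<lambda>st m'. collected m0 bid st m') 30 s"
            using spec_Extend[OF c3 m3(1) _ s] 3 guard by simp
        next
          assume "val m3 (AndE (NotE (V 9)) (NeqE (V 15) (V 16))) = 0"
          then have q: "?q x = return_pmf (rs, a)"
            using guard by simp
          have "collected m0 bid (rs, a) (m3(19 := val m3 (Lit 0)))"
            by (rule collected_same[OF same_upd[OF same_refl, of 19 "{19}"] c3]) auto
          then show "spec Skip m3 (?q x) (\<lambda>st m'. collected m0 bid st m') 30 s"
            unfolding q by (intro spec_weaken[OF spec_Set'[where R = "\<lambda>st m'. collected m0 bid st m'"]]) auto
        qed
      qed simp_all
    qed simp_all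
  qed simp_all
qed

text \<open>\<open>v\<close> is whatever the inner loop leaves in its counter; an idle epoch does
  not touch it.\<close>

lemma spec_Epoch:
  assumes c: "collected m0 bid st m" and s: "m0 4 = s" "s \<le> Y ^ 2" and T: "m0 8 = T" "T \<le> Y ^ 6"
  shows "spec Epoch m (epoch bid s T st) (\<lambda>st m'. \<exists>v. collected (m0(21 := v)) bid st m') 50 (T * (s + 3))"
    (is "spec _ _ _ ?R _ _")
proof -
  obtain rs a where st: "st = (rs, a)" by (cases st)
  have a: "val m (V 9) \<noteq> 0 \<longleftrightarrow> a"
    using c st by (simp add: collected_def)
  have "spec Epoch m (epoch bid s T st) ?R (Suc 49) (T * (s + 3))"
    unfolding Epoch_def
  proof (rule spec_Cond)
    assume "val m (V 9) \<noteq> 0"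
    then have ep: "epoch bid s T st = countdown T (\<lambda>_. epoch_step bid s) (rs, False)"
      using a st by (simp add: epoch_def)
    let ?I = "\<lambda>j st m'. collected (m0(21 := j)) bid st m'"
    show "spec (Seq (Assign 9 (Lit 0)) (For 21 (V 8) Epoch_step)) m (epoch bid s T st) ?R 49 (T * (s + 3))"
      unfolding ep
    proof (rule spec_then'[OF spec_Set])
      fix m1 assume 1: "m1 = m(9 := val m (Lit 0))"
      have c1: "collected m0 bid (rs, False) m1"
        using c st unfolding 1 by (simp add: collected_def same_upd ready_def stored_def)
      have m1: "m1 8 = T"
        using T collected_scalar[OF c1, of 8] by simp
      have "spec (For 21 (V 8) Epoch_step) m1 (countdown T (\<lambda>_. epoch_step bid s) (rs, False))
          (?I 0) (Suc (6 + 40)) (T * (s + 3))"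
      proof (rule spec_For[where I = ?I])
        show "?I T (rs, False) (m1(21 := T))"
          by (rule collected_upd[OF c1]) simp
        show "m' 21 = j" if "?I j st m'" for j st m'
          using collected_scalar[OF that, of 21] by simp
        fix j st m' assume I: "?I (Suc j) st m'"
        have "collected (m0(21 := j)) bid st (m'(21 := j))"
          using collected_upd[OF I, of 21 j] by simp
        then show "spec Epoch_step (m'(21 := j)) (epoch_step bid s st) (?I j) 40 (s + 3)"
          by (rule spec_Epoch_step) (use s in simp_all)
      qed (use m1 T in simp_all)
      then show "spec (For 21 (V 8) Epoch_step) m1 (countdown T (\<lambda>_. epoch_step bid s) (rs, False))
          ?R 48 (T * (s + 3))"
        by (rule spec_weaken) auto
    qed simp_all
  next
    assume "val m (V 9) = 0"
    then have ep: "epoch bid s T st = return_pmf st"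
      using a st by (simp add: epoch_def)
    have "collected m0 bid st (m(19 := val m (Lit 0)))"
      by (rule collected_same[OF same_upd_refl[of 19 "{19}"] c]) auto
    then have "?R st (m(19 := val m (Lit 0)))"
      by (intro exI[of _ "m0 21"]) simp
    then show "spec Skip m (epoch bid s T st) ?R 49 (T * (s + 3))"
      unfolding ep by (intro spec_weaken[OF spec_Set'[where R = ?R]]) auto
  qed
  then show ?thesis by simp
qed

lemma spec_Collect:
  assumes m: "m 0 = n" "m 1 = k" "m 4 = s" "m 8 = T" and bid: "\<And>j. j < n \<Longrightarrow> cell m 0 j = bid j"
    and le: "s \<le> Y ^ 2" "T \<le> Y ^ 6" "Suc k \<le> Y"
  shows "spec Collect_rows m (collect bid s T k)
    (\<lambda>st m'. same ({9, 11, 12, 15, 16, 20, 21} \<union> search_cells) (- {0}) m m' \<and> collected m' bid st m') 60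
    (Suc k * (T * (s + 3)))" (is "spec _ _ _ ?R _ ?Q")
  unfolding Collect_rows_def
proof (rule spec_then'[OF spec_Set])
  fix m1 assume 1: "m1 = m(9 := val m (Lit 1))"
  show "spec (Seq (Assign 11 (Lit 0)) (Seq (Assign 12 (array 7))
     (Seq (Map_array (array 1) (Lit 0)) (For 20 (Add (V 1) (Lit 1)) Epoch)))) m1 (collect bid s T k) ?R 59 ?Q"
  proof (rule spec_then'[OF spec_Set])
    fix m2 assume 2: "m2 = m1(11 := val m1 (Lit 0))"
    show "spec (Seq (Assign 12 (array 7))
       (Seq (Map_array (array 1) (Lit 0)) (For 20 (Add (V 1) (Lit 1)) Epoch))) m2 (collect bid s T k) ?R 58 ?Q"
    proof (rule spec_then'[OF spec_Set])
      fix m3 assume 3: "m3 = m2(12 := val m2 (array 7))"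
      have s3: "same {9, 11, 12} {} m m3"
        unfolding 3 2 1 by (intro same_upd) auto
      have m3: "m3 0 = n" "m3 9 = 1" "m3 11 = 0" "m3 12 = 40 + 7 * n"
        unfolding 3 2 1 using m by simp_all
      show "spec (Seq (Map_array (array 1) (Lit 0)) (For 20 (Add (V 1) (Lit 1)) Epoch)) m3 (collect bid s T k) ?R 57 ?Q"
      proof (rule spec_then'[OF spec_Map[where m = m3 and c = 1 and x = "found []", OF m3(1)]])
        fix m' assume s': "same {19} {1} m3 m'"
        show "val m' (array 1) = 40 + 1 * n"
          using m3(1) by (simp add: same_scalar[OF s'])
        show "(val m' (Lit 0) \<noteq> 0) = found [] j" for j
          by (simp add: found_def)
      next
        fix m4 assume 4: "same {19} {1} m3 m4 \<and> holds m4 1 (found [])"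
        note s4 = conjunct1[OF 4]
        have s: "same {9, 11, 12, 19} {1} m m4"
          using s3 s4 by (auto simp: same_def)
        have m4: "m4 0 = n" "m4 1 = k" "m4 4 = s" "m4 8 = T" "\<And>j. j < n \<Longrightarrow> cell m4 0 j = bid j"
          using m bid by (simp_all add: same_scalar[OF s] same_cell[OF s])
        have c4: "collected m4 bid ([], True) m4"
          using m4 4 m3 by (simp add: collected_def ready_def stored_def same_scalar[OF s4])
        let ?I = "\<lambda>j st m'. \<exists>v. collected (m4(20 := j, 21 := v)) bid st m'"
        have "spec (For 20 (Add (V 1) (Lit 1)) Epoch) m4
            (countdown (Suc k) (\<lambda>_. epoch bid s T) ([], True)) (?I 0) (Suc (1 + 50)) ?Q"
        proof (rule spec_For[where I = ?I])
          show "?I (Suc k) ([], True) (m4(20 := Suc k))"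
            using collected_upd[OF c4, of 20 "Suc k"] by (intro exI[of _ "m4 21"]) (simp add: fun_upd_idem)
          show "m' 20 = j" if I: "?I j st m'" for j st m'
          proof -
            obtain v where "collected (m4(20 := j, 21 := v)) bid st m'"
              using I by blast
            from collected_scalar[OF this, of 20] show ?thesis
              by simp
          qed
          fix j st m' assume "?I (Suc j) st m'"
          then obtain v where "collected (m4(20 := Suc j, 21 := v)) bid st m'" by blast
          from collected_upd[OF this, of 20 j]
          have "collected (m4(20 := j, 21 := v)) bid st (m'(20 := j))"
            by (simp add: fun_upd_twist)
          then have "spec Epoch (m'(20 := j)) (epoch bid s T st)
              (\<lambda>st m'. \<exists>v'. collected (m4(20 := j, 21 := v, 21 := v')) bid st m') 50 (T * (s + 3))"
            by (rule spec_Epoch) (use m4 le in simp_all)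
          then show "spec Epoch (m'(20 := j)) (epoch bid s T st) (?I j) 50 (T * (s + 3))"
            by simp
        qed (use m4 le in simp_all)
        then show "spec (For 20 (Add (V 1) (Lit 1)) Epoch) m4 (collect bid s T k) ?R 56 ?Q"
          unfolding collect_def
        proof (rule spec_weaken)
          fix st m' assume "?I 0 st m'"
          then obtain v where c: "collected (m4(20 := 0, 21 := v)) bid st m'" by blast
          have "same ({9, 11, 12, 15, 16, 20, 21} \<union> search_cells) (- {0}) m m'"
            using c s unfolding collected_def same_def by auto
          \<comment> \<open>From here on the memory is its own reference, which forgets the values
            of the counters.\<close>
          moreover have "collected m' bid st m'"
            using c unfolding collected_def by simp
          ultimately show "?R st m'" by blast
        qed simp_all
      qed simp_all
    qed simp_all
  qed simp_all
qed simp_all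

lemma spec_Label:
  assumes m: "m 0 = n" "m 4 = s" "m 20 = i" and i: "i < n" and s: "s \<le> Y ^ 2"
  shows "spec Label m (digits s)
    (\<lambda>v m'. same {21, 26, 27} {0} m m' \<and> (\<forall>j<n. cell m' 0 j = (if j = i then v else cell m 0 j))) 9 0"
    (is "spec _ _ _ ?R _ _")
  unfolding Label_def
proof (rule spec_then'[OF spec_Set])
  fix m1 assume 1: "m1 = m(26 := val m (Lit 0))"
  let ?I = "\<lambda>j v m'. same {21, 26, 27} {} m m' \<and> m' 21 = j \<and> m' 26 = v"
  have loop: "spec (For 21 (V 4) (Seq (Flip (Lit 27)) (Assign 26 (Add (Add (V 26) (V 26)) (V 27))))) m1
      (digits s) (?I 0) (Suc (2 + 2)) (s * 0)"
    unfolding digits_def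
  proof (rule spec_For[where I = ?I])
    show "?I s 0 (m1(21 := s))"
      unfolding 1 by (auto intro!: same_upd simp del: fun_upd_apply simp: fun_upd_same fun_upd_other)
    fix j v m' assume I: "?I (Suc j) v m'"
    let ?m = "m'(21 := j)"
    have "spec (Seq (Flip (Lit 27)) (Assign 26 (Add (Add (V 26) (V 26)) (V 27)))) ?m
      (bind_pmf (bernoulli_pmf (1/2)) (\<lambda>c. return_pmf (2 * v + of_bool c))) (?I j) 2 0"
    proof (rule spec_Seq'[OF spec_Flip])
      fix c m2 assume 2: "m2 = ?m(val ?m (Lit 27) := of_bool c)"
      show "spec (Assign 26 (Add (Add (V 26) (V 26)) (V 27))) m2 (return_pmf (2 * v + of_bool c)) (?I j) 0 0"
        using I unfolding 2 by (intro spec_Set') (simp add: same_upd)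
    qed simp_all
    then show "spec (Seq (Flip (Lit 27)) (Assign 26 (Add (Add (V 26) (V 26)) (V 27)))) ?m
      (map_pmf (\<lambda>c. 2 * v + of_bool c) (bernoulli_pmf (1/2))) (?I j) 2 0"
      by (simp add: map_pmf_def)
  qed (use m s in \<open>simp_all add: 1\<close>)
  have "spec (Seq (For 21 (V 4) (Seq (Flip (Lit 27)) (Assign 26 (Add (Add (V 26) (V 26)) (V 27)))))
     (Store (Add (array 0) (V 20)) (V 26))) m1 (bind_pmf (digits s) return_pmf) ?R 8 0"
  proof (rule spec_Seq'[OF loop])
    fix v m2 assume I: "?I 0 v m2"
    have s2: "same {21, 26, 27} {} m m2"
      using I by simp
    have m2: "m2 0 = n" "m2 20 = i" "m2 26 = v" "\<And>j. j < n \<Longrightarrow> cell m2 0 j = cell m 0 j"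
      using m I by (simp_all add: same_scalar[OF s2] same_cell[OF s2])
    have addr: "val m2 (Add (array 0) (V 20)) = 40 + 0 * n + i"
      using m2 by simp
    have "same {21, 26, 27} {0} m (m2(40 + 0 * n + i := v))"
      by (rule same_upd_cell[OF same_trans[OF s2 same_refl]]) (use i in auto)
    moreover have "cell (m2(40 + 0 * n + i := v)) 0 j = (if j = i then v else cell m 0 j)" if "j < n" for j
      using cell_upd_cell[OF i that, of m2 0 v 0] m2(4)[OF that] by auto
    ultimately have R: "?R v (m2(40 + 0 * n + i := v))"
      by blast
    have "spec (Store (Add (array 0) (V 20)) (V 26)) m2 (map_pmf (\<lambda>_. v) (return_pmf ())) ?R 0 0"
    proof (rule spec_map[OF spec_Store])
      fix m' assume m': "m' = m2(val m2 (Add (array 0) (V 20)) := val m2 (V 26))"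
      show "?R v m'"
        unfolding m' addr using R m2(3) by simp
    qed
    then show "spec (Store (Add (array 0) (V 20)) (V 26)) m2 (return_pmf v) ?R 0 0"
      by simp
  qed simp_all
  then show "spec (Seq (For 21 (V 4) (Seq (Flip (Lit 27)) (Assign 26 (Add (Add (V 26) (V 26)) (V 27)))))
     (Store (Add (array 0) (V 20)) (V 26))) m1 (digits s) ?R 8 0"
    by (simp add: bind_return_pmf')
qed simp_all

lemma spec_Labels:
  assumes m: "m 0 = n" "m 4 = s" and s: "s \<le> Y ^ 2"
  shows "spec (For 20 (V 0) Label) m (labels s)
    (\<lambda>bid m'. same {20, 21, 26, 27} {0} m m' \<and> (\<forall>j<n. cell m' 0 j = bid j)) 12 0"
proof -
  let ?I = "\<lambda>i bid m'. same {20, 21, 26, 27} {0} m m' \<and> m' 20 = i \<and> (\<forall>j<n. i \<le> j \<longrightarrow> cell m' 0 j = bid j)"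
  have "spec (For 20 (V 0) Label) m
      (countdown n (\<lambda>i bid. map_pmf (\<lambda>v. bid(i := v)) (digits s)) (\<lambda>_. 0)) (?I 0) (Suc (1 + 9)) (n * 0)"
  proof (rule spec_For[where I = ?I])
    fix i bid m' assume i: "i < n" and I: "?I (Suc i) bid m'"
    let ?m = "m'(20 := i)"
    have same: "same {20, 21, 26, 27} {0} m ?m"
      using I by (simp add: same_upd)
    show "spec Label ?m (map_pmf (\<lambda>v. bid(i := v)) (digits s)) (?I i) 9 0"
    proof (rule spec_map[OF spec_Label[where m = ?m and i = i and s = s]])
      show "?m 0 = n" "?m 4 = s" "?m 20 = i"
        using same_scalar[OF same, of 0] same_scalar[OF same, of 4] m by simp_all
      fix v m'' assume *: "same {21, 26, 27} {0} ?m m'' \<and>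
        (\<forall>j<n. cell m'' 0 j = (if j = i then v else cell ?m 0 j))"
      have "same {20, 21, 26, 27} {0} m m''"
        by (rule same_trans[OF conjunct1[OF *] same]) auto
      moreover have "m'' 20 = i"
        using same_scalar[OF conjunct1[OF *], of 20] by simp
      moreover have "cell m'' 0 j = (bid(i := v)) j" if "j < n" "i \<le> j" for j
        using * I that by (cases "j = i") auto
      ultimately show "?I i (bid(i := v)) m''"
        by blast
    qed (use i s in auto)
  qed (use m n_le in \<open>simp_all add: same_upd_refl\<close>)
  then show ?thesis
    unfolding countdown_Pi_pmf_default labels_def by (rule spec_weaken) auto
qed

end

section \<open>Parameters\<close>

primrec log_iter :: "nat \<Rightarrow> nat \<Rightarrow> nat \<Rightarrow> nat" where
  "log_iter N 0 L = L"
| "log_iter N (Suc i) L = log_iter N i (if 2 ^ L < N then Suc L else L)"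

definition log_ceil :: "nat \<Rightarrow> nat" where
  "log_ceil N = log_iter N N 0"

lemma log_iter_countdown:
  "countdown i (\<lambda>_ L. return_pmf (if 2 ^ L < N then Suc L else L)) L = return_pmf (log_iter N i L)"
  by (induction i arbitrary: L) (simp_all add: bind_return_pmf)

text \<open>A gap of \<open>i\<close> is closed in \<open>i\<close> rounds, since each doubling
  raises \<open>2 ^ L\<close> by at least 1.\<close>

lemma log_iter_ge: "N \<le> 2 ^ L + i \<Longrightarrow> N \<le> 2 ^ log_iter N i L"
proof (induction i arbitrary: L)
  case (Suc i)
  have "N \<le> 2 ^ (if 2 ^ L < N then Suc L else L) + i"
  proof (cases "2 ^ L < N")
    case True
    have "1 \<le> (2 :: nat) ^ L"
      by simp
    with Suc.prems have "N \<le> 2 * 2 ^ L + i"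
      by linarith
    with True show ?thesis
      by simp
  qed simp
  then show ?case
    using Suc.IH by simp
qed simp

lemma log_iter_le: "2 ^ L \<le> 2 * N \<Longrightarrow> 2 ^ log_iter N i L \<le> 2 * N"
  by (induction i arbitrary: L) auto

lemma log_ceil: "N \<le> 2 ^ log_ceil N" "1 \<le> N \<Longrightarrow> 2 ^ log_ceil N \<le> 2 * N"
  unfolding log_ceil_def by (rule log_iter_ge, simp) (rule log_iter_le, simp)

text \<open>A constant factor fits into one expression; a variable factor needs the loop
  \<open>Mul\<close>.\<close>

primrec double :: "nat \<Rightarrow> expr \<Rightarrow> expr" where
  "double 0 e = e"
| "double (Suc i) e = Add (double i e) (double i e)"

lemma val_double [simp]: "val m (double i e) = 2 ^ i * val m e"
  by (induction i) auto

definition Log_step :: com where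
  "Log_step = Cond (LessE (V 26) (Add (V 1) (V 2)))
     (Seq (Assign 26 (Add (V 26) (V 26))) (Assign 3 (Add (V 3) (Lit 1)))) Skip"

definition Mul :: "nat \<Rightarrow> nat \<Rightarrow> nat \<Rightarrow> com" where
  "Mul i a b = Seq (Assign i (Lit 0)) (For 20 (V a) (Assign i (Add (V i) (V b))))"

definition Parameters :: com where
  "Parameters = Seq (Assign 3 (Lit 0)) (Seq (Assign 26 (Lit 1)) (Seq (For 20 (Add (V 1) (V 2)) Log_step)
     (Seq (Assign 4 (Add (double 1 (V 3)) (Lit 4)))
     (Seq (Assign 5 (Add (double 3 (V 3)) (Lit 32)))
     (Seq (Mul 6 5 5) (Seq (Assign 6 (double 3 (V 6)))
     (Seq (Mul 7 2 6) (Seq (Assign 7 (double 5 (V 7))) (Mul 8 2 5)))))))))"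

text \<open>
  If \<open>\<lceil>1/\<epsilon>\<rceil> \<le> 1\<close>, the program must not make any query, since \<open>k/\<epsilon>\<close> may be arbitrarily small; but then
  no function is \<open>\<epsilon>\<close>-far from the juntas, because one of the two constants is close to it.
\<close>

definition Tester :: com where
  "Tester = Cond (Sub (V 2) (Lit 1))
     (Seq Parameters (Seq (For 20 (V 0) Label) (Seq Collect_rows
       (Seq (Assign 10 (NotE (V 9))) (Seq (For 20 (V 7) Round) (Assign 0 (V 10)))))))
     (Assign 0 (Lit 1))"

text \<open>A multiple of the logarithm so large that \<open>2 ^ m1\<close> outweighs the at most
  \<open>64 * k * E * m2\<close> row readings of all rounds, and that \<open>E * m1\<close> samples
  rarely miss a disagreement above \<open>\<epsilon> / 2\<close> in any of the \<open>k + 1\<close>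
  epochs.\<close>

definition m1_of :: "nat \<Rightarrow> nat" where
  "m1_of N = 8 * log_ceil N + 32"

text \<open>Chosen so that \<open>m2 / (8 * m1) = m1\<close>: a variable of influence
  \<open>1 / (8 * m1)\<close> escapes \<open>m2\<close> trials with probability at most
  \<open>exp (- m1)\<close>.\<close>

definition m2_of :: "nat \<Rightarrow> nat" where
  "m2_of N = 8 * (m1_of N * m1_of N)"

text \<open>\<open>2 ^ s\<close> is at least \<open>16 * N ^ 2\<close>, so the at most
  \<open>k ^ 2\<close> ordered pairs of relevant variables produce a collision with probability at
  most 1/16.\<close>

definition s_of :: "nat \<Rightarrow> nat" where
  "s_of N = 2 * log_ceil N + 4"

text \<open>In the \<open>k + 1\<close> epochs a sample costs its draw, two queries for the
  comparison and at most \<open>s\<close> for the search. The rounds may meet \<open>k + 1\<close>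
  rows, as they run even if the verdict is already negative. The 5 is one draw and two final queries
  in each of two checks.\<close>

definition query_bound :: "nat \<Rightarrow> nat \<Rightarrow> nat" where
  "query_bound k E = (let N = k + E in Suc k * (E * m1_of N * (s_of N + 3)) +
     32 * (E * m2_of N) * (Suc k * (4 * m1_of N) + Suc k * (4 * m2_of N) + 5))"

context ram
begin

lemma spec_Mul:
  assumes "m a = A" "m b = B" "A \<le> Y ^ 7" "i \<notin> {20, a, b}" "b \<noteq> 20" "i < 40"
  shows "spec (Mul i a b) m (return_pmf ()) (\<lambda>_ m'. same {i, 20} {} m m' \<and> m' i = A * B) 9 0"
  unfolding Mul_def
proof (rule spec_then'[OF spec_Set])
  fix m1 assume 1: "m1 = m(i := val m (Lit 0))"
  let ?I = "\<lambda>j (_ :: unit) m'. same {i, 20} {} m1 m' \<and> m' 20 = j \<and> m' b = B \<and> m' i = (A - j) * B"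
  have "spec (For 20 (V a) (Assign i (Add (V i) (V b)))) m1 (countdown A (\<lambda>_ _. return_pmf ()) ()) (?I 0)
      (Suc (7 + 0)) (A * 0)"
  proof (rule spec_For[where I = ?I])
    fix j m' and u :: unit assume j: "j < A" and I: "?I (Suc j) u m'"
    have "B + (A - Suc j) * B = (A - j) * B"
      using j by (metis Suc_diff_Suc mult_Suc)
    then show "spec (Assign i (Add (V i) (V b))) (m'(20 := j)) (return_pmf ()) (?I j) 0 0"
      using I assms(4-6) by (intro spec_Set') (simp add: same_upd add.commute)
  qed (use assms 1 in \<open>simp_all add: same_upd\<close>)
  then show "spec (For 20 (V a) (Assign i (Add (V i) (V b)))) m1 (return_pmf ())
      (\<lambda>_ m'. same {i, 20} {} m m' \<and> m' i = A * B) 8 0"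
    unfolding countdown_unit
  proof (rule spec_weaken)
    fix u m' assume "?I 0 u m'"
    then show "same {i, 20} {} m m' \<and> m' i = A * B"
      using same_trans[of "{i, 20}" "{}" m1 m' "{i, 20}" "{}" m] assms(6)
      unfolding 1 by (simp add: same_upd_refl)
  qed simp_all
qed simp_all

lemma spec_Log:
  assumes "m 1 = k" "m 2 = E" "k + E \<le> Y" "m 3 = 0" "m 26 = 1"
  shows "spec (For 20 (Add (V 1) (V 2)) Log_step) m (return_pmf (log_ceil (k + E)))
    (\<lambda>L m'. same {3, 19, 20, 26} {} m m' \<and> m' 3 = L) 5 0"
proof -
  let ?N = "k + E"
  let ?I = "\<lambda>j L m'. same {3, 19, 20, 26} {} m m' \<and> m' 20 = j \<and> m' 3 = L \<and> m' 26 = 2 ^ L"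
  have "spec (For 20 (Add (V 1) (V 2)) Log_step) m
    (countdown ?N (\<lambda>_ L. return_pmf (if 2 ^ L < ?N then Suc L else L)) 0) (?I 0) (Suc (1 + 2)) (?N * 0)"
  proof (rule spec_For[where I = ?I])
    fix j L m' assume I: "?I (Suc j) L m'"
    define \<mu> where "\<mu> = m'(20 := j)"
    have s: "same {3, 19, 20, 26} {} m \<mu>"
      unfolding \<mu>_def using I by (simp add: same_upd)
    have \<mu>: "\<mu> 1 = k" "\<mu> 2 = E" "\<mu> 20 = j" "\<mu> 3 = L" "\<mu> 26 = 2 ^ L"
      using I assms same_scalar[OF s, of 1] same_scalar[OF s, of 2] by (simp_all add: \<mu>_def)
    let ?p = "return_pmf (if 2 ^ L < ?N then Suc L else L)"
    have "spec Log_step \<mu> ?p (?I j) (Suc 1) 0"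
      unfolding Log_step_def
    proof (rule spec_Cond)
      assume "val \<mu> (LessE (V 26) (Add (V 1) (V 2))) \<noteq> 0"
      then have L: "2 ^ L < ?N"
        using \<mu> by (auto split: if_splits)
      show "spec (Seq (Assign 26 (Add (V 26) (V 26))) (Assign 3 (Add (V 3) (Lit 1)))) \<mu> ?p (?I j) 1 0"
      proof (rule spec_then'[OF spec_Set])
        fix m2 assume 2: "m2 = \<mu>(26 := val \<mu> (Add (V 26) (V 26)))"
        show "spec (Assign 3 (Add (V 3) (Lit 1))) m2 ?p (?I j) 0 0"
          using L \<mu> unfolding 2 by (intro spec_Set') (simp add: same_upd s)
      qed simp_all
    next
      assume "val \<mu> (LessE (V 26) (Add (V 1) (V 2))) = 0"
      then have L: "\<not> 2 ^ L < ?N"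
        using \<mu> by (auto split: if_splits)
      have "?I j (if 2 ^ L < ?N then Suc L else L) (\<mu>(19 := val \<mu> (Lit 0)))"
        using L \<mu> by (simp add: same_upd s)
      then show "spec Skip \<mu> ?p (?I j) 1 0"
        by (intro spec_weaken[OF spec_Set'[where R = "?I j"]]) auto
    qed
    then show "spec Log_step (m'(20 := j)) ?p (?I j) 2 0"
      unfolding \<mu>_def[symmetric] by (rule spec_weaken) simp_all
  qed (use assms in \<open>simp_all add: same_upd_refl\<close>)
  then show ?thesis
    unfolding log_iter_countdown log_ceil_def by (rule spec_weaken) auto
qed

lemma spec_Parameters:
  assumes m: "m 0 = n" "m 1 = k" "m 2 = E" and le: "E \<le> Y" "k + E \<le> Y" "m1_of (k + E) \<le> Y ^ 7"
  shows "spec Parameters m (return_pmf ()) (\<lambda>_ m'. m' 0 = n \<and> m' 1 = k \<and> m' 4 = s_of (k + E) \<and>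
    m' 5 = m1_of (k + E) \<and> m' 6 = m2_of (k + E) \<and> m' 7 = 32 * (E * m2_of (k + E)) \<and>
    m' 8 = E * m1_of (k + E)) 30 0"
  (is "spec _ _ _ ?R _ _")
  unfolding Parameters_def
proof (rule spec_then'[OF spec_Set])
  let ?P1 = "Seq (Assign 7 (double 5 (V 7))) (Mul 8 2 5)"
  let ?P2 = "Seq (Mul 7 2 6) ?P1"
  let ?P3 = "Seq (Assign 6 (double 3 (V 6))) ?P2"
  let ?P4 = "Seq (Mul 6 5 5) ?P3"
  let ?P5 = "Seq (Assign 5 (Add (double 3 (V 3)) (Lit 32))) ?P4"
  let ?P6 = "Seq (Assign 4 (Add (double 1 (V 3)) (Lit 4))) ?P5"
  let ?P7 = "Seq (For 20 (Add (V 1) (V 2)) Log_step) ?P6"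
  let ?P8 = "Seq (Assign 26 (Lit 1)) ?P7"
  let ?L = "log_ceil (k + E)"
  have E: "E \<le> Y ^ 7"
    using le(1) Y self_le_power[of Y 7] by simp
  fix ma assume a: "ma = m(3 := val m (Lit 0))"
  show "spec ?P8 ma (return_pmf ()) ?R 29 0"
  proof (rule spec_then'[OF spec_Set])
    fix mb assume b: "mb = ma(26 := val ma (Lit 1))"
    have mb: "mb 0 = n" "mb 1 = k" "mb 2 = E" "mb 3 = 0" "mb 26 = 1"
      unfolding b a using m by simp_all
    show "spec ?P7 mb (return_pmf ()) ?R 28 0"
    proof (rule spec_then'[OF spec_Log[where m = mb, OF mb(2,3) le(2) mb(4,5)]])
      fix mc assume c: "same {3, 19, 20, 26} {} mb mc \<and> mc 3 = ?L"
      have mc: "mc 0 = n" "mc 1 = k" "mc 2 = E" "mc 3 = ?L"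
        using mb c by (simp_all add: same_scalar[OF conjunct1[OF c]])
      show "spec ?P6 mc (return_pmf ()) ?R 27 0"
      proof (rule spec_then'[OF spec_Set])
        fix md assume d: "md = mc(4 := val mc (Add (double 1 (V 3)) (Lit 4)))"
        show "spec ?P5 md (return_pmf ()) ?R 26 0"
        proof (rule spec_then'[OF spec_Set])
          fix me assume e: "me = md(5 := val md (Add (double 3 (V 3)) (Lit 32)))"
          have me: "me 0 = n" "me 1 = k" "me 2 = E" "me 4 = s_of (k + E)" "me 5 = m1_of (k + E)"
            unfolding e d using mc by (simp_all add: s_of_def m1_of_def)
          show "spec ?P4 me (return_pmf ()) ?R 25 0"
          proof (rule spec_then'[OF spec_Mul[where m = me, OF me(5,5) le(3)]])
            fix mf assume f: "same {6, 20} {} me mf \<and> mf 6 = m1_of (k + E) * m1_of (k + E)"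
            show "spec ?P3 mf (return_pmf ()) ?R 24 0"
            proof (rule spec_then'[OF spec_Set])
              fix mg assume g: "mg = mf(6 := val mf (double 3 (V 6)))"
              have mg: "mg 0 = n" "mg 1 = k" "mg 2 = E" "mg 4 = s_of (k + E)" "mg 5 = m1_of (k + E)"
                "mg 6 = m2_of (k + E)"
                unfolding g using me f by (simp_all add: same_scalar[OF conjunct1[OF f]] m2_of_def)
              show "spec ?P2 mg (return_pmf ()) ?R 23 0"
              proof (rule spec_then'[OF spec_Mul[where m = mg, OF mg(3,6) E]])
                fix mh assume h: "same {7, 20} {} mg mh \<and> mh 7 = E * m2_of (k + E)"
                show "spec ?P1 mh (return_pmf ()) ?R 22 0"
                proof (rule spec_then'[OF spec_Set])
                  fix mi assume i: "mi = mh(7 := val mh (double 5 (V 7)))"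
                  have mi: "mi 0 = n" "mi 1 = k" "mi 2 = E" "mi 4 = s_of (k + E)" "mi 5 = m1_of (k + E)"
                    "mi 6 = m2_of (k + E)" "mi 7 = 32 * (E * m2_of (k + E))"
                    unfolding i using mg h by (simp_all add: same_scalar[OF conjunct1[OF h]])
                  show "spec (Mul 8 2 5) mi (return_pmf ()) ?R 9 0"
                  proof (rule spec_weaken[OF spec_Mul[where m = mi, OF mi(3,5) E] order_refl order_refl])
                    fix u m' assume m': "same {8, 20} {} mi m' \<and> m' 8 = E * m1_of (k + E)"
                    then show "?R u m'"
                      using mi by (simp add: same_scalar[OF conjunct1[OF m']])
                  qed simp_all
                qed simp_all
              qed simp_all
            qed simp_all
          qed simp_all
        qed simp_all
      qed simp_all
    qed simp_all
  qed simp_all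
qed simp_all

lemma spec_Rounds:
  assumes m: "m 0 = n" "m 5 = N1" "m 6 = N2" "m 7 = M" and c: "collected m' bid (rs, a) m"
    and le: "N1 \<le> Y ^ 6" "N2 \<le> Y ^ 6" "length rs \<le> Y" "M \<le> Y ^ 7" and ok: "(m 10 \<noteq> 0) = ok"
  shows "spec (For 20 (V 7) Round) m
    (countdown M (\<lambda>_ ok. map_pmf (\<lambda>r. ok \<and> r) (test_round N1 N2 rs)) ok)
    (\<lambda>ok m'. (m' 10 \<noteq> 0) = ok) 50 (M * (length rs * (4 * N1) + length rs * (4 * N2) + 5))"
proof -
  let ?S = "{20, 28} \<union> check_cells" and ?A = "{2, 3, 4, 5, 6}"
  let ?I = "\<lambda>j ok m'. same ?S ?A m m' \<and> m' 20 = j \<and> (m' 10 \<noteq> 0) = ok"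
  have cm: "m 11 = length rs" "m 12 = 40 + (7 + 2 * length rs) * n" "stored m rs" "holds m 1 (found rs)"
    using c by (simp_all add: collected_def ready_def)
  have "spec (For 20 (V 7) Round) m
    (countdown M (\<lambda>_ ok. map_pmf (\<lambda>r. ok \<and> r) (test_round N1 N2 rs)) ok) (?I 0) (Suc (7 + 40))
    (M * (length rs * (4 * N1) + length rs * (4 * N2) + 5))"
  proof (rule spec_For[where I = ?I])
    fix j ok m' assume I: "?I (Suc j) ok m'"
    define \<mu> where "\<mu> = m'(20 := j)"
    have s: "same ?S ?A m \<mu>"
      unfolding \<mu>_def using I by (simp add: same_upd)
    have j: "\<mu> 20 = j" "(\<mu> 10 \<noteq> 0) = ok"
      using I by (simp_all add: \<mu>_def)
    have "spec Round \<mu> (map_pmf (\<lambda>r. ok \<and> r) (test_round N1 N2 rs)) (?I j) 40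
        (length rs * (4 * N1) + length rs * (4 * N2) + 5)"
    proof (rule spec_map[OF spec_Round[where m = \<mu>, OF _ _ _ _ _ le(1-3) _ _ j(2)]])
      show "\<mu> 0 = n" "\<mu> 5 = N1" "\<mu> 6 = N2" "\<mu> 11 = length rs" "\<mu> 12 = 40 + (7 + 2 * length rs) * n"
        "holds \<mu> 1 (found rs)" "stored \<mu> rs"
        using m cm stored_same[OF s] by (simp_all add: same_facts[OF s])
      fix r m'' assume *: "same ({28} \<union> check_cells) {2, 3, 4, 5, 6} \<mu> m'' \<and> (m'' 10 \<noteq> 0) = (ok \<and> r)"
      have "same ?S ?A m m''"
        by (rule same_trans[OF conjunct1[OF *] s]) auto
      moreover have "m'' 20 = j"
        using j(1) by (simp add: same_scalar[OF conjunct1[OF *]])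
      ultimately show "?I j (ok \<and> r) m''"
        using * by blast
    qed
    then show "spec Round (m'(20 := j)) (map_pmf (\<lambda>r. ok \<and> r) (test_round N1 N2 rs)) (?I j) 40
        (length rs * (4 * N1) + length rs * (4 * N2) + 5)"
      by (simp add: \<mu>_def)
  qed (use m le ok in \<open>simp_all add: same_upd_refl\<close>)
  then show ?thesis
    by (rule spec_weaken) auto
qed

lemma spec_Tester:
  assumes m: "m 0 = n" "m 1 = k" "m 2 = E"
    and le: "E \<le> Y" "k + E \<le> Y" "Suc k \<le> Y" "m1_of (k + E) \<le> Y ^ 2" "m2_of (k + E) \<le> Y ^ 5"
      "s_of (k + E) \<le> Y ^ 2"
  shows "spec Tester m (if 1 < E then algorithm k (s_of (k + E)) (E * m1_of (k + E))
      (32 * (E * m2_of (k + E))) (m1_of (k + E)) (m2_of (k + E)) else return_pmf True)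
    (\<lambda>ok m'. (m' 0 \<noteq> 0) = ok) 100 (if 1 < E then query_bound k E else 0)"
proof -
  let ?P1 = "Seq (For 20 (V 7) Round) (Assign 0 (V 10))"
  let ?P2 = "Seq (Assign 10 (NotE (V 9))) ?P1"
  let ?P3 = "Seq Collect_rows ?P2"
  let ?P4 = "Seq (For 20 (V 0) Label) ?P3"
  let ?P5 = "Seq Parameters ?P4"
  let ?N = "k + E"
  let ?s = "s_of ?N" and ?T = "E * m1_of ?N" and ?M = "32 * (E * m2_of ?N)" and ?N1 = "m1_of ?N" and ?N2 = "m2_of ?N"
  let ?R = "\<lambda>ok m'. (m' 0 \<noteq> 0) = ok" and ?A = "algorithm k ?s ?T ?M ?N1 ?N2"
  let ?QR = "Suc k * (4 * ?N1) + Suc k * (4 * ?N2) + 5"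
  have N1: "?N1 \<le> Y ^ 6" "?N1 \<le> Y ^ 7"
    using le(4) Y_power_mono[of 2 6] Y_power_mono[of 2 7] by linarith+
  have N2: "?N2 \<le> Y ^ 6"
    using le(5) Y_power_mono[of 5 6] by linarith
  have "?T \<le> Y * Y ^ 2"
    using le by (intro mult_mono) auto
  also have "\<dots> = Y ^ 3"
    by (simp add: power_numeral_reduce)
  also have "\<dots> \<le> Y ^ 6"
    by (rule Y_power_mono) simp
  finally have T: "?T \<le> Y ^ 6" .
  have "?M \<le> Y * (Y * Y ^ 5)"
    using le Y by (intro mult_mono) auto
  then have M: "?M \<le> Y ^ 7"
    by (simp add: power_numeral_reduce)
  have main: "spec ?P5 m ?A ?R 99 (query_bound k E)"
  proof (rule spec_then'[OF spec_Parameters[where m = m, OF m le(1,2) N1(2)]])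
    fix ma :: mem
    assume a: "ma 0 = n \<and> ma 1 = k \<and> ma 4 = ?s \<and> ma 5 = ?N1 \<and> ma 6 = ?N2 \<and> ma 7 = ?M \<and> ma 8 = ?T"
    show "spec ?P4 ma ?A ?R 98 (query_bound k E)"
      unfolding algorithm_def
    proof (rule spec_Seq'[OF spec_Labels[where m = ma and s = ?s]])
      fix bid mb assume b: "same {20, 21, 26, 27} {0} ma mb \<and> (\<forall>j<n. cell mb 0 j = bid j)"
      have mb: "mb 0 = n" "mb 1 = k" "mb 4 = ?s" "mb 5 = ?N1" "mb 6 = ?N2" "mb 7 = ?M" "mb 8 = ?T"
        using a by (simp_all add: same_scalar[OF conjunct1[OF b]])
      show "spec ?P3 mb
         (bind_pmf (collect bid ?s ?T k) (decide ?M ?N1 ?N2)) ?R 97 (query_bound k E)"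
      proof (rule spec_Seq'[OF spec_Collect[where m = mb, OF mb(1,2,3,7)]])
        fix st mc assume st: "st \<in> set_pmf (collect bid ?s ?T k)"
          and c: "same ({9, 11, 12, 15, 16, 20, 21} \<union> search_cells) (- {0}) mb mc \<and> collected mc bid st mc"
        obtain rs f where [simp]: "st = (rs, f)" by (cases st)
        have len: "length rs \<le> Suc k"
          using set_collect[OF st] by (auto split: if_splits)
        have mc: "mc 0 = n" "mc 5 = ?N1" "mc 6 = ?N2" "mc 7 = ?M"
          using mb by (simp_all add: same_scalar[OF conjunct1[OF c]])
        have f: "(mc 9 \<noteq> 0) = f"
          using c by (simp add: collected_def)
        show "spec ?P2 mc
            (decide ?M ?N1 ?N2 st) ?R 60 (?M * ?QR)"
        proof (rule spec_then'[OF spec_Set])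
          fix md assume d: "md = mc(10 := val mc (NotE (V 9)))"
          have md: "md 0 = n" "md 5 = ?N1" "md 6 = ?N2" "md 7 = ?M" "(md 10 \<noteq> 0) = (\<not> f)"
            unfolding d using mc f by simp_all
          have cd: "collected md bid (rs, f) md"
            using c unfolding d by (simp add: collected_def ready_def stored_def)
          have rounds: "spec (For 20 (V 7) Round) md
              (decide ?M ?N1 ?N2 st) (\<lambda>ok m'. (m' 10 \<noteq> 0) = ok) 50
              (?M * (length rs * (4 * ?N1) + length rs * (4 * ?N2) + 5))"
            using spec_Rounds[where m = md, OF md(1-4) cd N1(1) N2 _ M md(5)] len le(3)
            by (simp add: decide_def)
          have "spec ?P1 md
              (bind_pmf (decide ?M ?N1 ?N2 st) return_pmf) ?R 55 (?M * ?QR)"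
          proof (rule spec_Seq'[OF rounds])
            fix ok and m' :: mem assume "(m' 10 \<noteq> 0) = ok"
            then show "spec (Assign 0 (V 10)) m' (return_pmf ok) ?R 0 0"
              by (intro spec_Set') simp
          next
            show "?M * (length rs * (4 * ?N1) + length rs * (4 * ?N2) + 5) + 0 \<le> ?M * ?QR"
              unfolding add_0_right using len by (intro mult_mono add_mono) auto
          qed simp_all
          then show "spec ?P1 md
              (decide ?M ?N1 ?N2 st) ?R 55 (?M * ?QR)"
            by (simp add: bind_return_pmf')
        qed simp_all
      qed (use b le T in \<open>simp_all add: query_bound_def Let_def\<close>)
    qed (use a le in simp_all)
  qed simp_all
  have "spec Tester m (if 1 < E then ?A else return_pmf True) ?R (Suc 99) (if 1 < E then query_bound k E else 0)"
    unfolding Tester_def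
  proof (rule spec_Cond)
    assume "val m (Sub (V 2) (Lit 1)) \<noteq> 0"
    then have "1 < E"
      using m by simp
    then show "spec ?P5 m (if 1 < E then ?A else return_pmf True) ?R 99 (if 1 < E then query_bound k E else 0)"
      using main by simp
  next
    assume "val m (Sub (V 2) (Lit 1)) = 0"
    then have E: "\<not> 1 < E"
      using m by simp
    have "spec (Assign 0 (Lit 1)) m (return_pmf True) ?R 0 0"
      by (rule spec_Set') simp
    then show "spec (Assign 0 (Lit 1)) m (if 1 < E then ?A else return_pmf True) ?R 99
        (if 1 < E then query_bound k E else 0)"
      using E by (auto intro: spec_weaken)
  qed
  then show ?thesis by simp
qed

end

section \<open>The theorem\<close>

lemma power2_le_power2: "((L + 4) * (L + 4) :: nat) \<le> 2 ^ (2 * L + 8)"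
proof -
  have "L + 4 \<le> 2 ^ (L + 4)"
    using less_exp[of "L + 4"] by simp
  then have "(L + 4) * (L + 4) \<le> 2 ^ (L + 4) * 2 ^ (L + 4)"
    by (rule mult_mono) auto
  also have "\<dots> = (2 :: nat) ^ (2 * L + 8)"
    unfolding power_add[symmetric] by (rule arg_cong[where f = "(^) 2"]) simp
  finally show ?thesis .
qed

lemma exp_minus_le: "exp (- real i) \<le> 1 / 2 ^ i"
proof -
  have "2 ^ i \<le> exp (1 :: real) ^ i"
    using exp_ge_add_one_self[of 1] by (intro power_mono) auto
  also have "\<dots> = exp (real i)"
    by (simp add: exp_of_nat_mult[symmetric])
  finally have "1 / exp (real i) \<le> 1 / 2 ^ i"
    by (intro divide_left_mono) auto
  then show ?thesis
    by (simp add: exp_minus inverse_eq_divide)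
qed

context junta_algorithm
begin

lemma numeric_completeness:
  assumes f: "f \<in> juntas n k" and k: "1 \<le> k" "1 \<le> E"
  defines "N \<equiv> k + E"
  shows "2 / 3 \<le> pmf (algorithm k (s_of N) (E * m1_of N) (32 * (E * m2_of N)) (m1_of N) (m2_of N)) True"
proof -
  define L where "L = log_ceil N"
  have N: "N \<le> 2 ^ L"
    unfolding L_def by (rule log_ceil)
  have kL: "k \<le> 2 ^ L" and EL: "E \<le> 2 ^ L"
    using N unfolding N_def by linarith+
  have m1: "m1_of N = 8 * (L + 4)"
    by (simp add: m1_of_def L_def)
  have "1 \<le> m1_of N"
    by (simp add: m1_of_def)
  then have m12: "m1_of N \<le> m2_of N"
    unfolding m2_of_def by simp
  have collide: "(real k)\<^sup>2 / 2 ^ s_of N \<le> 1 / 16"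
  proof -
    have "real k \<le> real (2 ^ L)"
      using kL by (simp only: of_nat_le_iff)
    then have "(real k)\<^sup>2 \<le> (2 ^ L)\<^sup>2"
      by (intro power_mono) simp_all
    then have "(real k)\<^sup>2 / 2 ^ s_of N \<le> (2 ^ L)\<^sup>2 / 2 ^ (2 * L + 4)"
      by (simp add: s_of_def L_def divide_right_mono)
    also have "\<dots> = 1 / 16"
      by (simp add: power_add power_mult[symmetric] mult.commute)
    finally show ?thesis .
  qed
  have missed: "real (32 * (E * m2_of N)) * (2 * real k * (1 / 2) ^ m1_of N) \<le> 1 / 512"
  proof -
    have "32 * (E * m2_of N) * (2 * k) = 512 * (E * k * (64 * ((L + 4) * (L + 4))))"
      by (simp add: m2_of_def m1 algebra_simps)
    also have "\<dots> \<le> 512 * (2 ^ L * 2 ^ L * (64 * 2 ^ (2 * L + 8)))"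
      by (intro mult_mono power2_le_power2 kL EL) auto
    also have "\<dots> = 2 ^ (4 * L + 23)"
    proof -
      have "(2 :: nat) ^ (4 * L + 23) = 2 ^ 9 * (2 ^ L * 2 ^ L * (2 ^ 6 * 2 ^ (2 * L + 8)))"
        unfolding power_add[symmetric] by (rule arg_cong[where f = "(^) 2"]) simp
      then show ?thesis by simp
    qed
    \<comment> \<open>The exponent is raised only to cancel against \<open>m1 = 8 * L + 32\<close>,
      which leaves \<open>2 ^ (-9)\<close>.\<close>
    also have "\<dots> \<le> (2 :: nat) ^ (8 * L + 23)"
      by (rule power_increasing) auto
    finally have "real (32 * (E * m2_of N) * (2 * k)) \<le> real (2 ^ (8 * L + 23))"
      by (simp only: of_nat_le_iff)
    then have "real (32 * (E * m2_of N)) * (2 * real k) \<le> 2 ^ (8 * L + 23)"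
      by simp
    then have "real (32 * (E * m2_of N)) * (2 * real k) * (1 / 2) ^ m1_of N \<le> 2 ^ (8 * L + 23) * (1 / 2) ^ m1_of N"
      by (rule mult_right_mono) simp
    also have "\<dots> = 1 / 512"
      by (simp add: m1 power_add power_one_over field_simps)
    finally show ?thesis
      by (simp add: mult.assoc)
  qed
  have "pmf (algorithm k (s_of N) (E * m1_of N) (32 * (E * m2_of N)) (m1_of N) (m2_of N)) False \<le> 1 / 16 + 1 / 512"
    using completeness[OF f m12, of "s_of N" "E * m1_of N" "32 * (E * m2_of N)"] collide missed by linarith
  then show ?thesis
    by (simp add: pmf_True_eq)
qed

lemma numeric_soundness:
  assumes far: "eps_far D \<epsilon> (juntas n k) f" and k: "1 \<le> k" and E: "2 \<le> E" and \<epsilon>: "0 < \<epsilon>" "\<epsilon> \<le> 1" "1 \<le> \<epsilon> * real E"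
  defines "N \<equiv> k + E"
  shows "2 / 3 \<le> pmf (algorithm k (s_of N) (E * m1_of N) (32 * (E * m2_of N)) (m1_of N) (m2_of N)) False"
proof -
  define L where "L = log_ceil N"
  have N: "N \<le> 2 ^ L"
    unfolding L_def by (rule log_ceil)
  have kL: "Suc k \<le> 2 ^ L"
    using N E unfolding N_def by linarith
  let ?m = "m1_of N" and ?T = "E * m1_of N" and ?M = "32 * (E * m2_of N)"
  have m1: "?m = 8 * L + 32"
    by (simp add: m1_of_def L_def)
  have m0: "1 \<le> real ?m"
    by (simp add: m1)
  have "real (Suc k) \<le> real (2 ^ L)"
    using kL by (simp only: of_nat_le_iff)
  then have kr: "real (Suc k) \<le> 2 ^ L"
    by simp
  have m2: "real k * (1 - 1 / (8 * real ?m)) ^ m2_of N \<le> 1 / 2"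
  proof -
    have "(1 - 1 / (8 * real ?m)) ^ m2_of N \<le> exp (- (1 / (8 * real ?m) * real (m2_of N)))"
      by (rule one_minus_power_le_exp) (use m0 in \<open>simp add: field_simps\<close>)
    also have "1 / (8 * real ?m) * real (m2_of N) = real ?m"
      using m0 by (simp add: m2_of_def)
    also have "exp (- real ?m) \<le> 1 / 2 ^ ?m"
      by (rule exp_minus_le)
    also have "(1 :: real) / 2 ^ ?m \<le> 1 / 2 ^ (L + 1)"
      by (intro divide_left_mono power_increasing) (auto simp: m1)
    finally have "(1 - 1 / (8 * real ?m)) ^ m2_of N \<le> 1 / 2 ^ (L + 1)" .
    moreover have "0 \<le> 1 - 1 / (8 * real ?m)"
      using m0 by (simp add: field_simps)
    moreover have "real k \<le> 2 ^ L"
      using kr unfolding of_nat_Suc by linarith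
    ultimately have "real k * (1 - 1 / (8 * real ?m)) ^ m2_of N \<le> 2 ^ L * (1 / 2 ^ (L + 1))"
      by (intro mult_mono zero_le_power) simp_all
    then show ?thesis by simp
  qed
  define \<rho> where "\<rho> = min (\<epsilon> / 4) (1 / (128 * real ?m ^ 2))"
  have \<rho>: "\<rho> \<le> \<epsilon> / 4" "\<rho> \<le> 1 / (128 * real ?m ^ 2)" "0 \<le> \<rho>" "\<rho> \<le> 1"
    using \<epsilon> by (auto simp: \<rho>_def)
  have M: "real ?M = 256 * real E * real ?m ^ 2"
    by (simp add: m2_of_def power2_eq_square)
  \<comment> \<open>\<open>M = 256 E m1^2\<close> serves both values of \<rho>: the first gives
    \<open>64 \<epsilon> E m1^2\<close>, which is at least 64, the second gives \<open>2 E\<close>,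
    which is at least 4.\<close>
  have "4 \<le> \<rho> * real ?M"
  proof (cases "\<rho> = \<epsilon> / 4")
    case True
    have "1 * 1 \<le> (\<epsilon> * real E) * real ?m ^ 2"
      using \<epsilon>(3) m0 by (intro mult_mono) auto
    then show ?thesis
      unfolding M True by simp
  next
    case False
    then have "\<rho> = 1 / (128 * real ?m ^ 2)"
      by (auto simp: \<rho>_def min_def split: if_splits)
    then show ?thesis
      unfolding M using m0 E by simp
  qed
  then have "exp (- (\<rho> * real ?M)) \<le> exp (- real 4)"
    by simp
  with one_minus_power_le_exp[OF \<rho>(4), of ?M] have "(1 - \<rho>) ^ ?M \<le> exp (- real 4)"
    by (rule order_trans)
  also have "\<dots> \<le> 1 / 2 ^ 4"
    by (rule exp_minus_le)
  finally have rounds: "(1 - \<rho>) ^ ?M \<le> 1 / 16"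
    by simp
  have "(1 - \<epsilon> / 2) ^ ?T \<le> exp (- (\<epsilon> / 2 * real ?T))"
    by (rule one_minus_power_le_exp) (use \<epsilon> in simp)
  also have "\<dots> \<le> exp (- real (4 * L + 16))"
  proof -
    \<comment> \<open>As \<open>\<epsilon> E \<ge> 1\<close>, half of \<open>m1\<close> survives in
      the exponent.\<close>
    have "1 * real ?m \<le> (\<epsilon> * real E) * real ?m"
      using \<epsilon>(3) by (intro mult_right_mono) auto
    then show ?thesis
      by (simp add: m1 algebra_simps)
  qed
  also have "\<dots> \<le> 1 / 2 ^ (4 * L + 16)"
    by (rule exp_minus_le)
  also have "(1 :: real) / 2 ^ (4 * L + 16) \<le> 1 / 2 ^ (L + 4)"
    by (intro divide_left_mono power_increasing) auto
  finally have "real (Suc k) * (1 - \<epsilon> / 2) ^ ?T \<le> 2 ^ L * (1 / 2 ^ (L + 4))"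
    using kr \<epsilon> by (intro mult_mono) auto
  then have collect: "real (Suc k) * (1 - \<epsilon> / 2) ^ ?T \<le> 1 / 16"
    by (simp add: power_add)
  have "pmf (algorithm k (s_of N) ?T ?M ?m (m2_of N)) True \<le> 1 / 16 + 1 / 16"
    using soundness[OF far _ _ _ m2 \<rho>(1-3), of "s_of N" ?T ?M] \<epsilon> m0 rounds collect by linarith
  then show ?thesis
    by (simp add: pmf_True_eq)
qed

end

text \<open>Outside the logarithms \<open>k\<close> and \<open>E\<close> occur as a product; inside,
  \<open>k + E \<le> 2 * k * E\<close> reduces their sum to that product, hence to
  \<open>k / \<epsilon>\<close>. The fourth power of the logarithm stems from about
  \<open>E * m2\<close> rounds with \<open>m2\<close> trials per flag, each \<open>m2\<close> being
  quadratic in it.\<close>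

lemma query_bound_le:
  assumes k: "1 \<le> k" and \<epsilon>: "0 < \<epsilon>" "\<epsilon> \<le> 1" and E: "1 \<le> E" "real E \<le> 2 / \<epsilon>"
  shows "real (query_bound k E) \<le> 2 ^ 41 * (real k / \<epsilon>) * log 2 (real k / \<epsilon> + 2) ^ 4"
proof -
  define T where "T = real k / \<epsilon>"
  define l where "l = log 2 (T + 2)"
  define L where "L = log_ceil (k + E)"
  have kE: "real k * real E \<le> 2 * T"
    using mult_left_mono[OF E(2), of "real k"] by (simp add: T_def mult.commute)
  have "1 * 1 \<le> real k / \<epsilon>"
    using k \<epsilon> by (simp add: field_simps)
  then have T: "1 \<le> T"
    by (simp add: T_def)
  have l: "1 \<le> l"
    unfolding l_def using T log_mono[of 2 2 "T + 2"] by simp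
  have L: "real L \<le> 4 * l"
  proof -
    have "k * 1 \<le> k * E" "1 * E \<le> k * E"
      using k E(1) by (intro mult_le_mono; simp)+
    then have "k + E \<le> 2 * (k * E)"
      by linarith
    moreover have "2 ^ L \<le> 2 * (k + E)"
      unfolding L_def by (rule log_ceil(2)) (use k in simp)
    moreover have "2 * (k + E) \<le> 4 * (k * E)" if "k + E \<le> 2 * (k * E)"
      using that by simp
    ultimately have "2 ^ L \<le> 4 * (k * E)"
      using order_trans by blast
    then have "real (2 ^ L) \<le> real (4 * (k * E))"
      by (simp only: of_nat_le_iff)
    then have "2 ^ L \<le> 8 * T"
      using kE by simp
    also have "\<dots> \<le> 8 * (T + 2)"
      by simp
    finally have "log 2 (2 ^ L) \<le> log 2 (2 ^ 3 * (T + 2))"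
      using T by (intro log_mono) auto
    also have "\<dots> = 3 + l"
      unfolding l_def using T log_pow_cancel[of 2 3] by (subst log_mult) auto
    finally show ?thesis
      using l by simp
  qed
  have m1: "real (m1_of (k + E)) \<le> 64 * l"
    using L l by (simp add: m1_of_def L_def)
  have m2: "real (m2_of (k + E)) \<le> 2 ^ 15 * l ^ 2"
  proof -
    have "real (m2_of (k + E)) = 8 * (real (m1_of (k + E)) * real (m1_of (k + E)))"
      by (simp add: m2_of_def)
    also have "\<dots> \<le> 8 * ((64 * l) * (64 * l))"
      using m1 by (intro mult_left_mono mult_mono) auto
    finally show ?thesis
      by (simp add: power2_eq_square)
  qed
  have s: "real (s_of (k + E)) + 3 \<le> 15 * l"
    using L l by (simp add: s_of_def L_def)
  have K: "real (Suc k) \<le> 2 * real k"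
    using k by simp
  have lp: "l ^ i \<le> l ^ 4" if "i \<le> 4" for i
    using l that by (rule power_increasing[rotated])
  have ll: "l \<le> l ^ 2" "1 \<le> l ^ 2"
    using l power_increasing[of 1 2 l] power_increasing[of 0 2 l] by simp_all
  have "real (query_bound k E) = real (Suc k) * (real E * real (m1_of (k + E)) * (real (s_of (k + E)) + 3)) +
      32 * (real E * real (m2_of (k + E))) *
        (real (Suc k) * (4 * real (m1_of (k + E))) + real (Suc k) * (4 * real (m2_of (k + E))) + 5)"
    unfolding query_bound_def Let_def by (simp only: of_nat_add of_nat_mult of_nat_numeral mult.assoc)
  \<comment> \<open>The additive 5 is inflated by \<open>k * l ^ 2 \<ge> 1\<close>, so that
    \<open>k * E\<close> becomes a common factor.\<close>
  also have "\<dots> \<le> (2 * real k) * (real E * (64 * l) * (15 * l)) +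
      32 * (real E * (2 ^ 15 * l ^ 2)) *
        ((2 * real k) * (4 * (64 * l ^ 2)) + (2 * real k) * (4 * (2 ^ 15 * l ^ 2)) + 5 * (real k * l ^ 2))"
  proof (intro add_mono mult_mono K m1 m2 s)
    show "real (m1_of (k + E)) \<le> 64 * l ^ 2"
      using m1 ll by linarith
    have "1 * 1 \<le> real k * l ^ 2"
      using k ll by (intro mult_mono) auto
    then show "5 \<le> 5 * (real k * l ^ 2)"
      by simp
  qed (use l in auto)
  \<comment> \<open>1920 is \<open>2 * 64 * 15\<close>; in the bracket, 512 and
    \<open>8 * 2 ^ 15\<close> are 8 times the bounds 64 and \<open>2 ^ 15\<close> on the numbers of
    trials.\<close>
  also have "\<dots> = (real k * real E) * (1920 * l ^ 2 + 32 * 2 ^ 15 * (512 + 8 * 2 ^ 15 + 5) * l ^ 4)"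
    by (simp add: power2_eq_square power4_eq_xxxx algebra_simps)
  also have "\<dots> \<le> (2 * T) * (2 ^ 40 * l ^ 4)"
  proof (rule mult_mono[OF kE])
    have "1920 * l ^ 2 + 32 * 2 ^ 15 * (512 + 8 * 2 ^ 15 + 5) * l ^ 4 \<le>
        1920 * l ^ 4 + 32 * 2 ^ 15 * (512 + 8 * 2 ^ 15 + 5) * l ^ 4"
      using lp[of 2] by simp
    also have "\<dots> \<le> 2 ^ 40 * l ^ 4"
      using lp[of 0] by simp
    finally show "1920 * l ^ 2 + 32 * 2 ^ 15 * (512 + 8 * 2 ^ 15 + 5) * l ^ 4 \<le> 2 ^ 40 * l ^ 4" .
  qed (use T l in auto)
  finally show ?thesis
    by (simp add: T_def l_def)
qed

text \<open>The factor 2 dominates the logarithm, by \<open>L < 2 ^ L \<le> 2 * (k + E)\<close>; the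
  constant 60 absorbs numerical factors.\<close>

definition time_base :: "nat \<Rightarrow> nat \<Rightarrow> nat \<Rightarrow> nat" where
  "time_base n k E = 2 * (n + k + E) + 60"

lemma Tester_implements:
  assumes D: "set_pmf D \<subseteq> cube n" and k: "1 \<le> k"
  shows "implements n f D Tester ((\<lambda>_. 0)(0 := n, 1 := k, 2 := E))
    (if 1 < E then junta_algorithm.algorithm n f D k (s_of (k + E)) (E * m1_of (k + E))
      (32 * (E * m2_of (k + E))) (m1_of (k + E)) (m2_of (k + E)) else return_pmf True)
    (\<lambda>ok m'. (m' 0 \<noteq> 0) = ok) (time_base n k E ^ 100) (if 1 < E then query_bound k E else 0)"
proof -
  define Y where "Y = time_base n k E"
  interpret ram n f D Y
    by unfold_locales (use D in \<open>auto simp: Y_def time_base_def\<close>)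
  define L where "L = log_ceil (k + E)"
  have "2 ^ L \<le> 2 * (k + E)"
    unfolding L_def by (rule log_ceil) (use k in simp)
  then have "L \<le> 2 * (k + E)"
    using less_exp[of L] by linarith
  then have L: "L \<le> Y"
    by (simp add: Y_def time_base_def)
  have Y60: "60 \<le> Y"
    by (simp add: Y_def time_base_def)
  have YY: "9 * Y \<le> Y ^ 2"
    using Y60 mult_le_mono1[of 9 Y Y] by (simp add: power2_eq_square)
  have m1_le: "m1_of (k + E) \<le> 9 * Y"
    using L Y60 by (simp add: m1_of_def L_def)
  then have m1: "m1_of (k + E) \<le> Y ^ 2"
    using YY by (rule le_trans)
  have m1': "m1_of (k + E) * m1_of (k + E) \<le> (9 * Y) * (9 * Y)"
    by (intro mult_le_mono m1_le)
  have "m2_of (k + E) \<le> 648 * (Y * Y)"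
    using m1' by (simp add: m2_of_def)
  also have "\<dots> \<le> (Y * Y) * (Y * Y)"
    using mult_le_mono[OF Y60 Y60] by (intro mult_le_mono1) simp
  also have "\<dots> = Y ^ 4"
    by (simp add: power4_eq_xxxx)
  also have "\<dots> \<le> Y ^ 5"
    by (rule Y_power_mono) simp
  finally have m2: "m2_of (k + E) \<le> Y ^ 5" .
  have "s_of (k + E) \<le> 9 * Y"
    using L Y60 by (simp add: s_of_def L_def)
  then have s: "s_of (k + E) \<le> Y ^ 2"
    using YY by (rule le_trans)
  show ?thesis
    using spec_Tester[where m = "(\<lambda>_. 0)(0 := n, 1 := k, 2 := E)" and k = k and E = E, OF _ _ _ _ _ _ m1 m2 s]
    unfolding spec_def by (simp add: Y_def time_base_def)
qed

section \<open>Correctness, running time and queries of the tester\<close>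

lemma Tester_start:
  "start Tester n k \<epsilon> = ([Tester], (\<lambda>_. 0)(0 := n, 1 := k, 2 := nat \<lceil>1 / \<epsilon>\<rceil>), 0)"
  by (simp add: start_def)

lemma real_nat_ceiling:
  assumes "0 < (\<epsilon> :: real)"
  shows "1 / \<epsilon> \<le> real (nat \<lceil>1 / \<epsilon>\<rceil>)" "real (nat \<lceil>1 / \<epsilon>\<rceil>) < 1 / \<epsilon> + 1" "1 \<le> nat \<lceil>1 / \<epsilon>\<rceil>"
proof -
  have "0 < \<lceil>1 / \<epsilon>\<rceil>"
    using assms by simp
  then have "real (nat \<lceil>1 / \<epsilon>\<rceil>) = real_of_int \<lceil>1 / \<epsilon>\<rceil>" and "1 \<le> nat \<lceil>1 / \<epsilon>\<rceil>"
    by linarith+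
  then show "1 / \<epsilon> \<le> real (nat \<lceil>1 / \<epsilon>\<rceil>)" "real (nat \<lceil>1 / \<epsilon>\<rceil>) < 1 / \<epsilon> + 1" "1 \<le> nat \<lceil>1 / \<epsilon>\<rceil>"
    by linarith+
qed

text \<open>The disagreements of \<open>f\<close> with the two constants add up to 1. Consequently a
  far function forces \<open>1 / \<epsilon> \<ge> 2\<close>, and the branch without queries is never
  taken for it.\<close>

lemma not_eps_far:
  assumes "eps_far D \<epsilon> (juntas n k) f"
  shows "\<epsilon> \<le> 1 / 2"
proof -
  have const: "(\<lambda>_. c) \<in> juntas n k" for c
    by (simp add: juntas_def depends_on_def)
  have "measure_pmf.prob D {x. f x \<noteq> False} + measure_pmf.prob D {x. f x \<noteq> True} = 1"
  proof -
    have "{x. f x \<noteq> True} = UNIV - {x. f x \<noteq> False}"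
      by auto
    then show ?thesis
      using measure_pmf.prob_compl[of "{x. f x \<noteq> False}" D] by simp
  qed
  moreover have far: "\<epsilon> \<le> measure_pmf.prob D {x. f x \<noteq> c}" for c
    by (rule assms[unfolded eps_far_def, rule_format, OF const])
  ultimately show ?thesis
    using far[of False] far[of True] by linarith
qed

lemma Tester_correct: "junta_tester Tester"
  unfolding junta_tester_def
proof (intro allI impI)
  fix n k :: nat and \<epsilon> :: real and f :: "bool list \<Rightarrow> bool" and D :: "bool list pmf"
  assume k: "1 \<le> k" and \<epsilon>: "0 < \<epsilon>" and D: "set_pmf D \<subseteq> cube n"
  interpret junta_algorithm n f D
    by unfold_locales (rule D)
  let ?E = "nat \<lceil>1 / \<epsilon>\<rceil>"
  note E = real_nat_ceiling[OF \<epsilon>]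
  note probs = accept_prob_ge[OF Tester_implements[OF D k] Tester_start]
  show "(f \<in> juntas n k \<longrightarrow> 2 / 3 \<le> accept_prob Tester n k \<epsilon> f D) \<and>
    (eps_far D \<epsilon> (juntas n k) f \<longrightarrow> 2 / 3 \<le> reject_prob Tester n k \<epsilon> f D)"
  proof (intro conjI impI)
    assume f: "f \<in> juntas n k"
    have "2 / 3 \<le> pmf (if 1 < ?E then algorithm k (s_of (k + ?E)) (?E * m1_of (k + ?E))
      (32 * (?E * m2_of (k + ?E))) (m1_of (k + ?E)) (m2_of (k + ?E)) else return_pmf True) True"
      using numeric_completeness[OF f k E(3)] by simp
    then show "2 / 3 \<le> accept_prob Tester n k \<epsilon> f D"
      using probs(1) by (rule order_trans)
  next
    assume far: "eps_far D \<epsilon> (juntas n k) f"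
    then have half: "\<epsilon> \<le> 1 / 2"
      by (rule not_eps_far)
    then have "2 \<le> 1 / \<epsilon>"
      using \<epsilon> by (simp add: field_simps)
    then have E2: "2 \<le> ?E"
      using E(1) by linarith
    have \<epsilon>E: "1 \<le> \<epsilon> * real ?E"
      using mult_left_mono[OF E(1), of \<epsilon>] \<epsilon> by simp
    have E1: "1 < ?E"
      using E2 by linarith
    have "2 / 3 \<le> pmf (if 1 < ?E then algorithm k (s_of (k + ?E)) (?E * m1_of (k + ?E))
      (32 * (?E * m2_of (k + ?E))) (m1_of (k + ?E)) (m2_of (k + ?E)) else return_pmf True) False"
      unfolding if_P[OF E1] by (rule numeric_soundness[OF far k E2 \<epsilon> _ \<epsilon>E]) (use half in simp)
    then show "2 / 3 \<le> reject_prob Tester n k \<epsilon> f D"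
      using probs(2) by (rule order_trans)
  qed
qed

lemma Tester_polynomial_time: "polynomial_time Tester"
  unfolding polynomial_time_def
proof (intro exI allI impI conjI)
  fix n k :: nat and \<epsilon> :: real and f :: "bool list \<Rightarrow> bool" and D :: "bool list pmf"
  assume k: "1 \<le> k" and \<epsilon>: "0 < \<epsilon>" and D: "set_pmf D \<subseteq> cube n"
  let ?E = "nat \<lceil>1 / \<epsilon>\<rceil>"
  show "\<forall>s\<in>set_pmf (run n f D (time_base n k ?E ^ 100) (start Tester n k \<epsilon>)). halted s"
    unfolding Tester_start using halted_run(1)[OF Tester_implements[OF D k] order_refl] by blast
  have "real (time_base n k ?E) = 2 * (real n + real k + real ?E) + 60"
    unfolding time_base_def by (simp only: of_nat_add of_nat_mult of_nat_numeral)
  moreover have "0 < 1 / \<epsilon>"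
    using \<epsilon> by simp
  \<comment> \<open>62 is \<open>2 + 60\<close>, since the bracket is at least 1; its summand 1 also
    pays for rounding \<open>1 / \<epsilon>\<close> up.\<close>
  ultimately have "real (time_base n k ?E) \<le> 62 * (real n + real k + 1 / \<epsilon> + 1)"
    using real_nat_ceiling(2)[OF \<epsilon>] of_nat_0_le_iff[of n] of_nat_0_le_iff[of k] unfolding distrib_left by linarith
  then have "real (time_base n k ?E) ^ 100 \<le> (62 * (real n + real k + 1 / \<epsilon> + 1)) ^ 100"
    by (rule power_mono) simp
  then show "real (time_base n k ?E ^ 100) \<le> real (62 ^ 100) * (real n + real k + 1 / \<epsilon> + 1) ^ 100"
    by (simp only: of_nat_power of_nat_numeral power_mult_distrib)
qed

lemma Tester_queries: "soft_O_queries Tester (\<lambda>k \<epsilon>. real k / \<epsilon>)"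
  unfolding soft_O_queries_def
proof (intro exI allI impI ballI)
  fix n k t :: nat and \<epsilon> :: real and f :: "bool list \<Rightarrow> bool" and D :: "bool list pmf" and s
  assume k: "1 \<le> k" and \<epsilon>: "0 < \<epsilon>" and D: "set_pmf D \<subseteq> cube n"
    and s: "s \<in> set_pmf (run n f D t (start Tester n k \<epsilon>))"
  let ?E = "nat \<lceil>1 / \<epsilon>\<rceil>"
  note E = real_nat_ceiling[OF \<epsilon>]
  have q: "queries s \<le> (if 1 < ?E then query_bound k ?E else 0)"
    by (rule queries_run_le[OF Tester_implements[OF D k] s[unfolded Tester_start]])
  show "real (queries s) \<le> real (2 ^ 41) * (real k / \<epsilon>) * log 2 (real k / \<epsilon> + 2) ^ 4"
  proof (cases "1 < ?E")
    case True
    then have "1 < 1 / \<epsilon>"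
      using E(2) by linarith
    then have "\<epsilon> \<le> 1" "real ?E \<le> 2 / \<epsilon>"
      using \<epsilon> E(2) by (simp_all add: field_simps)
    then have "real (query_bound k ?E) \<le> 2 ^ 41 * (real k / \<epsilon>) * log 2 (real k / \<epsilon> + 2) ^ 4"
      by (intro query_bound_le k \<epsilon> E(3))
    then show ?thesis
      using q True by simp
  next
    case False
    then show ?thesis
      using q \<epsilon> by simp
  qed
qed

theorem theorem6:
  "\<exists>P :: com. junta_tester P \<and> polynomial_time P \<and> soft_O_queries P (\<lambda>k \<epsilon>. real k / \<epsilon>)"
  using Tester_correct Tester_polynomial_time Tester_queries by blast

end
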